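(* Fix $\varpi>1$. For $\beta>1$ let $T_\beta(x)=\beta x \bmod 1$ on $[0,1]$ and consider the classes $\mathcal{T}=\{T_{\beta},T_{\varpi\beta}\}$ and $\mathcal{H}=\{[0,\tfrac12],(\tfrac12,1]\}$. There exist a set $\mathcal{B}\subset(1,\infty)$ and $C>0$, with $\mathrm{Leb}(\mathcal{B}\cap(1,t))\le C\log t$ for all $t>1$, such that for every $\beta\in(1,\infty)\setminus\mathcal{B}$ the pair $(\mathcal{T},\mathcal{H})$ satisfies conditions (C1), (C2) and (C3($n_2,n_3$)) for some $n_3\ge n_2$, where these conditions and the integer $n_2=n_2(\mathcal{T},\mathcal{H})$ are defined in the context.
   Context: Let $\mathcal{T}$ be a finite set of piecewise $C^2$ uniformly expanding maps of $[0,1]$ and $\mathcal{H}$ a finite set of subintervals of $[0,1]$. Let $\Sigma=\mathcal{T}\times\mathcal{H}$; for $\sigma=(\sigma_1,\sigma_2,\dots)\in\Sigma^{\mathbb{N}}$ write $\sigma_k=(T_{\sigma_k},H_{\sigma_k})$; $\tau$ is the unilateral shift. $\mathcal{L}_T$ denotes the transfer operator of $T$ with respect to Lebesgue measure. Put $T^n_\sigma=T_{\sigma_n}\circ\cdots\circ T_{\sigma_1}$, $H^n_\sigma=\bigcap_{j=0}^{n-1}(T^j_\sigma)^{-1}(H_{\sigma_{j+1}})$, $\widehat{\mathcal{L}}_{\sigma_k}f=\mathcal{L}_{T_{\sigma_k}}(f\mathbf{1}_{H_{\sigma_k}})$, $\widehat{\mathcal{L}}^n_\sigma=\widehat{\mathcal{L}}_{\sigma_n}\cdots\widehat{\mathcal{L}}_{\sigma_1}$.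 Let $g_{\sigma_k}=\mathbf{1}_{H_{\sigma_k}}/|T_{\sigma_k}'|$, $g^n_\sigma=g_{\sigma_1}\cdot g_{\sigma_2}\circ T^1_\sigma\cdots g_{\sigma_n}\circ T_\sigma^{n-1}$ and $\Theta^{-1}=\inf_{T\in\mathcal{T}}\inf|T'|$. Functions are taken modulo null sets (inf/sup are essential) and interval partitions modulo endpoints. (C1) There is $\delta_\star>0$ with $\inf\widehat{\mathcal{L}}_{\sigma_1}\mathbf{1}\ge\delta_\star$ for all $\sigma_1\in\Sigma$. Under (C1) define $\Lambda_\sigma(f)=\lim_{n\to\infty}\inf\frac{\widehat{\mathcal{L}}^n_\sigma f}{\widehat{\mathcal{L}}^n_\sigma\mathbf{1}}$ (a bounded increasing limit), $\rho_\sigma=\Lambda_{\tau\sigma}(\widehat{\mathcal{L}}_{\sigma_1}\mathbf{1})$, $\rho=\inf_{\sigma}\rho_\sigma$. Let $\mathcal{Z}^n_\sigma$ be the partition into smoothness intervals of $T^n_\sigma$, and $\widehat{\mathcal{Z}}^n_\sigma$ the coarsest partition finer than $\mathcal{Z}^n_\sigma$ whose elements are either disjoint from $\overline{H^n_\sigma}$ or contained in $H^n_\sigma$. Let $\mathcal{Z}^n_{\sigma,\star}=\{Z\in\widehat{\mathcal{Z}}^n_\sigma: Z\subset H^n_\sigma\}$, $\mathcal{Z}^n_{\sigma,b}=\{Z\in\mathcal{Z}^n_{\sigma,\star}:\Lambda_\sigma(\mathbf{1}_Z)=0\}$, $\mathcal{Z}^n_{\sigma,g}=\{Z\in\mathcal{Z}^n_{\sigma,\star}:\Lambda_\sigma(\mathbf{1}_Z)>0\}$.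 Two elements of $\mathcal{Z}^n_{\sigma,\star}$ are called contiguous if they are contiguous in the usual sense or are separated by a connected component of $(H^n_\sigma)^c$. (C2) There exist $K\ge0$, $\xi\ge1$ such that for all $n$ and $\sigma$ at most $K\xi^n$ elements of $\mathcal{Z}^n_{\sigma,b}$ are contiguous (successively), and $\theta:=\xi\Theta<\min\{\rho,1\}$. (C3($N,N'$)) $\hat\epsilon(N,N'):=\min_{1\le k\le N}\inf_{\sigma}\min_{Z\in\mathcal{Z}^k_{\sigma,g}}\inf_{x}\frac{(\widehat{\mathcal{L}}^{N'}_\sigma\mathbf{1}_Z)(x)}{(\widehat{\mathcal{L}}^{N'}_\sigma\mathbf{1})(x)}>0$. The integer $n_2$ (for the constants $K,\xi$ for which (C2) is verified). Let $\epsilon_\star(n)=\min\{\hat\epsilon(n,m):m\ge n,\ \hat\epsilon(n,m)>0\}$ ($=0$ if there is no such $m$). Let $C_{\mathrm{d}}$ be a constant with $\bigvee_Zg^n_\sigma\le C_{\mathrm{d}}\|g^n_\sigma\|_\infty$ for all $n,\sigma$, $Z\in\mathcal{Z}^n_{\sigma,\star}$ ($\bigvee$ is total variation; for piecewise linear maps one takes $C_{\mathrm{d}}=0$). Put $C_\star=3(C_{\mathrm{d}}+1)+2K(3C_{\mathrm{d}}+2)$, $C_n=(3C_{\mathrm{d}}+2)(2K\xi+1)\Theta/\epsilon_\star(n)$ ($=\infty$ if $\epsilon_\star(n)=0$), $n_0=\lceil\ln(4C_\star^2)/\ln(\rho\theta^{-1})\rceil$. If $\epsilon_\star(n_0)=0$,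 $n_2=n_0$. If $\epsilon_\star(n_0)>0$, let $a=\max\{1,\frac{15}{11}\max_{1\le i\le n_0}\frac{C_i}{C_\star\theta^i}\}$, $B=1+2aC_\star$ and $n_2=\left\lceil\frac{\ln(4aB(1+2C_{n_0}\rho^{-n_0}))}{\ln(\theta^{-1}\rho)}\right\rceil$. *)

theory Defs
  imports "HOL-Analysis.Analysis"
begin

text \<open>
  A map of the unit interval is a function on the reals of which only the restriction to
  \<open>{0..1}\<close> matters; a symbol is a pair consisting of a map and an interval.  Words
  \<open>\<sigma>\<close> are indexed from 0, so \<open>\<sigma> k\<close> is the letter usually written
  \<open>\<sigma>\<^sub>k\<^sub>+\<^sub>1\<close>.  The definitions are meant for a finite set \<open>\<T>\<close> of piecewise C2 uniformly
  expanding maps and a finite set \<open>\<H>\<close> of subintervals of \<open>{0..1}\<close>.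
\<close>

type_synonym symb = "(real \<Rightarrow> real) \<times> real set"

definition words :: "(real \<Rightarrow> real) set \<Rightarrow> real set set \<Rightarrow> (nat \<Rightarrow> symb) set" where
  "words \<T> \<H> = {\<sigma>. \<forall>k. \<sigma> k \<in> \<T> \<times> \<H>}"

definition shift :: "(nat \<Rightarrow> symb) \<Rightarrow> (nat \<Rightarrow> symb)" where
  "shift \<sigma> = (\<lambda>k. \<sigma> (Suc k))"

text \<open>
  Essential bounds with respect to Lebesgue measure on the unit interval.  As suprema and infima
  of sets of reals these are meaningful for functions that are essentially bounded on the
  relevant side; no measurability is built in.
\<close>

definition ess_inf :: "(real \<Rightarrow> real) \<Rightarrow> real" where
  "ess_inf f = Sup {c. AE x in lebesgue_on {0..1}. c \<le> f x}"

definition ess_sup :: "(real \<Rightarrow> real) \<Rightarrow> real" where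
  "ess_sup f = Inf {c. AE x in lebesgue_on {0..1}. f x \<le> c}"


section \<open>Transfer operators\<close>

text \<open>
  The transfer operator with respect to Lebesgue measure of a map with finitely many monotone
  branches.  At the finitely many points where the map is not differentiable the
  value of \<^const>\<open>deriv\<close> is irrelevant, since this affects the result on a null set only.
\<close>

definition transfer :: "(real \<Rightarrow> real) \<Rightarrow> (real \<Rightarrow> real) \<Rightarrow> (real \<Rightarrow> real)" where
  "transfer T f = (\<lambda>x. \<Sum>y | y \<in> {0..1} \<and> T y = x. f y / \<bar>deriv T y\<bar>)"

definition transfer_open :: "symb \<Rightarrow> (real \<Rightarrow> real) \<Rightarrow> (real \<Rightarrow> real)" where
  "transfer_open s f = transfer (fst s) (\<lambda>x. f x * indicator (snd s) x)"

fun iter_transfer :: "(nat \<Rightarrow> symb) \<Rightarrow> nat \<Rightarrow> (real \<Rightarrow> real) \<Rightarrow> (real \<Rightarrow> real)" where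
  "iter_transfer \<sigma> 0 f = f"
| "iter_transfer \<sigma> (Suc n) f = transfer_open (\<sigma> n) (iter_transfer \<sigma> n f)"

fun iter_map :: "(nat \<Rightarrow> symb) \<Rightarrow> nat \<Rightarrow> real \<Rightarrow> real" where
  "iter_map \<sigma> 0 = id"
| "iter_map \<sigma> (Suc n) = fst (\<sigma> n) \<circ> iter_map \<sigma> n"

definition surviving :: "(nat \<Rightarrow> symb) \<Rightarrow> nat \<Rightarrow> real set" where
  "surviving \<sigma> n = {x \<in> {0..1}. \<forall>j<n. iter_map \<sigma> j x \<in> snd (\<sigma> j)}"

definition weight :: "symb \<Rightarrow> real \<Rightarrow> real" where
  "weight s x = indicator (snd s) x / \<bar>deriv (fst s) x\<bar>"

definition iter_weight :: "(nat \<Rightarrow> symb) \<Rightarrow> nat \<Rightarrow> real \<Rightarrow> real" where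
  "iter_weight \<sigma> n x = (\<Prod>j<n. weight (\<sigma> j) (iter_map \<sigma> j x))"

definition Theta :: "(real \<Rightarrow> real) set \<Rightarrow> real" where
  "Theta \<T> = inverse (INF T\<in>\<T>. ess_inf (\<lambda>x. \<bar>deriv T x\<bar>))"

definition C1 :: "(real \<Rightarrow> real) set \<Rightarrow> real set set \<Rightarrow> bool" where
  "C1 \<T> \<H> \<longleftrightarrow> (\<exists>\<delta>>0. \<forall>s \<in> \<T> \<times> \<H>. ess_inf (transfer_open s (\<lambda>_. 1)) \<ge> \<delta>)"

definition Lambda :: "(nat \<Rightarrow> symb) \<Rightarrow> (real \<Rightarrow> real) \<Rightarrow> real" where
  "Lambda \<sigma> f =
     lim (\<lambda>n. ess_inf (\<lambda>x. iter_transfer \<sigma> n f x / iter_transfer \<sigma> n (\<lambda>_. 1) x))"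

definition rho_word :: "(nat \<Rightarrow> symb) \<Rightarrow> real" where
  "rho_word \<sigma> = Lambda (shift \<sigma>) (transfer_open (\<sigma> 0) (\<lambda>_. 1))"

definition rho :: "(real \<Rightarrow> real) set \<Rightarrow> real set set \<Rightarrow> real" where
  "rho \<T> \<H> = (INF \<sigma>\<in>words \<T> \<H>. rho_word \<sigma>)"


section \<open>Partitions\<close>

text \<open>
  Interval partitions are taken modulo endpoints: every partition element is represented by its
  interior, a nonempty open interval.  The smoothness intervals of \<open>T\<close> are the
  maximal open subintervals of the unit interval on which \<open>T\<close> is C2.
\<close>

definition C2_near :: "(real \<Rightarrow> real) \<Rightarrow> real \<Rightarrow> bool" where
  "C2_near T x \<longleftrightarrow>
     (\<exists>U. open U \<and> x \<in> U \<and> T C1_differentiable_on U \<and> deriv T C1_differentiable_on U)"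

definition smooth_partition :: "(nat \<Rightarrow> symb) \<Rightarrow> nat \<Rightarrow> real set set" where
  "smooth_partition \<sigma> n = components {x \<in> {0<..<1}. C2_near (iter_map \<sigma> n) x}"

text \<open>
  Representatives modulo null sets of the surviving set and of its complement, which drop
  isolated points.
\<close>

definition surviving_open :: "(nat \<Rightarrow> symb) \<Rightarrow> nat \<Rightarrow> real set" where
  "surviving_open \<sigma> n = interior (surviving \<sigma> n)"

definition hole :: "(nat \<Rightarrow> symb) \<Rightarrow> nat \<Rightarrow> real set" where
  "hole \<sigma> n = {0..1} - closure (surviving_open \<sigma> n)"

text \<open>
  The coarsest refinement of the smoothness partition into intervals that lie inside or outside
  the surviving set cuts every element \<open>Z\<close> into the connected components of its
  two parts.
\<close>

definition refined_partition :: "(nat \<Rightarrow> symb) \<Rightarrow> nat \<Rightarrow> real set set" where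
  "refined_partition \<sigma> n =
     (\<Union>Z\<in>smooth_partition \<sigma> n. components (Z \<inter> surviving_open \<sigma> n) \<union> components (Z \<inter> hole \<sigma> n))"

definition Z_star :: "(nat \<Rightarrow> symb) \<Rightarrow> nat \<Rightarrow> real set set" where
  "Z_star \<sigma> n = {Z \<in> refined_partition \<sigma> n. Z \<subseteq> surviving \<sigma> n}"

definition Z_bad :: "(nat \<Rightarrow> symb) \<Rightarrow> nat \<Rightarrow> real set set" where
  "Z_bad \<sigma> n = {Z \<in> Z_star \<sigma> n. Lambda \<sigma> (indicator Z) = 0}"

definition Z_good :: "(nat \<Rightarrow> symb) \<Rightarrow> nat \<Rightarrow> real set set" where
  "Z_good \<sigma> n = {Z \<in> Z_star \<sigma> n. Lambda \<sigma> (indicator Z) > 0}"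

definition left_neighbour :: "(nat \<Rightarrow> symb) \<Rightarrow> nat \<Rightarrow> real set \<Rightarrow> real set \<Rightarrow> bool" where
  "left_neighbour \<sigma> n Z Z' \<longleftrightarrow>
     Sup Z = Inf Z' \<or> (\<exists>J\<in>components (hole \<sigma> n). Sup Z = Inf J \<and> Sup J = Inf Z')"

definition contiguous :: "(nat \<Rightarrow> symb) \<Rightarrow> nat \<Rightarrow> real set \<Rightarrow> real set \<Rightarrow> bool" where
  "contiguous \<sigma> n Z Z' \<longleftrightarrow> left_neighbour \<sigma> n Z Z' \<or> left_neighbour \<sigma> n Z' Z"

definition C2 :: "(real \<Rightarrow> real) set \<Rightarrow> real set set \<Rightarrow> real \<Rightarrow> real \<Rightarrow> bool" where
  "C2 \<T> \<H> K \<xi> \<longleftrightarrow> K \<ge> 0 \<and> \<xi> \<ge> 1 \<and>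
     (\<forall>n. \<forall>\<sigma>\<in>words \<T> \<H>. \<forall>Zs. distinct Zs \<and> set Zs \<subseteq> Z_bad \<sigma> n \<and> successively (contiguous \<sigma> n) Zs
        \<longrightarrow> real (length Zs) \<le> K * \<xi> ^ n) \<and>
     \<xi> * Theta \<T> < min (rho \<T> \<H>) 1"

text \<open>Extended-real valued, so that an infimum over no good interval at all is infinite.\<close>

definition eps_hat :: "(real \<Rightarrow> real) set \<Rightarrow> real set set \<Rightarrow> nat \<Rightarrow> nat \<Rightarrow> ereal" where
  "eps_hat \<T> \<H> N N' =
     (INF k\<in>{1..N}. INF \<sigma>\<in>words \<T> \<H>. INF Z\<in>Z_good \<sigma> k.
        ereal (ess_inf (\<lambda>x. iter_transfer \<sigma> N' (indicator Z) x / iter_transfer \<sigma> N' (\<lambda>_. 1) x)))"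

definition C3 :: "(real \<Rightarrow> real) set \<Rightarrow> real set set \<Rightarrow> nat \<Rightarrow> nat \<Rightarrow> bool" where
  "C3 \<T> \<H> N N' \<longleftrightarrow> eps_hat \<T> \<H> N N' > 0"


section \<open>The constant \<open>n\<^sub>2\<close>\<close>

text \<open>
  Under \<^const>\<open>C1\<close> the number \<open>eps_hat \<T> \<H> n m\<close> is
  nondecreasing in \<open>m\<close>, so the infimum below is a minimum.
\<close>

definition eps_star :: "(real \<Rightarrow> real) set \<Rightarrow> real set set \<Rightarrow> nat \<Rightarrow> ereal" where
  "eps_star \<T> \<H> n =
     (if \<exists>m\<ge>n. eps_hat \<T> \<H> n m > 0
      then INF m\<in>{m. m \<ge> n \<and> eps_hat \<T> \<H> n m > 0}. eps_hat \<T> \<H> n m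
      else 0)"

definition variation_on :: "(real \<Rightarrow> real) \<Rightarrow> real set \<Rightarrow> ereal" where
  "variation_on f Z = (SUP xs\<in>{xs. sorted xs \<and> set xs \<subseteq> Z}.
     ereal (\<Sum>i<length xs - 1. \<bar>f (xs ! Suc i) - f (xs ! i)\<bar>))"

definition distortion_const :: "(real \<Rightarrow> real) set \<Rightarrow> real set set \<Rightarrow> real \<Rightarrow> bool" where
  "distortion_const \<T> \<H> Cd \<longleftrightarrow> Cd \<ge> 0 \<and>
     (\<forall>n. \<forall>\<sigma>\<in>words \<T> \<H>. \<forall>Z\<in>Z_star \<sigma> n.
        variation_on (iter_weight \<sigma> n) Z \<le> ereal (Cd * ess_sup (\<lambda>x. \<bar>iter_weight \<sigma> n x\<bar>)))"

definition C_star :: "real \<Rightarrow> real \<Rightarrow> real" where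
  "C_star Cd K = 3 * (Cd + 1) + 2 * K * (3 * Cd + 2)"

text \<open>The numerator is positive, so the value is infinite when \<^const>\<open>eps_star\<close> vanishes.\<close>

definition C_n ::
  "(real \<Rightarrow> real) set \<Rightarrow> real set set \<Rightarrow> real \<Rightarrow> real \<Rightarrow> real \<Rightarrow> nat \<Rightarrow> ereal" where
  "C_n \<T> \<H> Cd K \<xi> n =
     ereal ((3 * Cd + 2) * (2 * K * \<xi> + 1) * Theta \<T>) / eps_star \<T> \<H> n"

definition n0 :: "(real \<Rightarrow> real) set \<Rightarrow> real set set \<Rightarrow> real \<Rightarrow> real \<Rightarrow> real \<Rightarrow> nat" where
  "n0 \<T> \<H> Cd K \<xi> =
     nat \<lceil>ln (4 * (C_star Cd K)\<^sup>2) / ln (rho \<T> \<H> / (\<xi> * Theta \<T>))\<rceil>"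

text \<open>
  If \<open>eps_star\<close> is positive at \<open>n0\<close> then it is positive at all
  \<open>i \<le> n0\<close>, so all the \<^const>\<open>C_n\<close> used are finite.
\<close>

definition n2 :: "(real \<Rightarrow> real) set \<Rightarrow> real set set \<Rightarrow> real \<Rightarrow> real \<Rightarrow> real \<Rightarrow> nat" where
  "n2 \<T> \<H> Cd K \<xi> =
     (let \<theta> = \<xi> * Theta \<T>;
          \<rho> = rho \<T> \<H>;
          Cs = C_star Cd K;
          m = n0 \<T> \<H> Cd K \<xi>;
          C = (\<lambda>i. real_of_ereal (C_n \<T> \<H> Cd K \<xi> i));
          a = max 1 (15 / 11 * Max ((\<lambda>i. C i / (Cs * \<theta> ^ i)) ` {1..m}));
          B = 1 + 2 * a * Cs
      in if eps_star \<T> \<H> m = 0 then m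
         else nat \<lceil>ln (4 * a * B * (1 + 2 * C m / \<rho> ^ m)) / ln (\<rho> / \<theta>)\<rceil>)"


section \<open>Beta maps\<close>

definition beta_map :: "real \<Rightarrow> real \<Rightarrow> real" where
  "beta_map \<beta> x = frac (\<beta> * x)"

definition beta_maps :: "real \<Rightarrow> real \<Rightarrow> (real \<Rightarrow> real) set" where
  "beta_maps \<omega> \<beta> = {beta_map \<beta>, beta_map (\<omega> * \<beta>)}"

definition half_intervals :: "real set set" where
  "half_intervals = {{0..1/2}, {1/2<..1}}"

end

theory Submission
  imports Defs
begin

text \<open>
  For large \<open>\<beta>\<close> both maps have many full branches inside either half of the unit interval, so an
  open transfer operator maps the constant 1 to a function with values between 1/4 and 2.  This
  yields \<^const>\<open>C1\<close> and \<open>\<rho> \<ge> 1/4\<close>.  Away from the discontinuities a letter has constant weight on its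
  interval, which makes 0 a distortion constant, and \<open>\<Theta> = 1/\<beta>\<close>.

  The partition elements inside the surviving set are the components of an open set of live points,
  and the iterated map is affine on each of them.  An element whose image is the whole interval
  \<open>(0,1)\<close> is called full; full elements are good (\<open>full_good\<close>).  Condition \<^const>\<open>C2\<close> holds with
  \<open>K = 4\<close> and \<open>\<xi> = 2\<close>: of three children of one element the middle one is full
  (\<open>middle_child_full\<close>), so a run of elements that are not full contains at most two children of
  each parent, and all but at most two of the parents belong to a run of the same kind one level
  below.  The maximal lengths \<open>a\<^sub>n\<close> of such runs thus satisfy \<open>a\<^sub>n \<le> 2 (a\<^sub>n\<^sub>-\<^sub>1 + 2)\<close>.

  Only \<^const>\<open>C3\<close> asks for more than a lower bound on \<open>\<beta>\<close>.  Suppose that the orbits of the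
  cut points 1/2 and 1 keep, for \<open>N\<close> steps, the distance \<open>3/\<beta>\<close> from the multiples of 1/2 before reduction modulo 1.  Then up to
  level \<open>N\<close> the image of every element is an interval sharing an endpoint with \<open>(0,1)\<close> whose other
  endpoint is either the other end of \<open>(0,1)\<close> or at least \<open>3/\<beta>\<close> away from 0, 1/2 and 1
  (\<open>component_shape\<close>).  Such an interval either misses the next half interval, and then the
  element is bad, or meets it in an interval of length at least \<open>3/\<beta>\<close>, which contains a full
  branch, and then the ratio in \<^const>\<open>C3\<close> is bounded below one step later
  (\<open>dies_or_full\<close>).  So C3 with parameters \<open>k\<close> and \<open>N + 1\<close> holds for every \<open>k \<le> N\<close>.

  It remains to see that \<open>n\<^sub>2\<close> is bounded.  The same dichotomy gives
  \<open>\<epsilon>\<^sub>\<star>(1) \<ge> (2\<omega>\<beta>)\<^sup>-\<^sup>2\<close>; since \<open>n\<^sub>0 = 1\<close> for large \<open>\<beta>\<close>, the logarithm in the definition of \<open>n\<^sub>2\<close> is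
  taken of a quantity of order \<open>\<beta>\<^sup>5\<close> and divided by \<open>ln (\<rho>/\<theta>)\<close> with \<open>\<rho>/\<theta> \<ge> \<beta>/8\<close>.  Hence \<open>n\<^sub>2 \<le> 6\<close> for
  \<open>\<beta> \<ge> 2 \<cdot> 10\<^sup>1\<^sup>2 \<omega>\<^sup>6\<close> (\<open>n2_le_6\<close>), and \<open>N = 6\<close> suffices.

  The parameters in \<open>[m, m + 1]\<close> that violate the separation are counted by itineraries, the
  sequences of integer parts along the critical orbit.  On the parameters with a given itinerary of
  length \<open>j\<close> the unreduced orbit point grows at rate at least \<open>m\<^sup>j/2\<close>, so it is close to a given
  multiple of 1/2 on a set of diameter of order \<open>m\<^sup>-\<^sup>j\<^sup>-\<^sup>1\<close>; there are only \<open>O(m\<^sup>j)\<close> pairs of an itinerary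
  and such a multiple.  The exceptional set therefore has measure \<open>O(1/m)\<close> in \<open>[m, m + 1]\<close>, and
  summation over \<open>m \<le> t\<close> produces the logarithm.
\<close>

section \<open>Disjoint intervals on the line\<close>

text \<open>
  The comparison is made through a choice \<open>p\<close> of points in the intervals, so that the
  outer bounds \<open>p Z1\<close> and \<open>p Z3\<close> can be taken in a prescribed subset of the line.
\<close>

lemma three_ordered_intervals:
  fixes S :: "real set set"
  assumes "\<And>Z. Z \<in> S \<Longrightarrow> is_interval Z \<and> p Z \<in> Z"
    and "\<And>Z Z'. Z \<in> S \<Longrightarrow> Z' \<in> S \<Longrightarrow> Z \<noteq> Z' \<Longrightarrow> Z \<inter> Z' = {}"
    and "card S \<ge> 3"
  obtains (ordered) Z1 Z2 Z3 where "Z1 \<in> S" "Z2 \<in> S" "Z3 \<in> S" "Z2 \<subseteq> {p Z1<..<p Z3}"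
proof -
  obtain A where A: "A \<subseteq> S" "card A = 3"
    using assms(3) by (meson obtain_subset_with_card_n)
  then obtain P Q R where PQR: "A = {P, Q, R}" "P \<noteq> Q" "P \<noteq> R" "Q \<noteq> R"
    using card_3_iff by metis
  have in_S: "P \<in> S" "Q \<in> S" "R \<in> S" using A PQR by auto
  have pts: "p P \<in> P" "p Q \<in> Q" "p R \<in> R" using assms(1) in_S by auto
  have disj: "P \<inter> Q = {}" "P \<inter> R = {}" "Q \<inter> R = {}" using assms(2) in_S PQR by auto
  have "p P \<noteq> p Q" "p P \<noteq> p R" "p Q \<noteq> p R" using disj pts by auto
  have between: "Y \<subseteq> {x<..<z}"
    if "X \<in> S" "Y \<in> S" "Z \<in> S" "x \<in> X" "y \<in> Y" "z \<in> Z" "x < y" "y < z" "X \<inter> Y = {}" "Y \<inter> Z = {}"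
    for X Y Z x y z
  proof
    fix t assume t: "t \<in> Y"
    have "is_interval Y" using assms(1) that by auto
    then have mem: "u \<in> Y" if "a \<in> Y" "b \<in> Y" "a \<le> u" "u \<le> b" for a b u
      using that unfolding is_interval_1 by blast
    have "\<not> t \<le> x" using mem[OF t \<open>y \<in> Y\<close>, of x] that by auto
    moreover have "\<not> z \<le> t" using mem[OF \<open>y \<in> Y\<close> t, of z] that by auto
    ultimately show "t \<in> {x<..<z}" by auto
  qed
  have by_points: thesis
    if "X \<in> S" "Y \<in> S" "Z \<in> S" "X \<inter> Y = {}" "Y \<inter> Z = {}" "p X < p Y" "p Y < p Z" for X Y Z
  proof (rule ordered[OF that(1-3)])
    show "Y \<subseteq> {p X<..<p Z}"
      using between[OF that(1-3), of "p X" "p Y" "p Z"] that assms(1) by blast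
  qed
  have disj': "Q \<inter> P = {}" "R \<inter> P = {}" "R \<inter> Q = {}" using disj by auto
  have "(p P < p Q \<and> p Q < p R) \<or> (p P < p R \<and> p R < p Q) \<or> (p Q < p P \<and> p P < p R)
    \<or> (p Q < p R \<and> p R < p P) \<or> (p R < p P \<and> p P < p Q) \<or> (p R < p Q \<and> p Q < p P)"
    using \<open>p P \<noteq> p Q\<close> \<open>p P \<noteq> p R\<close> \<open>p Q \<noteq> p R\<close>
    by (cases "p P < p Q"; cases "p Q < p R"; cases "p P < p R") simp_all
  then show thesis
    using by_points[OF in_S disj(1,3)] by_points[OF in_S(1,3,2) disj(2) disj'(3)]
      by_points[OF in_S(2,1,3) disj'(1) disj(2)] by_points[OF in_S(2,3,1) disj(3) disj'(2)]
      by_points[OF in_S(3,1,2) disj'(2) disj(1)] by_points[OF in_S(3,2,1) disj'(3) disj'(1)]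
    by blast
qed

section \<open>Essential bounds\<close>

lemma AE_unit_iff:
  "(AE x in lebesgue_on {0..1}. P x) \<longleftrightarrow> negligible {x \<in> {0..1::real}. \<not> P x}"
proof -
  have "(AE x in lebesgue_on {0..1}. P x) \<longleftrightarrow> (AE x in lebesgue. x \<in> {0..1} \<longrightarrow> P x)"
    by (subst AE_restrict_space_iff) auto
  also have "\<dots> \<longleftrightarrow> (\<exists>N. negligible N \<and> {x. \<not> (x \<in> {0..1} \<longrightarrow> P x)} \<subseteq> N)"
    by (rule eventually_ae_filter_negligible)
  also have "\<dots> \<longleftrightarrow> negligible {x \<in> {0..1}. \<not> P x}"
    by (auto intro: negligible_subset simp: conj_commute Collect_conj_eq)
  finally show ?thesis .
qed

lemma AE_unit_nontrivial: "\<not> (AE x in lebesgue_on {0..1::real}. False)"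
proof
  assume "AE x in lebesgue_on {0..1::real}. False"
  then have "negligible {x \<in> {0..1::real}. \<not> False}" by (rule AE_unit_iff[THEN iffD1])
  moreover have "{x \<in> {0..1}. \<not> False} = {0..1::real}" by blast
  ultimately have "negligible {0..1::real}" by metis
  then show False using negligible_interval(1)[of 0 "1::real"] by auto
qed

lemma
  fixes f :: "real \<Rightarrow> real"
  assumes "AE x in lebesgue_on {0..1}. f x \<le> M"
  shows bdd_above_essential_lower_bounds: "bdd_above {c. AE x in lebesgue_on {0..1}. c \<le> f x}" (is ?B)
    and essential_lower_bound_le: "AE x in lebesgue_on {0..1}. c \<le> f x \<Longrightarrow> c \<le> M"
proof -
  show *: "c \<le> M" if "AE x in lebesgue_on {0..1}. c \<le> f x" for c
  proof (rule ccontr)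
    assume "\<not> c \<le> M"
    have "AE x in lebesgue_on {0..1::real}. c \<le> f x \<and> f x \<le> M"
      using that assms by eventually_elim auto
    then have "AE x in lebesgue_on {0..1::real}. False"
      by (rule eventually_mono) (use \<open>\<not> c \<le> M\<close> in auto)
    then show False using AE_unit_nontrivial by blast
  qed
  then show ?B unfolding bdd_above_def by blast
qed

lemma ess_inf_ge:
  assumes "AE x in lebesgue_on {0..1}. f x \<le> M" "AE x in lebesgue_on {0..1}. c \<le> f x"
  shows "c \<le> ess_inf f"
  unfolding ess_inf_def using assms(2) bdd_above_essential_lower_bounds[OF assms(1)]
  by (intro cSup_upper) simp_all

lemma ess_inf_le:
  assumes "AE x in lebesgue_on {0..1}. f x \<le> M" "AE x in lebesgue_on {0..1}. c \<le> f x"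
  shows "ess_inf f \<le> M"
  unfolding ess_inf_def using assms(2) essential_lower_bound_le[OF assms(1)]
  by (intro cSup_least) blast+

text \<open>
  Countably many exceptional sets, one for each bound \<open>ess_inf f - 1/(k+1)\<close>, have a null union.
\<close>

lemma AE_ess_inf_le:
  assumes "AE x in lebesgue_on {0..1}. f x \<le> M" "AE x in lebesgue_on {0..1}. c \<le> f x"
  shows "AE x in lebesgue_on {0..1}. ess_inf f \<le> f x"
proof -
  have "AE x in lebesgue_on {0..1}. ess_inf f - 1 / real (Suc k) \<le> f x" for k
  proof -
    have "ess_inf f - 1 / real (Suc k) < Sup {c. AE x in lebesgue_on {0..1}. c \<le> f x}"
      unfolding ess_inf_def by simp
    then obtain d where d: "AE x in lebesgue_on {0..1}. d \<le> f x" "ess_inf f - 1 / real (Suc k) < d"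
      using less_cSupE[of "ess_inf f - 1 / real (Suc k)" "{c. AE x in lebesgue_on {0..1}. c \<le> f x}"] assms(2)
      by blast
    from d(1) show ?thesis by eventually_elim (use d(2) in linarith)
  qed
  then have "AE x in lebesgue_on {0..1}. \<forall>k. ess_inf f - 1 / real (Suc k) \<le> f x"
    by (simp add: AE_all_countable)
  then show ?thesis
  proof eventually_elim
    case (elim x)
    show ?case
    proof (rule ccontr)
      assume "\<not> ess_inf f \<le> f x"
      then obtain k where "1 / real (Suc k) < ess_inf f - f x"
        using nat_approx_posE[of "ess_inf f - f x"] by (metis not_le diff_gt_0_iff_gt)
      then show False using elim[rule_format, of k] by linarith
    qed
  qed
qed

lemma ess_inf_cong:
  assumes "AE x in lebesgue_on {0..1}. f x = g x"
  shows "ess_inf f = ess_inf g"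
proof -
  have "(AE x in lebesgue_on {0..1}. c \<le> f x) \<longleftrightarrow> (AE x in lebesgue_on {0..1}. c \<le> g x)" for c
  proof
    assume "AE x in lebesgue_on {0..1}. c \<le> f x"
    then show "AE x in lebesgue_on {0..1}. c \<le> g x" using assms by eventually_elim auto
  next
    assume "AE x in lebesgue_on {0..1}. c \<le> g x"
    then show "AE x in lebesgue_on {0..1}. c \<le> f x" using assms by eventually_elim auto
  qed
  then show ?thesis by (simp add: ess_inf_def)
qed

lemma ess_inf_const: "ess_inf (\<lambda>_. c) = c"
  using ess_inf_ge[of "\<lambda>_. c" c c] ess_inf_le[of "\<lambda>_. c" c c] by simp

section \<open>Beta maps and their transfer operators\<close>

lemma beta_map_has_derivative:
  assumes "b * y \<notin> \<int>"
  shows "(beta_map b has_real_derivative b) (at y)"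
proof -
  have "((\<lambda>y. b * y - of_int \<lfloor>b * y\<rfloor>) has_real_derivative b) (at y)"
    using floor_has_real_derivative[of y "\<lambda>y. b * y"] assms
    by (auto intro!: derivative_eq_intros continuous_intros)
  then show ?thesis by (simp add: beta_map_def[abs_def] frac_def)
qed

lemma half_interval_interior:
  assumes "H \<in> half_intervals"
  obtains u where "u = 0 \<or> u = 1/2" "interior H = {u<..<u + 1/2}"
proof -
  show thesis
    using assms that[of 0] that[of "1/2"] by (auto simp: half_intervals_def)
qed

text \<open>
  The bound 12 leaves at least \<open>b/4\<close> full branches of slope \<open>b\<close> in either half interval.
\<close>

locale beta_system =
  fixes \<omega> \<beta> :: real
  assumes omega: "1 < \<omega>" and beta: "12 \<le> \<beta>"
begin

abbreviation "maps \<equiv> beta_maps \<omega> \<beta>"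

definition slope :: "symb \<Rightarrow> real" where
  "slope s = (if fst s = beta_map \<beta> then \<beta> else \<omega> * \<beta>)"

lemma slope:
  assumes "s \<in> maps \<times> half_intervals"
  shows "fst s = beta_map (slope s)" "slope s \<in> {\<beta>, \<omega> * \<beta>}"
  using assms by (auto simp: slope_def beta_maps_def)

lemma slope_bounds:
  assumes "b \<in> {\<beta>, \<omega> * \<beta>}"
  shows "\<beta> \<le> b" "b \<le> \<omega> * \<beta>" "12 \<le> b" "0 < b"
proof -
  have "\<beta> \<le> \<omega> * \<beta>" using omega beta by simp
  moreover have "b = \<beta> \<or> b = \<omega> * \<beta>" using assms by simp
  ultimately show "\<beta> \<le> b" "b \<le> \<omega> * \<beta>" "12 \<le> b" "0 < b" using beta by linarith+
qed

text \<open>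
  The countable forward orbit of the endpoints of the half intervals.  Off this set every preimage
  again lies off it, so that pointwise inequalities propagate through the transfer operators without
  boundary cases: no regular point has a preimage at a discontinuity or at the end of a half.
\<close>

definition critical :: "real set" where
  "critical = (\<lambda>(bs, v). foldr beta_map bs v) ` (lists {\<beta>, \<omega> * \<beta>} \<times> {0, 1/2, 1})"

definition regular :: "real set" where
  "regular = {0<..<1} - critical"

lemma critical_endpoints: "0 \<in> critical" "1/2 \<in> critical" "1 \<in> critical"
  unfolding critical_def by (force intro!: image_eqI[where x = "([], _)"])+

lemma beta_map_critical:
  assumes "b \<in> {\<beta>, \<omega> * \<beta>}" "y \<in> critical"
  shows "beta_map b y \<in> critical"
proof -
  obtain bs v where "bs \<in> lists {\<beta>, \<omega> * \<beta>}" "v \<in> {0, 1/2, 1}" "y = foldr beta_map bs v"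
    using assms(2) unfolding critical_def by (auto simp del: insert_iff)
  then show ?thesis
    unfolding critical_def using assms(1) by (intro image_eqI[where x = "(b # bs, v)"]) auto
qed

lemma AE_regular: "AE x in lebesgue_on {0..1}. x \<in> regular"
proof -
  have "countable critical"
    unfolding critical_def by (intro countable_image countable_SIGMA countable_lists) auto
  then have "countable {x \<in> {0..1}. x \<notin> regular}"
    by (rule countable_subset[rotated]) (use critical_endpoints in \<open>force simp: regular_def\<close>)
  then show ?thesis unfolding AE_unit_iff 
    by (metis countable_imp_null_set_lborel negligible_iff_null_sets null_sets_completionI)
qed

lemma regularD:
  assumes "x \<in> regular"
  shows "0 < x" "x < 1" "x \<noteq> 1/2"
proof -
  show "0 < x" "x < 1" using assms by (auto simp: regular_def)
  show "x \<noteq> 1/2" using assms critical_endpoints(2) unfolding regular_def by blast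
qed

lemma regular_preimage:
  assumes "b \<in> {\<beta>, \<omega> * \<beta>}" "y \<in> {0..1}" "beta_map b y \<in> regular"
  shows "y \<in> regular" "b * y \<notin> \<int>"
proof -
  have "y \<notin> critical" using assms(1,3) beta_map_critical by (auto simp: regular_def)
  then show "y \<in> regular"
    using assms(2) critical_endpoints by (auto simp: regular_def less_le)
  show "b * y \<notin> \<int>"
    using regularD(1)[OF assms(3)] by (auto simp: beta_map_def)
qed

lemma regular_in_half_iff:
  assumes "x \<in> regular" "H \<in> half_intervals"
  shows "x \<in> H \<longleftrightarrow> x \<in> interior H"
  using assms(2) regularD[OF assms(1)] by (auto simp: half_intervals_def)

definition fibre :: "real \<Rightarrow> real \<Rightarrow> real set" where
  "fibre b x = {y \<in> {0..1}. beta_map b y = x}"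

lemma fibre_regular:
  assumes "b \<in> {\<beta>, \<omega> * \<beta>}" "x \<in> regular" "y \<in> fibre b x"
  shows "y \<in> regular" "beta_map b y = x" "deriv (beta_map b) y = b"
  using assms regular_preimage[of b y] beta_map_has_derivative[of b y]
  by (auto simp: fibre_def DERIV_imp_deriv)

lemma fibre_subset:
  assumes "b \<in> {\<beta>, \<omega> * \<beta>}"
  shows "fibre b x \<subseteq> (\<lambda>j. (x + of_int j) / b) ` {0..\<lfloor>b\<rfloor>}"
proof
  fix y assume y: "y \<in> fibre b x"
  note b = slope_bounds[OF assms]
  have "b * y = x + of_int \<lfloor>b * y\<rfloor>" using y by (auto simp: fibre_def beta_map_def frac_def)
  then have "y = (x + of_int \<lfloor>b * y\<rfloor>) / b" using b by (simp add: field_simps)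
  moreover have "0 \<le> b * y" "b * y \<le> b" using y b by (auto simp: fibre_def mult_left_le)
  then have "\<lfloor>b * y\<rfloor> \<in> {0..\<lfloor>b\<rfloor>}" by (auto intro: floor_mono)
  ultimately show "y \<in> (\<lambda>j. (x + of_int j) / b) ` {0..\<lfloor>b\<rfloor>}" by blast
qed

lemma finite_fibre: "b \<in> {\<beta>, \<omega> * \<beta>} \<Longrightarrow> finite (fibre b x)"
  using fibre_subset finite_subset by blast

lemma card_fibre_le:
  assumes "b \<in> {\<beta>, \<omega> * \<beta>}"
  shows "real (card (fibre b x)) \<le> 2 * b"
proof -
  have "card (fibre b x) \<le> card {0..\<lfloor>b\<rfloor>}"
    using fibre_subset[OF assms] by (meson card_image_le card_mono finite_atLeastAtMost_int finite_imageI le_trans)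
  also have "real \<dots> \<le> b + 1" using slope_bounds[OF assms] by (simp add: le_floor_iff)
  finally show ?thesis using slope_bounds[OF assms] by simp
qed

text \<open>
  A half interval of length 1/2 contains at least \<open>b/2 - 2\<close> complete branches, and \<open>b/2 - 2 \<ge> b/4 + 1\<close>.
\<close>

lemma card_fibre_half_ge:
  assumes "b \<in> {\<beta>, \<omega> * \<beta>}" "x \<in> regular" "H \<in> half_intervals"
  shows "b / 4 \<le> real (card {y \<in> fibre b x. y \<in> H})"
proof -
  note b = slope_bounds[OF assms(1)] and x = regularD[OF assms(2)]
  obtain u where u: "u = 0 \<or> u = 1/2" "interior H = {u<..<u + 1/2}"
    using half_interval_interior[OF assms(3)] .
  define J where "J = {\<lfloor>b * u\<rfloor> + 1 .. \<lfloor>b * (u + 1/2)\<rfloor> - 1}"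
  have "(\<lambda>j. (x + of_int j) / b) ` J \<subseteq> {y \<in> fibre b x. y \<in> H}"
  proof (clarify, intro conjI)
    fix j assume j: "j \<in> J"
    have "b * u < of_int j" "of_int j + 1 \<le> b * (u + 1/2)"
      using j unfolding J_def by (auto, linarith+)
    then have "u * b < x + of_int j" "x + of_int j < (u + 1/2) * b"
      using x by (auto simp: mult.commute)
    then have in_int: "(x + of_int j) / b \<in> interior H"
      using b u(2) by (auto simp: field_simps)
    then show "(x + of_int j) / b \<in> H" using interior_subset by blast
    have "frac (x + of_int j) = x" using x by (simp add: frac_eq)
    moreover have "y \<in> {0..1}" if "y \<in> interior H" for y using that u by auto
    ultimately show "(x + of_int j) / b \<in> fibre b x"
      using in_int b unfolding fibre_def beta_map_def by simp
  qed
  moreover have "inj_on (\<lambda>j. (x + of_int j) / b) J" using b by (auto intro!: inj_onI)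
  ultimately have "card J \<le> card {y \<in> fibre b x. y \<in> H}"
    using finite_fibre[OF assms(1)] by (metis card_image card_mono finite_Collect_conjI finite_fibre assms(1) Collect_mem_eq)
  moreover have "b / 4 \<le> real (card J)"
  proof -
    have "b * (u + 1/2) = b * u + b / 2" by (simp add: algebra_simps)
    then have "of_int (\<lfloor>b * (u + 1/2)\<rfloor> - 1 - \<lfloor>b * u\<rfloor>) \<ge> b / 2 - 2" by linarith
    then show ?thesis using b unfolding J_def by (simp add: algebra_simps)
  qed
  ultimately show ?thesis by linarith
qed

lemma transfer_open_eq:
  assumes "s \<in> maps \<times> half_intervals" "x \<in> regular"
  shows "transfer_open s f x = (\<Sum>y\<in>fibre (slope s) x. f y * indicator (snd s) y) / slope s"
proof -
  note b = slope(2)[OF assms(1)]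
  have "{y. y \<in> {0..1} \<and> fst s y = x} = fibre (slope s) x"
    using slope(1)[OF assms(1)] by (auto simp: fibre_def)
  then show ?thesis
    unfolding transfer_open_def transfer_def sum_divide_distrib
    using fibre_regular(3)[OF b assms(2)] slope_bounds(4)[OF b] slope(1)[OF assms(1)]
    by (auto intro!: sum.cong)
qed

lemma transfer_open_mono:
  assumes "s \<in> maps \<times> half_intervals" "x \<in> regular"
    and "\<And>y. y \<in> fibre (slope s) x \<Longrightarrow> f y \<le> g y"
  shows "transfer_open s f x \<le> transfer_open s g x"
  unfolding transfer_open_eq[OF assms(1,2)]
  using slope_bounds(4)[OF slope(2)[OF assms(1)]] assms(3)
  by (intro divide_right_mono sum_mono mult_right_mono) auto

lemma transfer_open_scale:
  assumes "s \<in> maps \<times> half_intervals" "x \<in> regular"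
  shows "transfer_open s (\<lambda>y. c * f y) x = c * transfer_open s f x"
  unfolding transfer_open_eq[OF assms] by (simp add: sum_distrib_left mult.assoc)

lemma transfer_open_one:
  assumes "s \<in> maps \<times> half_intervals" "x \<in> regular"
  shows "transfer_open s (\<lambda>_. 1) x \<le> 2" "1/4 \<le> transfer_open s (\<lambda>_. 1) x"
proof -
  note b = slope(2)[OF assms(1)]
  have "(\<Sum>y\<in>fibre (slope s) x. 1 * indicator (snd s) y) = real (card {y \<in> fibre (slope s) x. y \<in> snd s})"
    unfolding sum_mult_indicator[OF finite_fibre[OF b]] by (simp add: Int_def flip: card_eq_sum)
  moreover have "card {y \<in> fibre (slope s) x. y \<in> snd s} \<le> card (fibre (slope s) x)"
    using finite_fibre[OF b] by (intro card_mono) auto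
  moreover have "slope s / 4 \<le> real (card {y \<in> fibre (slope s) x. y \<in> snd s})"
    using assms(1) by (intro card_fibre_half_ge[OF b assms(2)]) auto
  ultimately show "transfer_open s (\<lambda>_. 1) x \<le> 2" "1/4 \<le> transfer_open s (\<lambda>_. 1) x"
    using card_fibre_le[OF b, of x] slope_bounds(4)[OF b]
    unfolding transfer_open_eq[OF assms] by (auto simp: field_simps)
qed

section \<open>The functional \<open>\<Lambda>\<close>\<close>

text \<open>
  The inverse branches are affine, so a null set has only a null set of images: the maps are
  nonsingular.
\<close>

lemma AE_fibre:
  assumes "AE x in lebesgue_on {0..1}. P x" "b \<in> {\<beta>, \<omega> * \<beta>}"
  shows "AE x in lebesgue_on {0..1}. \<forall>y\<in>fibre b x. P y"
proof -
  define N where "N = {y \<in> {0..1}. \<not> P y}"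
  have N: "negligible N" using assms(1) unfolding N_def AE_unit_iff .
  have "negligible ((\<lambda>y. b * y - of_int j) ` N)" for j :: int
    by (rule negligible_differentiable_image_negligible[OF _ N])
      (auto intro!: derivative_intros)
  then have "negligible (\<Union>j::int. (\<lambda>y. b * y - of_int j) ` N)"
    by (intro negligible_countable_Union) auto
  moreover have "{x \<in> {0..1}. \<not> (\<forall>y\<in>fibre b x. P y)} \<subseteq> (\<Union>j::int. (\<lambda>y. b * y - of_int j) ` N)"
    by (auto simp: fibre_def N_def beta_map_def frac_def)
  ultimately show ?thesis unfolding AE_unit_iff by (rule negligible_subset)
qed

abbreviation "admissible \<equiv> words maps half_intervals"

lemma admissible_letter: "\<sigma> \<in> admissible \<Longrightarrow> \<sigma> k \<in> maps \<times> half_intervals"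
  by (simp add: words_def)

lemma admissible_shift: "\<sigma> \<in> admissible \<Longrightarrow> shift \<sigma> \<in> admissible"
  by (simp add: words_def shift_def)

lemma iter_transfer_mono:
  assumes "\<sigma> \<in> admissible" "k \<le> n" "x \<in> regular"
    and "\<And>y. y \<in> regular \<Longrightarrow> iter_transfer \<sigma> k f y \<le> iter_transfer \<sigma> k g y"
  shows "iter_transfer \<sigma> n f x \<le> iter_transfer \<sigma> n g x"
  using assms(2,3)
proof (induction n arbitrary: x rule: dec_induct)
  case base
  then show ?case using assms(4) by simp
next
  case (step n)
  have s: "\<sigma> n \<in> maps \<times> half_intervals" by (rule admissible_letter[OF assms(1)])
  show ?case
    using step fibre_regular(1)[OF slope(2)[OF s]] by (auto intro!: transfer_open_mono[OF s])
qed

lemma iter_transfer_scale: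
  assumes "\<sigma> \<in> admissible" "x \<in> regular"
  shows "iter_transfer \<sigma> n (\<lambda>y. c * f y) x = c * iter_transfer \<sigma> n f x"
  using assms(2)
proof (induction n arbitrary: x)
  case (Suc n)
  have s: "\<sigma> n \<in> maps \<times> half_intervals" by (rule admissible_letter[OF assms(1)])
  have "transfer_open (\<sigma> n) (iter_transfer \<sigma> n (\<lambda>y. c * f y)) x
      = transfer_open (\<sigma> n) (\<lambda>y. c * iter_transfer \<sigma> n f y) x"
    unfolding transfer_open_eq[OF s Suc.prems]
    using Suc fibre_regular(1)[OF slope(2)[OF s]]
    by (intro arg_cong2[where f = "(/)"] sum.cong) auto
  then show ?case using transfer_open_scale[OF s Suc.prems] by simp
qed simp

lemma iter_transfer_nonneg:
  assumes "\<sigma> \<in> admissible" "x \<in> regular" "\<And>y. y \<in> regular \<Longrightarrow> 0 \<le> f y"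
  shows "0 \<le> iter_transfer \<sigma> n f x"
  using iter_transfer_mono[OF assms(1) _ assms(2), of 0 n "\<lambda>y. 0 * f y" f]
    iter_transfer_scale[OF assms(1,2), of n 0 f] assms(3) by simp

lemma iter_transfer_one:
  assumes "\<sigma> \<in> admissible" "x \<in> regular"
  shows "iter_transfer \<sigma> n (\<lambda>_. 1) x \<le> 2 ^ n" "(1/4) ^ n \<le> iter_transfer \<sigma> n (\<lambda>_. 1) x"
proof -
  have "iter_transfer \<sigma> n (\<lambda>_. 1) x \<le> 2 ^ n \<and> (1/4) ^ n \<le> iter_transfer \<sigma> n (\<lambda>_. 1) x"
    using assms(2)
  proof (induction n arbitrary: x)
    case (Suc n)
    have s: "\<sigma> n \<in> maps \<times> half_intervals" by (rule admissible_letter[OF assms(1)])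
    note one = transfer_open_one[OF s Suc.prems]
    have "transfer_open (\<sigma> n) (iter_transfer \<sigma> n (\<lambda>_. 1)) x \<le> transfer_open (\<sigma> n) (\<lambda>_. 2 ^ n * 1) x"
      using Suc fibre_regular(1)[OF slope(2)[OF s]] by (auto intro!: transfer_open_mono[OF s])
    moreover have "transfer_open (\<sigma> n) (\<lambda>_. (1/4) ^ n * 1) x \<le> transfer_open (\<sigma> n) (iter_transfer \<sigma> n (\<lambda>_. 1)) x"
      using Suc fibre_regular(1)[OF slope(2)[OF s]] by (intro transfer_open_mono[OF s]) auto
    moreover have "2 ^ n * transfer_open (\<sigma> n) (\<lambda>_. 1) x \<le> 2 ^ n * 2"
      "(1/4) ^ n * (1/4) \<le> (1/4) ^ n * transfer_open (\<sigma> n) (\<lambda>_. 1) x"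
      using one by (intro mult_left_mono; simp)+
    ultimately have "transfer_open (\<sigma> n) (iter_transfer \<sigma> n (\<lambda>_. 1)) x \<le> 2 ^ n * 2"
      "(1/4) ^ n * (1/4) \<le> transfer_open (\<sigma> n) (iter_transfer \<sigma> n (\<lambda>_. 1)) x"
      unfolding transfer_open_scale[OF s Suc.prems] by linarith+
    then show ?case by (simp add: mult.commute)
  qed simp
  then show "iter_transfer \<sigma> n (\<lambda>_. 1) x \<le> 2 ^ n" "(1/4) ^ n \<le> iter_transfer \<sigma> n (\<lambda>_. 1) x" by auto
qed

lemma iter_transfer_one_pos:
  assumes "\<sigma> \<in> admissible" "x \<in> regular"
  shows "0 < iter_transfer \<sigma> n (\<lambda>_. 1) x"
  by (rule less_le_trans[OF _ iter_transfer_one(2)[OF assms]]) simp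

abbreviation ratio :: "(nat \<Rightarrow> symb) \<Rightarrow> nat \<Rightarrow> (real \<Rightarrow> real) \<Rightarrow> real \<Rightarrow> real" where
  "ratio \<sigma> n f x \<equiv> iter_transfer \<sigma> n f x / iter_transfer \<sigma> n (\<lambda>_. 1) x"

lemma ratio_ge_iff:
  assumes "\<sigma> \<in> admissible" "x \<in> regular"
  shows "c \<le> ratio \<sigma> n f x \<longleftrightarrow> c * iter_transfer \<sigma> n (\<lambda>_. 1) x \<le> iter_transfer \<sigma> n f x"
  using iter_transfer_one_pos[OF assms] by (rule pos_le_divide_eq)

text \<open>
  A lower bound of the ratio at one time persists, since the transfer operators are positive.
\<close>

lemma ratio_ge:
  assumes "\<sigma> \<in> admissible" "k \<le> n" "x \<in> regular"
    and "\<And>y. y \<in> regular \<Longrightarrow> c * iter_transfer \<sigma> k (\<lambda>_. 1) y \<le> iter_transfer \<sigma> k f y"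
  shows "c \<le> ratio \<sigma> n f x"
proof -
  have "iter_transfer \<sigma> n (\<lambda>_. c * 1) x \<le> iter_transfer \<sigma> n f x"
    using assms(4) by (intro iter_transfer_mono[OF assms(1,2,3)]) (simp only: iter_transfer_scale[OF assms(1)])
  then show ?thesis
    unfolding ratio_ge_iff[OF assms(1,3)] by (simp only: iter_transfer_scale[OF assms(1,3)])
qed

lemma ratio_bounds:
  assumes "\<sigma> \<in> admissible" "x \<in> regular" "\<And>y. y \<in> regular \<Longrightarrow> 0 \<le> f y \<and> f y \<le> M"
  shows "0 \<le> ratio \<sigma> n f x" "ratio \<sigma> n f x \<le> M"
proof -
  show "0 \<le> ratio \<sigma> n f x"
    using assms(3) by (intro ratio_ge[OF assms(1) _ assms(2), of 0]) auto
  have "iter_transfer \<sigma> n f x \<le> iter_transfer \<sigma> n (\<lambda>_. M * 1) x"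
    using assms(3) by (intro iter_transfer_mono[OF assms(1) _ assms(2), of 0]) auto
  also have "\<dots> = M * iter_transfer \<sigma> n (\<lambda>_. 1) x"
    by (rule iter_transfer_scale[OF assms(1,2)])
  finally show "ratio \<sigma> n f x \<le> M"
    using iter_transfer_one_pos[OF assms(1,2)] by (simp add: pos_divide_le_eq)
qed

lemma AE_of_regular: "(\<And>x. x \<in> regular \<Longrightarrow> P x) \<Longrightarrow> AE x in lebesgue_on {0..1}. P x"
  using AE_regular by (rule eventually_mono)

lemma ess_inf_ratio_ge:
  assumes "\<sigma> \<in> admissible" "\<And>y. y \<in> regular \<Longrightarrow> 0 \<le> f y \<and> f y \<le> M"
    and "\<And>x. x \<in> regular \<Longrightarrow> c \<le> ratio \<sigma> n f x"
  shows "c \<le> ess_inf (ratio \<sigma> n f)"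
  by (rule ess_inf_ge[where M = M]; rule AE_of_regular; use ratio_bounds[OF assms(1)] assms in blast)

text \<open>
  Monotonicity in \<open>n\<close> makes the limit in the definition of \<open>\<Lambda>\<close> exist.
\<close>

lemma ess_inf_ratio_incseq:
  assumes "\<sigma> \<in> admissible" "\<And>y. y \<in> regular \<Longrightarrow> 0 \<le> f y \<and> f y \<le> M"
  shows "incseq (\<lambda>n. ess_inf (ratio \<sigma> n f))"
proof (rule incseq_SucI)
  fix n
  define r where "r = ess_inf (ratio \<sigma> n f)"
  have s: "\<sigma> n \<in> maps \<times> half_intervals" by (rule admissible_letter[OF assms(1)])
  have upper: "AE x in lebesgue_on {0..1}. ratio \<sigma> k f x \<le> M" for k
    by (rule AE_of_regular) (use ratio_bounds[OF assms(1)] assms(2) in blast)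
  have lower: "AE x in lebesgue_on {0..1}. 0 \<le> ratio \<sigma> k f x" for k
    by (rule AE_of_regular) (use ratio_bounds[OF assms(1)] assms(2) in blast)
  have "AE x in lebesgue_on {0..1}. \<forall>y\<in>fibre (slope (\<sigma> n)) x. r \<le> ratio \<sigma> n f y"
    unfolding r_def by (rule AE_fibre[OF AE_ess_inf_le[OF upper lower] slope(2)[OF s]])
  then have "AE x in lebesgue_on {0..1}. r \<le> ratio \<sigma> (Suc n) f x"
    using AE_regular
  proof eventually_elim
    case (elim x)
    have "transfer_open (\<sigma> n) (\<lambda>y. r * iter_transfer \<sigma> n (\<lambda>_. 1) y) x \<le> transfer_open (\<sigma> n) (iter_transfer \<sigma> n f) x"
      using elim ratio_ge_iff[OF assms(1)] fibre_regular(1)[OF slope(2)[OF s]]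
      by (intro transfer_open_mono[OF s]) auto
    then show ?case
      unfolding ratio_ge_iff[OF assms(1) elim(2)] by (simp add: transfer_open_scale[OF s elim(2)])
  qed
  then show "ess_inf (ratio \<sigma> n f) \<le> ess_inf (ratio \<sigma> (Suc n) f)"
    unfolding r_def by (rule ess_inf_ge[OF upper])
qed

lemma Lambda_limit:
  assumes "\<sigma> \<in> admissible" "\<And>y. y \<in> regular \<Longrightarrow> 0 \<le> f y \<and> f y \<le> M"
  shows "(\<lambda>n. ess_inf (ratio \<sigma> n f)) \<longlonglongrightarrow> Lambda \<sigma> f"
proof -
  have inc: "incseq (\<lambda>n. ess_inf (ratio \<sigma> n f))" using assms by (rule ess_inf_ratio_incseq)
  have "ess_inf (ratio \<sigma> n f) \<le> M" for n
    by (rule ess_inf_le[where c = 0]; rule AE_of_regular; use ratio_bounds[OF assms(1)] assms(2) in blast)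
  then have upper: "\<forall>n. ess_inf (ratio \<sigma> n f) \<le> M" by blast
  obtain L where "(\<lambda>n. ess_inf (ratio \<sigma> n f)) \<longlonglongrightarrow> L"
    using incseq_convergent[OF inc, of M] upper by blast
  then have "convergent (\<lambda>n. ess_inf (ratio \<sigma> n f))" by (rule convergentI)
  then show ?thesis unfolding Lambda_def by (simp add: convergent_LIMSEQ_iff)
qed

lemma Lambda_ge:
  assumes "\<sigma> \<in> admissible" "\<And>y. y \<in> regular \<Longrightarrow> 0 \<le> f y \<and> f y \<le> M"
    and "\<And>n x. k \<le> n \<Longrightarrow> x \<in> regular \<Longrightarrow> c \<le> ratio \<sigma> n f x"
  shows "c \<le> Lambda \<sigma> f"
proof (rule LIMSEQ_le_const)
  show "(\<lambda>n. ess_inf (ratio \<sigma> n f)) \<longlonglongrightarrow> Lambda \<sigma> f"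
    using assms(1,2) by (rule Lambda_limit)
  show "\<exists>N. \<forall>n\<ge>N. c \<le> ess_inf (ratio \<sigma> n f)"
  proof (intro exI[of _ k] allI impI)
    fix n assume "k \<le> n"
    show "c \<le> ess_inf (ratio \<sigma> n f)"
      using assms(1,2) assms(3)[OF \<open>k \<le> n\<close>] by (rule ess_inf_ratio_ge)
  qed
qed

lemma Lambda_eq_0:
  assumes "\<And>n x. k \<le> n \<Longrightarrow> x \<in> regular \<Longrightarrow> iter_transfer \<sigma> n f x = 0"
  shows "Lambda \<sigma> f = 0"
proof -
  have "ess_inf (ratio \<sigma> n f) = 0" if "k \<le> n" for n
  proof -
    have "ess_inf (ratio \<sigma> n f) = ess_inf (\<lambda>_. 0)"
      by (rule ess_inf_cong, rule AE_of_regular) (simp add: assms[OF that])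
    then show ?thesis by (simp add: ess_inf_const)
  qed
  then have "(\<lambda>n. ess_inf (ratio \<sigma> n f)) \<longlonglongrightarrow> 0"
    by (intro tendsto_eventually eventually_sequentiallyI) blast
  then show ?thesis unfolding Lambda_def by (rule limI)
qed

lemma C1_holds: "C1 maps half_intervals"
  unfolding C1_def
proof (intro exI[of _ "1/4"] conjI ballI)
  fix s assume "s \<in> maps \<times> half_intervals"
  then show "1/4 \<le> ess_inf (transfer_open s (\<lambda>_. 1))"
    by (intro ess_inf_ge[where M = 2] AE_of_regular transfer_open_one)
qed simp

text \<open>
  The function whose \<open>\<Lambda>\<close> defines \<open>\<rho>\<close> is at least 1/4, hence so are all the ratios.
\<close>

lemma rho_ge: "1/4 \<le> rho maps half_intervals"
  unfolding rho_def
proof (rule cINF_greatest)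
  have "(\<lambda>_. (beta_map \<beta>, {0..1/2})) \<in> admissible"
    by (auto simp: words_def beta_maps_def half_intervals_def)
  then show "admissible \<noteq> {}" by blast
  fix \<sigma> assume \<sigma>: "\<sigma> \<in> admissible"
  have one: "1/4 \<le> transfer_open (\<sigma> 0) (\<lambda>_. 1) x" "transfer_open (\<sigma> 0) (\<lambda>_. 1) x \<le> 2"
    if "x \<in> regular" for x
    by (rule transfer_open_one[OF admissible_letter[OF \<sigma>] that])+
  have "1/4 \<le> Lambda (shift \<sigma>) (transfer_open (\<sigma> 0) (\<lambda>_. 1))"
  proof (rule Lambda_ge[OF admissible_shift[OF \<sigma>], where M = 2 and k = 0])
    show "0 \<le> transfer_open (\<sigma> 0) (\<lambda>_. 1) y \<and> transfer_open (\<sigma> 0) (\<lambda>_. 1) y \<le> 2" if "y \<in> regular" for y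
      using one[OF that] by linarith
    show "1/4 \<le> ratio (shift \<sigma>) n (transfer_open (\<sigma> 0) (\<lambda>_. 1)) x" if "x \<in> regular" for n x
      using one(1) by (intro ratio_ge[OF admissible_shift[OF \<sigma>] _ that, of 0]) auto
  qed
  then show "1/4 \<le> rho_word \<sigma>" by (simp add: rho_word_def)
qed

lemma Theta_eq: "Theta maps = 1 / \<beta>"
proof -
  have ess: "ess_inf (\<lambda>x. \<bar>deriv (beta_map b) x\<bar>) = b" if "b \<in> {\<beta>, \<omega> * \<beta>}" for b
  proof -
    have "countable ((\<lambda>j. of_int j / b) ` (UNIV :: int set))" by simp
    then have "negligible ((\<lambda>j. of_int j / b) ` (UNIV :: int set))"
      by (metis countable_imp_null_set_lborel negligible_iff_null_sets null_sets_completionI)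
    then have "AE x in lebesgue_on {0..1}. b * x \<notin> \<int>"
      unfolding AE_unit_iff
      by (rule negligible_subset) (use slope_bounds[OF that] in \<open>auto elim!: Ints_cases simp: field_simps\<close>)
    then have "AE x in lebesgue_on {0..1}. \<bar>deriv (beta_map b) x\<bar> = b"
    proof (rule eventually_mono)
      fix x assume "b * x \<notin> \<int>"
      then show "\<bar>deriv (beta_map b) x\<bar> = b"
        using beta_map_has_derivative[of b x] slope_bounds[OF that] by (simp add: DERIV_imp_deriv)
    qed
    then show ?thesis by (simp add: ess_inf_cong[of _ "\<lambda>_. b"] ess_inf_const)
  qed
  have "(INF T\<in>maps. ess_inf (\<lambda>x. \<bar>deriv T x\<bar>)) = min \<beta> (\<omega> * \<beta>)"
    unfolding beta_maps_def using ess[of \<beta>] ess[of "\<omega> * \<beta>"] by (simp add: cInf_eq_Min)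
  also have "\<dots> = \<beta>" using slope_bounds(1)[of "\<omega> * \<beta>"] by simp
  finally show ?thesis by (simp add: Theta_def divide_inverse)
qed

end

section \<open>Cylinders\<close>

lemma component_of_open_real:
  fixes S :: "real set"
  assumes "Z \<in> components S" "open S" "bounded S"
  obtains a b where "a < b" "Z = {a<..<b}" "a \<notin> S" "b \<notin> S"
proof -
  have Z: "open Z" "is_interval Z" "Z \<noteq> {}" "bounded Z"
    using open_components[OF assms(2,1)] in_components_connected[OF assms(1)] in_components_nonempty[OF assms(1)]
      bounded_subset[OF assms(3) in_components_subset[OF assms(1)]] is_interval_connected_1 by auto
  define a where "a = Inf Z"
  define b where "b = Sup Z"
  have bdd: "bdd_below Z" "bdd_above Z" using bounded_imp_bdd_below[OF Z(4)] bounded_imp_bdd_above[OF Z(4)] .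
  have strict: "a < x \<and> x < b" if "x \<in> Z" for x
  proof -
    obtain e where e: "e > 0" "ball x e \<subseteq> Z" using openE[OF Z(1) \<open>x \<in> Z\<close>] by blast
    then have "x - e/2 \<in> ball x e" "x + e/2 \<in> ball x e" by (simp_all add: dist_real_def)
    then have "x - e/2 \<in> Z" "x + e/2 \<in> Z" using e(2) by blast+
    then have "a \<le> x - e/2" "x + e/2 \<le> b"
      unfolding a_def b_def using bdd by (auto intro: cInf_lower cSup_upper)
    then show ?thesis using e(1) by linarith
  qed
  have eq: "Z = {a<..<b}"
  proof
    show "Z \<subseteq> {a<..<b}" using strict by auto
    show "{a<..<b} \<subseteq> Z"
    proof
      fix x assume "x \<in> {a<..<b}"
      then obtain y z where "y \<in> Z" "y < x" "z \<in> Z" "x < z"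
        using cInf_lessD[OF Z(3), of x] less_cSupD[OF Z(3), of x] unfolding a_def b_def by auto
      then show "x \<in> Z" using Z(2) unfolding is_interval_1 by (meson less_imp_le)
    qed
  qed
  have outside: "c \<notin> S" if "c = a \<or> c = b" for c
  proof
    assume "c \<in> S"
    then obtain e where e: "e > 0" "ball c e \<subseteq> S" using openE[OF assms(2) \<open>c \<in> S\<close>] by blast
    define d where "d = min (e/2) ((b - a)/2)"
    have ab: "a < b" using Z(3) eq by auto
    have d: "d > 0" "d < e" "d < b - a" using e(1) ab by (auto simp: d_def min_def)
    have "(if c = a then c + d else c - d) \<in> Z \<inter> ball c e"
      using that d ab eq by (auto simp: dist_real_def)
    then have "Z \<inter> ball c e \<noteq> {}" by blast
    then have "ball c e \<subseteq> Z" using components_maximal[OF assms(1) _ e(2)] by auto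
    then have "c \<in> Z" using e(1) by auto
    then show False using that eq by auto
  qed
  show thesis
    by (rule that[of a b]) (use Z(3) eq outside in auto)
qed

lemma frac_local:
  fixes z :: real
  assumes "z \<notin> \<int>"
  obtains d where "d > 0" "\<And>w. \<bar>w - z\<bar> < d \<Longrightarrow> frac w = frac z + (w - z)"
proof
  have "frac z \<noteq> 0" using assms by simp
  then have "0 < frac z" "frac z < 1" using frac_ge_0[of z] frac_lt_1[of z] by linarith+
  then show "0 < min (frac z) (1 - frac z)" by simp
  fix w assume "\<bar>w - z\<bar> < min (frac z) (1 - frac z)"
  then have "0 \<le> frac z + (w - z)" "frac z + (w - z) < 1" by (auto simp: min_def split: if_splits)
  moreover have "w - (frac z + (w - z)) \<in> \<int>" by (simp add: frac_def)
  ultimately show "frac w = frac z + (w - z)" by (simp add: frac_unique_iff)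
qed

context beta_system begin

definition smooth_points :: "(nat \<Rightarrow> symb) \<Rightarrow> nat \<Rightarrow> real set" where
  "smooth_points \<sigma> n = {x \<in> {0<..<1}. \<forall>j<n. slope (\<sigma> j) * iter_map \<sigma> j x \<notin> \<int>}"

text \<open>
  The points whose first \<open>n\<close> iterates stay in the interiors of the half intervals and avoid the
  discontinuities; the partition elements inside the surviving set are its components.
\<close>

definition live :: "(nat \<Rightarrow> symb) \<Rightarrow> nat \<Rightarrow> real set" where
  "live \<sigma> n = {x \<in> smooth_points \<sigma> n. \<forall>j<n. iter_map \<sigma> j x \<in> interior (snd (\<sigma> j))}"

definition expansion :: "(nat \<Rightarrow> symb) \<Rightarrow> nat \<Rightarrow> real" where
  "expansion \<sigma> n = (\<Prod>j<n. slope (\<sigma> j))"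

lemma admissible_slope:
  assumes "\<sigma> \<in> admissible"
  shows "fst (\<sigma> k) = beta_map (slope (\<sigma> k))" "slope (\<sigma> k) \<in> {\<beta>, \<omega> * \<beta>}" "12 \<le> slope (\<sigma> k)"
    "0 < slope (\<sigma> k)"
  using slope[OF admissible_letter[OF assms]] slope_bounds by blast+

lemma expansion_pos: "\<sigma> \<in> admissible \<Longrightarrow> 0 < expansion \<sigma> n"
  unfolding expansion_def using admissible_slope(4) by (intro prod_pos) auto

lemma expansion_Suc: "expansion \<sigma> (Suc n) = slope (\<sigma> n) * expansion \<sigma> n"
  by (simp add: expansion_def)

lemma iter_map_Suc_eq:
  assumes "\<sigma> \<in> admissible"
  shows "iter_map \<sigma> (Suc n) x = frac (slope (\<sigma> n) * iter_map \<sigma> n x)"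
  using admissible_slope(1)[OF assms] by (simp add: beta_map_def)

lemma iter_map_unit:
  assumes "\<sigma> \<in> admissible" "x \<in> {0..1}"
  shows "iter_map \<sigma> n x \<in> {0..1}"
proof (cases n)
  case (Suc m)
  then show ?thesis unfolding Suc iter_map_Suc_eq[OF assms(1)]
    using frac_ge_0 frac_lt_1 less_imp_le by (metis atLeastAtMost_iff)
qed (use assms in simp)

lemma smooth_points_antimono: "m \<le> n \<Longrightarrow> smooth_points \<sigma> n \<subseteq> smooth_points \<sigma> m"
  by (auto simp: smooth_points_def)

lemma live_subset: "live \<sigma> n \<subseteq> smooth_points \<sigma> n" "live \<sigma> n \<subseteq> {0<..<1}"
  by (auto simp: live_def smooth_points_def)

lemma iter_map_locally_affine:
  assumes "\<sigma> \<in> admissible" "x \<in> smooth_points \<sigma> n"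
  obtains e where "e > 0"
    "\<And>y. \<bar>y - x\<bar> < e \<Longrightarrow> iter_map \<sigma> n y = iter_map \<sigma> n x + expansion \<sigma> n * (y - x)"
  using assms(2)
proof (induction n arbitrary: thesis)
  case 0
  show ?case by (rule 0(1)[of 1]) (auto simp: expansion_def)
next
  case (Suc n)
  have "x \<in> smooth_points \<sigma> n" using Suc.prems(2) smooth_points_antimono[of n "Suc n" \<sigma>] by auto
  then obtain e where e: "e > 0"
    "\<And>y. \<bar>y - x\<bar> < e \<Longrightarrow> iter_map \<sigma> n y = iter_map \<sigma> n x + expansion \<sigma> n * (y - x)"
    using Suc.IH by blast
  have "slope (\<sigma> n) * iter_map \<sigma> n x \<notin> \<int>" using Suc.prems(2) by (auto simp: smooth_points_def)
  then obtain d where d: "d > 0" "\<And>w. \<bar>w - slope (\<sigma> n) * iter_map \<sigma> n x\<bar> < d \<Longrightarrow>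
      frac w = frac (slope (\<sigma> n) * iter_map \<sigma> n x) + (w - slope (\<sigma> n) * iter_map \<sigma> n x)"
    using frac_local by blast
  define E where "E = expansion \<sigma> (Suc n)"
  have E: "E > 0" unfolding E_def by (rule expansion_pos[OF assms(1)])
  show ?case
  proof (rule Suc.prems(1)[of "min e (d / E)"])
    show "0 < min e (d / E)" using e(1) d(1) E by simp
    fix y assume y: "\<bar>y - x\<bar> < min e (d / E)"
    then have "E * \<bar>y - x\<bar> < d" using E by (simp add: field_simps)
    then have "\<bar>E * (y - x)\<bar> < d" using E by (simp add: abs_mult)
    moreover have eq: "slope (\<sigma> n) * iter_map \<sigma> n y - slope (\<sigma> n) * iter_map \<sigma> n x = E * (y - x)"
    proof -
      have "iter_map \<sigma> n y = iter_map \<sigma> n x + expansion \<sigma> n * (y - x)" using e(2) y by simp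
      then show ?thesis by (simp only: E_def expansion_Suc) (simp add: algebra_simps)
    qed
    ultimately have "\<bar>slope (\<sigma> n) * iter_map \<sigma> n y - slope (\<sigma> n) * iter_map \<sigma> n x\<bar> < d"
      by metis
    from d(2)[OF this]
    show "iter_map \<sigma> (Suc n) y = iter_map \<sigma> (Suc n) x + expansion \<sigma> (Suc n) * (y - x)"
      unfolding eq iter_map_Suc_eq[OF assms(1)] E_def .
  qed
qed

lemma iter_map_has_derivative:
  assumes "\<sigma> \<in> admissible" "x \<in> smooth_points \<sigma> n"
  shows "(iter_map \<sigma> n has_real_derivative expansion \<sigma> n) (at x)"
proof -
  obtain e where e: "e > 0"
    "\<And>y. \<bar>y - x\<bar> < e \<Longrightarrow> iter_map \<sigma> n y = iter_map \<sigma> n x + expansion \<sigma> n * (y - x)"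
    using iter_map_locally_affine[OF assms] by blast
  have "((\<lambda>y. iter_map \<sigma> n x + expansion \<sigma> n * (y - x)) has_real_derivative expansion \<sigma> n) (at x)"
    by (auto intro!: derivative_eq_intros)
  then show ?thesis
  proof (rule has_field_derivative_transform_within[OF _ e(1)])
    fix y assume "dist y x < e"
    then show "iter_map \<sigma> n x + expansion \<sigma> n * (y - x) = iter_map \<sigma> n y"
      by (intro e(2)[symmetric]) (simp add: dist_real_def)
  qed simp
qed

lemma open_smooth_points_cond:
  assumes "\<sigma> \<in> admissible" "\<And>j. open (A j)"
  shows "open {x \<in> smooth_points \<sigma> n. \<forall>j<n. iter_map \<sigma> j x \<in> A j}"
proof -
  have local: "\<forall>\<^sub>F y in nhds x. y \<in> {x \<in> smooth_points \<sigma> n. \<forall>j<n. iter_map \<sigma> j x \<in> A j}"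
    if x: "x \<in> smooth_points \<sigma> n" "\<forall>j<n. iter_map \<sigma> j x \<in> A j" for x
  proof -
    have "\<forall>\<^sub>F y in nhds x. slope (\<sigma> j) * iter_map \<sigma> j y \<notin> \<int> \<and> iter_map \<sigma> j y \<in> A j" if "j < n" for j
    proof -
      have "x \<in> smooth_points \<sigma> j" using x(1) smooth_points_antimono[of j n \<sigma>] that by auto
      then have "isCont (iter_map \<sigma> j) x"
        using iter_map_has_derivative[OF assms(1)] DERIV_isCont by blast
      then have lim: "(iter_map \<sigma> j \<longlongrightarrow> iter_map \<sigma> j x) (nhds x)"
        by (simp add: isCont_def tendsto_at_iff_tendsto_nhds)
      have "((\<lambda>y. slope (\<sigma> j) * iter_map \<sigma> j y) \<longlongrightarrow> slope (\<sigma> j) * iter_map \<sigma> j x) (nhds x)"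
        by (intro tendsto_intros lim)
      then have "\<forall>\<^sub>F y in nhds x. slope (\<sigma> j) * iter_map \<sigma> j y \<in> - \<int>"
        by (rule topological_tendstoD) (use x(1) that in \<open>auto simp: smooth_points_def\<close>)
      moreover have "\<forall>\<^sub>F y in nhds x. iter_map \<sigma> j y \<in> A j"
        using x(2) that by (intro topological_tendstoD[OF lim] assms(2)) auto
      ultimately show ?thesis by eventually_elim auto
    qed
    then have "\<forall>\<^sub>F y in nhds x. \<forall>j\<in>{..<n}. slope (\<sigma> j) * iter_map \<sigma> j y \<notin> \<int> \<and> iter_map \<sigma> j y \<in> A j"
      by (intro eventually_ball_finite) auto
    moreover have "\<forall>\<^sub>F y in nhds x. y \<in> {0<..<1}"
      using x(1) by (intro eventually_nhds_in_open) (auto simp: smooth_points_def)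
    ultimately show ?thesis by eventually_elim (auto simp: smooth_points_def)
  qed
  show ?thesis
    unfolding open_subopen[of "{x \<in> _. _ x}"]
  proof
    fix x assume "x \<in> {x \<in> smooth_points \<sigma> n. \<forall>j<n. iter_map \<sigma> j x \<in> A j}"
    then show "\<exists>T. open T \<and> x \<in> T \<and> T \<subseteq> {x \<in> smooth_points \<sigma> n. \<forall>j<n. iter_map \<sigma> j x \<in> A j}"
      using local[of x] unfolding eventually_nhds by blast
  qed
qed

lemma open_smooth_points: "\<sigma> \<in> admissible \<Longrightarrow> open (smooth_points \<sigma> n)"
  using open_smooth_points_cond[of \<sigma> "\<lambda>_. UNIV" n] by simp

lemma open_live: "\<sigma> \<in> admissible \<Longrightarrow> open (live \<sigma> n)"
  using open_smooth_points_cond[of \<sigma> "\<lambda>j. interior (snd (\<sigma> j))" n] by (simp add: live_def)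

text \<open>
  Points slightly to the left of a jump are mapped close to 1, so left limits of the iterates are
  positive.  At a point whose orbit meets a jump the iterate itself vanishes; the iterated map is
  therefore discontinuous there, and no two jumps can cancel.
\<close>

lemma iter_map_left_limit:
  assumes "\<sigma> \<in> admissible" "0 < x"
  obtains e c where "e > 0" "c > 0"
    "\<And>y. x - e < y \<Longrightarrow> y < x \<Longrightarrow> iter_map \<sigma> n y = c - expansion \<sigma> n * (x - y)"
proof (induction n arbitrary: thesis)
  case 0
  show ?case by (rule 0[of 1 x]) (auto simp: expansion_def assms)
next
  case (Suc n)
  obtain e c where e: "e > 0" "c > 0"
    "\<And>y. x - e < y \<Longrightarrow> y < x \<Longrightarrow> iter_map \<sigma> n y = c - expansion \<sigma> n * (x - y)"
    using Suc.IH by blast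
  define E where "E = expansion \<sigma> (Suc n)"
  have E: "E > 0" unfolding E_def by (rule expansion_pos[OF assms(1)])
  define r where "r = slope (\<sigma> n) * c"
  define d where "d = r - of_int (\<lceil>r\<rceil> - 1)"
  have d: "0 < d" "d \<le> 1" unfolding d_def by linarith+
  show ?case
  proof (rule Suc.prems[of "min e (d / E)" d])
    show "0 < min e (d / E)" "0 < d" using e(1) d(1) E by simp_all
    fix y assume y: "x - min e (d / E) < y" "y < x"
    then have "x - y < d / E" by linarith
    then have small: "E * (x - y) < d" "0 < E * (x - y)" using E y(2) by (simp_all add: field_simps)
    have "slope (\<sigma> n) * iter_map \<sigma> n y = of_int (\<lceil>r\<rceil> - 1) + (d - E * (x - y))"
    proof -
      have "iter_map \<sigma> n y = c - expansion \<sigma> n * (x - y)" using y by (intro e(3)) linarith+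
      then show ?thesis by (simp only: E_def expansion_Suc d_def r_def) (simp add: algebra_simps)
    qed
    then have "iter_map \<sigma> (Suc n) y = frac (d - E * (x - y))"
      unfolding iter_map_Suc_eq[OF assms(1)] by (simp only: frac_add_of_int_left)
    then show "iter_map \<sigma> (Suc n) y = d - expansion \<sigma> (Suc n) * (x - y)"
      using small d(2) by (simp add: frac_eq E_def)
  qed
qed

lemma iter_map_eq_0:
  assumes "\<sigma> \<in> admissible" "j < n" "slope (\<sigma> j) * iter_map \<sigma> j x \<in> \<int>"
  shows "iter_map \<sigma> n x = 0"
  using assms(2)
proof (induction n)
  case (Suc n)
  then have "slope (\<sigma> n) * iter_map \<sigma> n x \<in> \<int>" using assms(3) by (cases "j = n") auto
  then show ?case unfolding iter_map_Suc_eq[OF assms(1)] by simp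
qed simp

text \<open>
  The iterates are affine near the points of \<^const>\<open>smooth_points\<close>, and discontinuous at all others
  by \<open>iter_map_left_limit\<close>.
\<close>

lemma smooth_iff:
  assumes "\<sigma> \<in> admissible" "x \<in> {0<..<1}"
  shows "C2_near (iter_map \<sigma> n) x \<longleftrightarrow> x \<in> smooth_points \<sigma> n"
proof
  assume "C2_near (iter_map \<sigma> n) x"
  then obtain U where "open U" "x \<in> U" "iter_map \<sigma> n C1_differentiable_on U"
    unfolding C2_near_def by blast
  then have "iter_map \<sigma> n differentiable (at x)" unfolding C1_differentiable_on_eq by blast
  then have "isCont (iter_map \<sigma> n) x" by (rule differentiable_imp_continuous_within)
  then have lim: "(iter_map \<sigma> n \<longlongrightarrow> iter_map \<sigma> n x) (at_left x)"
    by (simp add: isCont_def filterlim_at_split)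
  show "x \<in> smooth_points \<sigma> n"
  proof (rule ccontr)
    assume "x \<notin> smooth_points \<sigma> n"
    then obtain j where "j < n" "slope (\<sigma> j) * iter_map \<sigma> j x \<in> \<int>"
      using assms(2) by (auto simp: smooth_points_def)
    then have zero: "iter_map \<sigma> n x = 0" by (rule iter_map_eq_0[OF assms(1)])
    obtain e c where e: "e > 0" "c > 0"
      "\<And>y. x - e < y \<Longrightarrow> y < x \<Longrightarrow> iter_map \<sigma> n y = c - expansion \<sigma> n * (x - y)"
      using iter_map_left_limit[OF assms(1), of x n] assms(2) by auto
    have "((\<lambda>y. c - expansion \<sigma> n * (x - y)) \<longlongrightarrow> c - expansion \<sigma> n * (x - x)) (at_left x)"
      by (intro tendsto_intros)
    moreover have "\<forall>\<^sub>F y in at_left x. c - expansion \<sigma> n * (x - y) = iter_map \<sigma> n y"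
      using e(1,3) unfolding eventually_at_left_field by (intro exI[of _ "x - e"]) auto
    ultimately have "(iter_map \<sigma> n \<longlongrightarrow> c) (at_left x)"
      using Lim_transform_eventually by fastforce
    then have "c = 0"
      using tendsto_unique[OF _ lim] zero by (simp add: trivial_limit_at_left_real)
    then show False using e(2) by simp
  qed
next
  assume x: "x \<in> smooth_points \<sigma> n"
  have D: "(iter_map \<sigma> n has_real_derivative expansion \<sigma> n) (at y)" if "y \<in> smooth_points \<sigma> n" for y
    by (rule iter_map_has_derivative[OF assms(1) that])
  have "iter_map \<sigma> n C1_differentiable_on smooth_points \<sigma> n"
    unfolding C1_differentiable_on_def
    by (intro exI[of _ "\<lambda>_. expansion \<sigma> n"])
      (auto simp: has_real_derivative_iff_has_vector_derivative[symmetric] D)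
  moreover have "deriv (iter_map \<sigma> n) C1_differentiable_on smooth_points \<sigma> n"
    unfolding C1_differentiable_on_def
  proof (intro exI[of _ "\<lambda>_. 0"] conjI ballI)
    fix y assume y: "y \<in> smooth_points \<sigma> n"
    have "((\<lambda>_. expansion \<sigma> n) has_vector_derivative 0) (at y)" by simp
    then show "(deriv (iter_map \<sigma> n) has_vector_derivative 0) (at y)"
      by (rule has_vector_derivative_transform_within_open[OF _ open_smooth_points[OF assms(1)] y])
        (simp add: DERIV_imp_deriv[OF D])
  qed simp
  ultimately show "C2_near (iter_map \<sigma> n) x"
    unfolding C2_near_def using x open_smooth_points[OF assms(1)] by blast
qed

lemma smooth_partition_eq:
  assumes "\<sigma> \<in> admissible"
  shows "smooth_partition \<sigma> n = components (smooth_points \<sigma> n)"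
proof -
  have "smooth_points \<sigma> n \<subseteq> {0<..<1}" by (auto simp: smooth_points_def)
  then have "{x \<in> {0<..<1}. C2_near (iter_map \<sigma> n) x} = smooth_points \<sigma> n"
    using smooth_iff[OF assms] by blast
  then show ?thesis by (simp add: smooth_partition_def)
qed

text \<open>
  Around a smooth point the iterates are affine and increasing, so they map a neighbourhood inside the
  surviving set onto a neighbourhood inside the half interval.
\<close>

lemma live_eq_surviving_open:
  assumes "\<sigma> \<in> admissible"
  shows "live \<sigma> n = smooth_points \<sigma> n \<inter> surviving_open \<sigma> n"
proof
  have "live \<sigma> n \<subseteq> surviving \<sigma> n"
    using interior_subset by (fastforce simp: live_def surviving_def smooth_points_def)
  then show "live \<sigma> n \<subseteq> smooth_points \<sigma> n \<inter> surviving_open \<sigma> n"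
    unfolding surviving_open_def using interior_maximal[OF _ open_live[OF assms]] live_subset(1) by blast
  show "smooth_points \<sigma> n \<inter> surviving_open \<sigma> n \<subseteq> live \<sigma> n"
  proof
    fix x assume x: "x \<in> smooth_points \<sigma> n \<inter> surviving_open \<sigma> n"
    have "iter_map \<sigma> j x \<in> interior (snd (\<sigma> j))" if "j < n" for j
    proof -
      define E where "E = expansion \<sigma> j"
      have E: "E > 0" unfolding E_def by (rule expansion_pos[OF assms])
      have "x \<in> smooth_points \<sigma> j" using x smooth_points_antimono[of j n \<sigma>] that by auto
      then obtain e where e: "e > 0"
        "\<And>y. \<bar>y - x\<bar> < e \<Longrightarrow> iter_map \<sigma> j y = iter_map \<sigma> j x + E * (y - x)"
        using iter_map_locally_affine[OF assms] unfolding E_def by blast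
      have "x \<in> interior (surviving \<sigma> n)" using x by (simp add: surviving_open_def)
      then obtain d where d: "d > 0" "ball x d \<subseteq> surviving \<sigma> n"
        unfolding mem_interior by blast
      define m where "m = min e d"
      define r where "r = E * m"
      have "ball (iter_map \<sigma> j x) r \<subseteq> snd (\<sigma> j)"
      proof
        fix z assume z: "z \<in> ball (iter_map \<sigma> j x) r"
        define y where "y = x + (z - iter_map \<sigma> j x) / E"
        have "\<bar>z - iter_map \<sigma> j x\<bar> < r" using z by (simp add: dist_real_def abs_minus_commute)
        then have "\<bar>y - x\<bar> < m"
          using E by (simp add: y_def r_def abs_divide pos_divide_less_eq mult.commute)
        then have "\<bar>y - x\<bar> < e" "y \<in> ball x d" by (auto simp: m_def dist_real_def abs_minus_commute)
        then have "iter_map \<sigma> j y = z" "y \<in> surviving \<sigma> n"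
          using e(2)[of y] d(2) E by (simp_all add: y_def subset_iff)
        then show "z \<in> snd (\<sigma> j)" using that by (auto simp: surviving_def)
      qed
      moreover have "r > 0" using E e(1) d(1) by (simp add: r_def m_def)
      ultimately show ?thesis unfolding mem_interior by (intro exI[of _ r] conjI)
    qed
    then show "x \<in> live \<sigma> n" using x by (auto simp: live_def)
  qed
qed

text \<open>
  A nonempty open subset of the surviving set cannot lie in the hole, so only the components of the
  surviving parts contribute.
\<close>

lemma Z_star_component:
  assumes "\<sigma> \<in> admissible" "Z \<in> Z_star \<sigma> n"
  shows "Z \<in> components (live \<sigma> n)"
proof -
  obtain W where W: "W \<in> components (smooth_points \<sigma> n)"
    "Z \<in> components (W \<inter> surviving_open \<sigma> n) \<or> Z \<in> components (W \<inter> hole \<sigma> n)"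
    and Zs: "Z \<subseteq> surviving \<sigma> n"
    using assms(2) unfolding Z_star_def refined_partition_def smooth_partition_eq[OF assms(1)] by blast
  have W_sub: "W \<subseteq> smooth_points \<sigma> n" using W(1) by (rule in_components_subset)
  show ?thesis
  proof (cases "Z \<in> components (W \<inter> surviving_open \<sigma> n)")
    case True
    have Z: "Z \<noteq> {}" "Z \<subseteq> W \<inter> surviving_open \<sigma> n" "connected Z"
      using True by (auto simp: in_components_maximal)
    have "D = Z" if D: "D \<noteq> {}" "Z \<subseteq> D" "D \<subseteq> live \<sigma> n" "connected D" for D
    proof -
      have "D \<subseteq> smooth_points \<sigma> n" "D \<subseteq> surviving_open \<sigma> n"
        using D(3) live_eq_surviving_open[OF assms(1)] by auto
      moreover have "W \<inter> D \<noteq> {}" using Z D(2) by blast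
      ultimately have "D \<subseteq> W \<inter> surviving_open \<sigma> n"
        using components_maximal[OF W(1) D(4)] by blast
      then have "D \<subseteq> Z" using components_maximal[OF True D(4)] Z(1) D(2) by blast
      then show ?thesis using D(2) by blast
    qed
    moreover have "Z \<subseteq> live \<sigma> n" using Z(2) W_sub live_eq_surviving_open[OF assms(1)] by blast
    ultimately show ?thesis unfolding in_components_maximal using Z by blast
  next
    case False
    then have Z: "Z \<in> components (W \<inter> hole \<sigma> n)" using W(2) by blast
    have "W \<inter> hole \<sigma> n = W - closure (surviving_open \<sigma> n)"
      using W_sub by (auto simp: hole_def smooth_points_def)
    moreover have "open W" using open_components[OF open_smooth_points[OF assms(1)] W(1)] .
    ultimately have "open (W \<inter> hole \<sigma> n)" by (simp add: open_Diff)
    then have "open Z" using Z open_components by blast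
    then have "Z \<subseteq> surviving_open \<sigma> n" unfolding surviving_open_def using Zs interior_maximal by blast
    moreover have "Z \<subseteq> hole \<sigma> n" "Z \<noteq> {}"
      using in_components_subset[OF Z] in_components_nonempty[OF Z] by auto
    ultimately show ?thesis using closure_subset[of "surviving_open \<sigma> n"] by (auto simp: hole_def)
  qed
qed

lemma component_live_interval:
  assumes "\<sigma> \<in> admissible" "Z \<in> components (live \<sigma> n)"
  obtains a b where "a < b" "Z = {a<..<b}" "a \<notin> live \<sigma> n" "b \<notin> live \<sigma> n"
proof -
  have "bounded (live \<sigma> n)"
    using bounded_subset[OF bounded_box[of "0::real" 1]] live_subset(2)[of \<sigma> n] by simp
  then show thesis
    using component_of_open_real[OF assms(2) open_live[OF assms(1)]] that by blast
qed

lemma component_is_interval: "Z \<in> components (S :: real set) \<Longrightarrow> is_interval Z"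
  using in_components_connected is_interval_connected_1 by blast

lemma iter_map_affine:
  assumes "\<sigma> \<in> admissible" "is_interval Z" "Z \<subseteq> smooth_points \<sigma> n" "x \<in> Z" "y \<in> Z"
  shows "iter_map \<sigma> n y - iter_map \<sigma> n x = expansion \<sigma> n * (y - x)"
proof -
  have "\<exists>c. \<forall>z\<in>Z. iter_map \<sigma> n z - expansion \<sigma> n * z = c"
  proof (rule has_field_derivative_zero_constant)
    show "convex Z" using assms(2) by (rule is_interval_convex)
    fix z assume "z \<in> Z"
    then have "(iter_map \<sigma> n has_real_derivative expansion \<sigma> n) (at z)"
      using iter_map_has_derivative[OF assms(1)] assms(3) by blast
    then have "((\<lambda>z. iter_map \<sigma> n z - expansion \<sigma> n * z) has_real_derivative 0) (at z)"
      by (auto intro!: derivative_eq_intros)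
    then show "((\<lambda>z. iter_map \<sigma> n z - expansion \<sigma> n * z) has_real_derivative 0) (at z within Z)"
      by (rule has_field_derivative_at_within)
  qed
  then have "iter_map \<sigma> n x - expansion \<sigma> n * x = iter_map \<sigma> n y - expansion \<sigma> n * y"
    using assms(4,5) by metis
  then show ?thesis by (simp add: algebra_simps)
qed

lemma iter_weight_live:
  assumes "\<sigma> \<in> admissible" "x \<in> live \<sigma> n"
  shows "iter_weight \<sigma> n x = 1 / expansion \<sigma> n"
proof -
  have "weight (\<sigma> j) (iter_map \<sigma> j x) = 1 / slope (\<sigma> j)" if "j < n" for j
  proof -
    have "iter_map \<sigma> j x \<in> snd (\<sigma> j)" "slope (\<sigma> j) * iter_map \<sigma> j x \<notin> \<int>"
      using assms(2) that interior_subset by (auto simp: live_def smooth_points_def)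
    then show ?thesis
      using DERIV_imp_deriv[OF beta_map_has_derivative] admissible_slope(1,4)[OF assms(1), of j]
      by (simp add: weight_def)
  qed
  then show ?thesis unfolding iter_weight_def expansion_def by (simp add: prod_dividef)
qed

lemma distortion_const_0: "distortion_const maps half_intervals 0"
  unfolding distortion_const_def
proof (intro conjI allI ballI)
  fix n \<sigma> Z assume \<sigma>: "\<sigma> \<in> admissible" and Z: "Z \<in> Z_star \<sigma> n"
  have "Z \<subseteq> live \<sigma> n" using Z_star_component[OF \<sigma> Z] by (rule in_components_subset)
  then have const: "iter_weight \<sigma> n x = 1 / expansion \<sigma> n" if "x \<in> Z" for x
    using iter_weight_live[OF \<sigma>] that by blast
  have "(\<Sum>i<length xs - 1. \<bar>iter_weight \<sigma> n (xs ! Suc i) - iter_weight \<sigma> n (xs ! i)\<bar>) = 0"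
    if "set xs \<subseteq> Z" for xs
  proof (intro sum.neutral ballI)
    fix i assume "i \<in> {..<length xs - 1}"
    then have "xs ! Suc i \<in> Z" "xs ! i \<in> Z" using that nth_mem[of _ xs] by (auto simp: subset_iff)
    then show "\<bar>iter_weight \<sigma> n (xs ! Suc i) - iter_weight \<sigma> n (xs ! i)\<bar> = 0" using const by simp
  qed
  then show "variation_on (iter_weight \<sigma> n) Z \<le> ereal (0 * ess_sup (\<lambda>x. \<bar>iter_weight \<sigma> n x\<bar>))"
    unfolding variation_on_def by (intro SUP_least) auto
qed simp

section \<open>Full cylinders\<close>

lemma live_Suc:
  "live \<sigma> (Suc n) = {x \<in> live \<sigma> n. slope (\<sigma> n) * iter_map \<sigma> n x \<notin> \<int> \<and> iter_map \<sigma> n x \<in> interior (snd (\<sigma> n))}"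
  by (auto simp: live_def smooth_points_def less_Suc_eq)

definition full :: "(nat \<Rightarrow> symb) \<Rightarrow> nat \<Rightarrow> real set \<Rightarrow> bool" where
  "full \<sigma> n F \<longleftrightarrow> is_interval F \<and> F \<subseteq> live \<sigma> n \<and> iter_map \<sigma> n ` F = {0<..<1}"

lemma full_nonempty: "full \<sigma> n F \<Longrightarrow> F \<noteq> {}"
  by (auto simp: full_def)

lemma live_affine:
  assumes "\<sigma> \<in> admissible" "is_interval P" "P \<subseteq> live \<sigma> n" "x \<in> P" "y \<in> P"
  shows "iter_map \<sigma> n y = iter_map \<sigma> n x + expansion \<sigma> n * (y - x)"
  using iter_map_affine[OF assms(1,2) _ assms(4,5)] assms(3) live_subset(1) by (fastforce simp: algebra_simps)

lemma live_mono_iff: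
  assumes "\<sigma> \<in> admissible" "is_interval P" "P \<subseteq> live \<sigma> n" "x \<in> P" "y \<in> P"
  shows "iter_map \<sigma> n x \<le> iter_map \<sigma> n y \<longleftrightarrow> x \<le> y"
  unfolding live_affine[OF assms] using expansion_pos[OF assms(1), of n]
  by (simp add: zero_le_mult_iff)

text \<open>
  An interval of length \<open>2/b\<close> contains a whole interval \<open>[i/b, (i+1)/b]\<close>, which one
  application of the map of slope \<open>b\<close> expands to \<open>[0, 1]\<close>.
\<close>

lemma full_child:
  assumes "\<sigma> \<in> admissible" "is_interval P" "P \<subseteq> live \<sigma> n"
    and "{u<..<v} \<subseteq> iter_map \<sigma> n ` P" "{u<..<v} \<subseteq> interior (snd (\<sigma> n))" "2 \<le> slope (\<sigma> n) * (v - u)"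
  obtains F where "F \<subseteq> P" "full \<sigma> (Suc n) F"
proof -
  define b where "b = slope (\<sigma> n)"
  have b: "b > 0" unfolding b_def by (rule admissible_slope(4)[OF assms(1)])
  define i where "i = \<lceil>b * u\<rceil>"
  have i: "b * u \<le> of_int i" "of_int i + 1 \<le> b * v"
    using assms(6) unfolding i_def b_def by (linarith, simp add: algebra_simps, linarith)
  \<comment> \<open>the part of \<open>P\<close> mapped into the branch \<open>(i/b, (i+1)/b)\<close>\<close>
  define F where "F = {y \<in> P. of_int i < b * iter_map \<sigma> n y \<and> b * iter_map \<sigma> n y < of_int i + 1}"
  have uv: "z \<in> {u<..<v}" if "of_int i < b * z" "b * z < of_int i + 1" for z
  proof -
    have "b * u < b * z" "b * z < b * v" using that i by linarith+
    then show ?thesis using b by simp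
  qed
  have frac_z: "frac z = z - of_int i" if "of_int i < z" "z < of_int i + 1" for z :: real
    using that by (simp add: frac_unique_iff)
  have "is_interval F"
    unfolding is_interval_1
  proof (intro ballI allI impI)
    fix x z y assume x: "x \<in> F" and z: "z \<in> F" and y: "x \<le> y \<and> y \<le> z"
    have "x \<in> P" "z \<in> P" using x z by (auto simp: F_def)
    then have "y \<in> P" using assms(2) y unfolding is_interval_1 by blast
    then have "b * iter_map \<sigma> n x \<le> b * iter_map \<sigma> n y" "b * iter_map \<sigma> n y \<le> b * iter_map \<sigma> n z"
      using live_mono_iff[OF assms(1-3)] \<open>x \<in> P\<close> \<open>z \<in> P\<close> y b by simp_all
    then show "y \<in> F" using x z \<open>y \<in> P\<close> by (auto simp: F_def)
  qed
  moreover have "F \<subseteq> live \<sigma> (Suc n)"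
  proof
    fix y assume y: "y \<in> F"
    then have iy: "of_int i < b * iter_map \<sigma> n y" "b * iter_map \<sigma> n y < of_int i + 1" "y \<in> P"
      by (auto simp: F_def)
    then have "b * iter_map \<sigma> n y \<notin> \<int>" by (auto elim!: Ints_cases)
    then show "y \<in> live \<sigma> (Suc n)" using uv[OF iy(1,2)] assms(3,5) iy(3) by (auto simp: live_Suc b_def)
  qed
  moreover have "iter_map \<sigma> (Suc n) ` F = {0<..<1}"
  proof
    show "iter_map \<sigma> (Suc n) ` F \<subseteq> {0<..<1}"
      unfolding iter_map_Suc_eq[OF assms(1)] b_def[symmetric] using frac_z by (auto simp: F_def)
    show "{0<..<1} \<subseteq> iter_map \<sigma> (Suc n) ` F"
    proof
      fix t :: real assume t: "t \<in> {0<..<1}"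
      define z where "z = (of_int i + t) / b"
      have bz: "b * z = of_int i + t" using b by (simp add: z_def)
      then have "z \<in> {u<..<v}" using t by (intro uv) auto
      then obtain y where y: "y \<in> P" "iter_map \<sigma> n y = z" using assms(4) by auto
      then have "y \<in> F" using bz t by (auto simp: F_def)
      moreover have "iter_map \<sigma> (Suc n) y = t"
        unfolding iter_map_Suc_eq[OF assms(1)] b_def[symmetric] y(2) bz using t frac_z[of "of_int i + t"] by simp
      ultimately show "t \<in> iter_map \<sigma> (Suc n) ` F" by blast
    qed
  qed
  ultimately show thesis using that[of F] by (auto simp: full_def F_def)
qed

lemma full_has_full_child:
  assumes "\<sigma> \<in> admissible" "full \<sigma> n P"
  obtains F where "F \<subseteq> P" "full \<sigma> (Suc n) F"
proof -
  have "snd (\<sigma> n) \<in> half_intervals" using admissible_letter[OF assms(1), of n] by auto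
  then obtain u where u: "u = 0 \<or> u = 1/2" "interior (snd (\<sigma> n)) = {u<..<u + 1/2}"
    using half_interval_interior by blast
  have "{u<..<u + 1/2} \<subseteq> iter_map \<sigma> n ` P" using assms(2) u(1) by (auto simp: full_def)
  moreover have "2 \<le> slope (\<sigma> n) * (u + 1/2 - u)" using admissible_slope(3)[OF assms(1), of n] by simp
  ultimately show thesis
    using full_child[OF assms(1), of P n u "u + 1/2"] u(2) assms(2) that unfolding full_def by blast
qed

text \<open>
  The endpoints of the middle child are not live although their images lie inside the half interval,
  hence these images are two consecutive discontinuities.
\<close>

lemma middle_child_full:
  assumes "\<sigma> \<in> admissible" "is_interval P" "P \<subseteq> live \<sigma> n"
    and "Z \<in> components (live \<sigma> (Suc n))" "Z \<subseteq> {x1<..<x3}"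
    and "x1 \<in> P \<inter> live \<sigma> (Suc n)" "x3 \<in> P \<inter> live \<sigma> (Suc n)"
  shows "full \<sigma> (Suc n) Z"
proof -
  define E where "E = slope (\<sigma> n) * expansion \<sigma> n"
  have E: "E > 0" unfolding E_def using admissible_slope(4)[OF assms(1)] expansion_pos[OF assms(1)] by simp
  obtain a c where ac: "a < c" "Z = {a<..<c}" "a \<notin> live \<sigma> (Suc n)" "c \<notin> live \<sigma> (Suc n)"
    by (rule component_live_interval[OF assms(1,4)])
  have bounds: "x1 \<le> a" "c \<le> x3" using assms(5) ac(1,2) by (simp_all add: greaterThanLessThan_subseteq_greaterThanLessThan)
  have convex_P: "y \<in> P" if "x1 \<le> y" "y \<le> x3" for y
    using assms(2,6,7) that unfolding is_interval_1 by blast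
  have endpoint: "slope (\<sigma> n) * iter_map \<sigma> n y \<in> \<int>" if y: "x1 \<le> y" "y \<le> x3" "y \<notin> live \<sigma> (Suc n)" for y
  proof -
    have "y \<in> P" using convex_P y by blast
    have "iter_map \<sigma> n x1 \<le> iter_map \<sigma> n y" "iter_map \<sigma> n y \<le> iter_map \<sigma> n x3"
      using live_mono_iff[OF assms(1-3)] \<open>y \<in> P\<close> assms(6,7) y by simp_all
    moreover have "is_interval (interior (snd (\<sigma> n)))"
      using half_interval_interior[of "snd (\<sigma> n)"] admissible_letter[OF assms(1), of n]
      by (metis is_interval_oo mem_Sigma_iff prod.collapse)
    moreover have "iter_map \<sigma> n x1 \<in> interior (snd (\<sigma> n))" "iter_map \<sigma> n x3 \<in> interior (snd (\<sigma> n))"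
      using assms(6,7) by (auto simp: live_Suc)
    ultimately have "iter_map \<sigma> n y \<in> interior (snd (\<sigma> n))" unfolding is_interval_1 by blast
    then show ?thesis using y(3) \<open>y \<in> P\<close> assms(3) by (auto simp: live_Suc)
  qed
  have "a \<in> P" using convex_P bounds ac(1) by auto
  obtain i where i: "slope (\<sigma> n) * iter_map \<sigma> n a = of_int i"
    using endpoint[of a] bounds ac by (auto elim: Ints_cases)
  have affine: "slope (\<sigma> n) * iter_map \<sigma> n y = of_int i + E * (y - a)" if "x1 \<le> y" "y \<le> x3" for y
    unfolding live_affine[OF assms(1-3) \<open>a \<in> P\<close> convex_P[OF that]] distrib_left i E_def by simp
  obtain k where "slope (\<sigma> n) * iter_map \<sigma> n c = of_int k"
    using endpoint[of c] bounds ac by (auto elim: Ints_cases)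
  then have k: "E * (c - a) = of_int (k - i)" using affine[of c] bounds ac(1) by simp
  then have "0 < k - i" using E ac(1) by (metis diff_gt_0_iff_gt mult_pos_pos of_int_0_less_iff)
  moreover have "\<not> 1 < k - i"
  proof
    assume "1 < k - i"
    define y where "y = a + 1 / E"
    have "1 < E * (c - a)" unfolding k using \<open>1 < k - i\<close> by simp
    then have "a < y" "y < c" using E by (simp_all add: y_def field_simps)
    then have "y \<in> live \<sigma> (Suc n)" using in_components_subset[OF assms(4)] ac(2) by auto
    moreover have "slope (\<sigma> n) * iter_map \<sigma> n y = of_int (i + 1)"
    proof -
      have "x1 \<le> y" "y \<le> x3" using \<open>a < y\<close> \<open>y < c\<close> bounds by linarith+
      then show ?thesis unfolding affine[OF \<open>x1 \<le> y\<close> \<open>y \<le> x3\<close>] using E by (simp add: y_def)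
    qed
    ultimately show False by (auto simp: live_Suc)
  qed
  ultimately have "E * (c - a) = 1" using k by simp
  then have len: "c - a = 1 / E" using E by (simp add: field_simps)
  have unit: "0 < E * (y - a)" "E * (y - a) < 1" if "y \<in> Z" for y
  proof -
    have "0 < y - a" "y - a < 1 / E" using that ac(2) len by auto
    then show "0 < E * (y - a)" "E * (y - a) < 1" using E by (simp_all add: field_simps)
  qed
  have eq: "iter_map \<sigma> (Suc n) y = E * (y - a)" if "y \<in> Z" for y
  proof -
    have "x1 \<le> y" "y \<le> x3" using that ac(2) bounds by auto
    then show ?thesis
      unfolding iter_map_Suc_eq[OF assms(1)] affine[OF \<open>x1 \<le> y\<close> \<open>y \<le> x3\<close>]
      using unit[OF that] by (simp add: frac_eq)
  qed
  have "iter_map \<sigma> (Suc n) ` Z = {0<..<1}"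
  proof
    show "iter_map \<sigma> (Suc n) ` Z \<subseteq> {0<..<1}" using eq unit by auto
    show "{0<..<1} \<subseteq> iter_map \<sigma> (Suc n) ` Z"
    proof
      fix t :: real assume t: "t \<in> {0<..<1}"
      define y where "y = a + t / E"
      have "0 < t / E" "t / E < c - a" using t E unfolding len by (simp_all add: divide_strict_right_mono)
      then have "y \<in> Z" unfolding y_def ac(2) by simp
      moreover have "iter_map \<sigma> (Suc n) y = t" using eq[OF \<open>y \<in> Z\<close>] E by (simp add: y_def)
      ultimately show "t \<in> iter_map \<sigma> (Suc n) ` Z" by blast
    qed
  qed
  then show ?thesis
    unfolding full_def using ac(2) in_components_subset[OF assms(4)] by (simp add: is_interval_oo)
qed

text \<open>
  One of the nonnegative summands of the iterated transfer operator belongs to the given orbit.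
\<close>

lemma iter_transfer_orbit:
  assumes "\<sigma> \<in> admissible" "y \<in> live \<sigma> n" "iter_map \<sigma> n y \<in> regular"
    and "\<And>y. y \<in> regular \<Longrightarrow> 0 \<le> f y"
  shows "f y / expansion \<sigma> n \<le> iter_transfer \<sigma> n f (iter_map \<sigma> n y)"
  using assms(2,3)
proof (induction n)
  case 0
  then show ?case by (simp add: expansion_def)
next
  case (Suc n)
  define z where "z = iter_map \<sigma> n y"
  define x where "x = iter_map \<sigma> (Suc n) y"
  note s = admissible_letter[OF assms(1), of n]
  note b = admissible_slope[OF assms(1), of n]
  have x: "x \<in> regular" "beta_map (slope (\<sigma> n)) z = x"
    using Suc.prems(2) b(1) by (auto simp: x_def z_def)
  have "z \<in> {0..1}"
    unfolding z_def using Suc.prems(1) live_subset(2)[of \<sigma> "Suc n"] by (intro iter_map_unit[OF assms(1)]) auto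
  then have z: "z \<in> fibre (slope (\<sigma> n)) x" "z \<in> regular"
    using x regular_preimage(1)[OF b(2)] by (auto simp: fibre_def)
  have "z \<in> snd (\<sigma> n)" using Suc.prems(1) interior_subset by (auto simp: live_Suc z_def)
  have "f y / expansion \<sigma> n \<le> iter_transfer \<sigma> n f z"
    unfolding z_def using Suc.prems z(2) by (intro Suc.IH) (auto simp: live_Suc z_def)
  also have "\<dots> = iter_transfer \<sigma> n f z * indicator (snd (\<sigma> n)) z" using \<open>z \<in> snd (\<sigma> n)\<close> by simp
  also have "\<dots> \<le> (\<Sum>z\<in>fibre (slope (\<sigma> n)) x. iter_transfer \<sigma> n f z * indicator (snd (\<sigma> n)) z)"
  proof (rule member_le_sum[OF z(1) _ finite_fibre[OF b(2)]])
    fix w assume "w \<in> fibre (slope (\<sigma> n)) x - {z}"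
    then have "w \<in> regular" using fibre_regular(1)[OF b(2) x(1)] by blast
    then show "0 \<le> iter_transfer \<sigma> n f w * indicator (snd (\<sigma> n)) w"
      using iter_transfer_nonneg[OF assms(1) _ assms(4)] by simp
  qed
  finally have "f y / expansion \<sigma> n / slope (\<sigma> n) \<le>
      (\<Sum>z\<in>fibre (slope (\<sigma> n)) x. iter_transfer \<sigma> n f z * indicator (snd (\<sigma> n)) z) / slope (\<sigma> n)"
    using b(4) by (intro divide_right_mono) auto
  also have "\<dots> = iter_transfer \<sigma> (Suc n) f x" using transfer_open_eq[OF s x(1)] by simp
  finally show ?case unfolding x_def by (simp add: expansion_Suc mult.commute)
qed

text \<open>
  A full set has a preimage of every regular point, with weight \<open>1 / expansion \<sigma> k\<close>; the constant
  function 1 has grown by at most \<open>2\<^sup>k\<close> in the same time.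
\<close>

lemma full_ratio:
  assumes "\<sigma> \<in> admissible" "full \<sigma> k F" "F \<subseteq> Z" "k \<le> n" "x \<in> regular"
  shows "1 / (expansion \<sigma> k * 2 ^ k) \<le> ratio \<sigma> n (indicator Z) x"
proof (rule ratio_ge[OF assms(1,4,5)])
  fix x assume x: "x \<in> regular"
  have E: "0 < expansion \<sigma> k" by (rule expansion_pos[OF assms(1)])
  have "x \<in> iter_map \<sigma> k ` F" using assms(2) regularD(1,2)[OF x] by (simp add: full_def)
  then obtain y where y: "y \<in> F" "x = iter_map \<sigma> k y" by blast
  have "1 / (expansion \<sigma> k * 2 ^ k) * iter_transfer \<sigma> k (\<lambda>_. 1) x \<le> 1 / (expansion \<sigma> k * 2 ^ k) * 2 ^ k"
    using iter_transfer_one(1)[OF assms(1) x] E by (intro mult_left_mono) auto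
  also have "\<dots> = 1 / expansion \<sigma> k" by simp
  also have "\<dots> = indicator Z y / expansion \<sigma> k" using y assms(3) by auto
  also have "\<dots> \<le> iter_transfer \<sigma> k (indicator Z) (iter_map \<sigma> k y)"
    using assms(2) y x by (intro iter_transfer_orbit[OF assms(1)]) (auto simp: full_def)
  finally show "1 / (expansion \<sigma> k * 2 ^ k) * iter_transfer \<sigma> k (\<lambda>_. 1) x \<le> iter_transfer \<sigma> k (indicator Z) x"
    using y(2) by simp
qed

lemma full_good:
  assumes "\<sigma> \<in> admissible" "full \<sigma> k F" "F \<subseteq> Z"
  shows "0 < Lambda \<sigma> (indicator Z)"
proof -
  have "0 < 1 / (expansion \<sigma> k * 2 ^ k)" using expansion_pos[OF assms(1)] by simp
  also have "\<dots> \<le> Lambda \<sigma> (indicator Z)"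
    by (rule Lambda_ge[OF assms(1), where M = 1 and k = k])
      (auto simp: indicator_def intro: full_ratio[OF assms])
  finally show ?thesis .
qed

section \<open>Contiguous bad cylinders\<close>

lemma card_le_2I:
  fixes S :: "real set set"
  assumes "\<And>Z. Z \<in> S \<Longrightarrow> is_interval Z \<and> p Z \<in> Z"
    and "\<And>Z Z'. Z \<in> S \<Longrightarrow> Z' \<in> S \<Longrightarrow> Z \<noteq> Z' \<Longrightarrow> Z \<inter> Z' = {}"
    and "\<And>Z1 Z2 Z3. Z1 \<in> S \<Longrightarrow> Z2 \<in> S \<Longrightarrow> Z3 \<in> S \<Longrightarrow> \<not> Z2 \<subseteq> {p Z1<..<p Z3}"
  shows "card S \<le> 2"
proof (rule ccontr)
  assume "\<not> card S \<le> 2"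
  then have "3 \<le> card S" by simp
  with assms(1,2) obtain Z1 Z2 Z3 where "Z1 \<in> S" "Z2 \<in> S" "Z3 \<in> S" "Z2 \<subseteq> {p Z1<..<p Z3}"
    by (rule three_ordered_intervals)
  then show False using assms(3) by blast
qed

lemma card_le_mult_image:
  assumes "finite S" "\<And>y. y \<in> f ` S \<Longrightarrow> card {x \<in> S. f x = y} \<le> m"
  shows "card S \<le> m * card (f ` S)"
proof -
  have "card S = (\<Sum>y\<in>f ` S. card {x \<in> S. f x = y})"
    using sum.image_gen[OF assms(1), of "\<lambda>_. 1::nat" f] by simp
  also have "\<dots> \<le> (\<Sum>y\<in>f ` S. m)" using assms(2) by (rule sum_mono)
  finally show ?thesis by (simp add: mult.commute)
qed

text \<open>
  This is the recursion \<open>a\<^sub>n \<le> 2 (a\<^sub>n\<^sub>-\<^sub>1 + 2)\<close>: a parent has at most two children in \<open>I\<close>, and at most two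
  parents stick out of \<open>I\<close>, because a third one would lie between points of \<open>I\<close>.
\<close>

lemma card_components_without_full:
  assumes "\<sigma> \<in> admissible" "is_interval I"
  shows "\<lbrakk>\<And>F. F \<subseteq> I \<Longrightarrow> \<not> full \<sigma> n F; finite S; S \<subseteq> components (live \<sigma> n); \<Union>S \<subseteq> I\<rbrakk>
    \<Longrightarrow> card S + 4 \<le> 4 * 2 ^ n"
proof (induction n arbitrary: S)
  case 0
  have live_0: "live \<sigma> 0 = {0<..<1}" by (auto simp: live_def smooth_points_def)
  have "S = {}"
  proof (rule ccontr)
    assume "S \<noteq> {}"
    then obtain Z where Z: "Z \<in> S" by blast
    then obtain a b where "a < b" "Z = {a<..<b}" "a \<notin> live \<sigma> 0" "b \<notin> live \<sigma> 0"
      using component_live_interval[OF assms(1)] "0.prems"(3) by blast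
    moreover have "Z \<subseteq> live \<sigma> 0" using Z "0.prems"(3) in_components_subset by blast
    ultimately have "Z = {0<..<1}"
      unfolding live_0 by (auto simp: greaterThanLessThan_subseteq_greaterThanLessThan)
    then have "full \<sigma> 0 Z" by (simp add: full_def live_0 is_interval_oo)
    then show False using "0.prems"(1,4) Z by blast
  qed
  then show ?case by simp
next
  case (Suc n)
  have comp: "Z \<in> components (live \<sigma> (Suc n))" if "Z \<in> S" for Z using Suc.prems(3) that by blast
  have "\<forall>Z\<in>S. \<exists>C. C \<in> components (live \<sigma> n) \<and> Z \<subseteq> C"
  proof
    fix Z assume "Z \<in> S"
    have "Z \<subseteq> live \<sigma> n" "connected Z" "Z \<noteq> {}"
      using in_components_subset[OF comp[OF \<open>Z \<in> S\<close>]] in_components_connected[OF comp[OF \<open>Z \<in> S\<close>]]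
        in_components_nonempty[OF comp[OF \<open>Z \<in> S\<close>]] by (auto simp: live_Suc)
    then show "\<exists>C. C \<in> components (live \<sigma> n) \<and> Z \<subseteq> C"
      by (intro exists_component_superset) auto
  qed
  then obtain parent where parent: "\<And>Z. Z \<in> S \<Longrightarrow> parent Z \<in> components (live \<sigma> n) \<and> Z \<subseteq> parent Z"
    by metis
  define pt :: "real set \<Rightarrow> real" where "pt Z = (SOME x. x \<in> Z)" for Z
  have pt: "pt Z \<in> Z" if "Z \<in> S" for Z
    unfolding pt_def using in_components_nonempty[OF comp[OF that]] by (rule some_in_eq[THEN iffD2])
  \<comment> \<open>a third child of the same parent would make the middle one full\<close>
  have siblings: "card {Z \<in> S. parent Z = C} \<le> 2" if C: "C \<in> parent ` S" for C
  proof (rule card_le_2I[where p = pt])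
    show "is_interval Z \<and> pt Z \<in> Z" if "Z \<in> {Z \<in> S. parent Z = C}" for Z
      using that component_is_interval comp pt by blast
    show "Z \<inter> Z' = {}" if "Z \<in> {Z \<in> S. parent Z = C}" "Z' \<in> {Z \<in> S. parent Z = C}" "Z \<noteq> Z'" for Z Z'
      using that components_nonoverlap comp by blast
    fix Z1 Z2 Z3
    assume Z: "Z1 \<in> {Z \<in> S. parent Z = C}" "Z2 \<in> {Z \<in> S. parent Z = C}" "Z3 \<in> {Z \<in> S. parent Z = C}"
    have C': "C \<in> components (live \<sigma> n)" using C parent by blast
    show "\<not> Z2 \<subseteq> {pt Z1<..<pt Z3}"
    proof
      assume between: "Z2 \<subseteq> {pt Z1<..<pt Z3}"
      have mem: "pt Z \<in> C \<inter> live \<sigma> (Suc n)" if "Z \<in> S" "parent Z = C" for Z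
        using pt[OF that(1)] parent[OF that(1)] that(2) in_components_subset[OF comp[OF that(1)]] by blast
      have "full \<sigma> (Suc n) Z2"
        using Z comp mem
        by (intro middle_child_full[OF assms(1) component_is_interval[OF C'] in_components_subset[OF C'] _ between]) auto
      then show False using Suc.prems(1,4) Z by blast
    qed
  qed
  define P where "P = parent ` S"
  have P: "finite P" "P \<subseteq> components (live \<sigma> n)" using Suc.prems(2) parent by (auto simp: P_def)
  have inner: "card {C \<in> P. C \<subseteq> I} + 4 \<le> 4 * 2 ^ n"
  proof (rule Suc.IH)
    fix F assume "F \<subseteq> I"
    show "\<not> full \<sigma> n F"
    proof
      assume "full \<sigma> n F"
      then obtain F' where "F' \<subseteq> F" "full \<sigma> (Suc n) F'" by (rule full_has_full_child[OF assms(1)])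
      then show False using Suc.prems(1) \<open>F \<subseteq> I\<close> by blast
    qed
  qed (use P in auto)
  \<comment> \<open>the points chosen in the protruding parents lie in \<open>I\<close>, so a middle parent would not protrude\<close>
  have outer: "card {C \<in> P. \<not> C \<subseteq> I} \<le> 2"
  proof -
    define q where "q C = (SOME x. x \<in> C \<inter> I)" for C
    have q: "q C \<in> C \<inter> I" if "C \<in> P" for C
    proof -
      obtain Z where Z: "Z \<in> S" "C = parent Z" using \<open>C \<in> P\<close> by (auto simp: P_def)
      then have "pt Z \<in> C \<inter> I" using pt[OF Z(1)] parent[OF Z(1)] Suc.prems(4) by blast
      then show ?thesis unfolding q_def by (rule someI)
    qed
    show ?thesis
    proof (rule card_le_2I[where p = q])
      show "is_interval C \<and> q C \<in> C" if "C \<in> {C \<in> P. \<not> C \<subseteq> I}" for C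
        using that component_is_interval P(2) q by blast
      show "C \<inter> C' = {}" if "C \<in> {C \<in> P. \<not> C \<subseteq> I}" "C' \<in> {C \<in> P. \<not> C \<subseteq> I}" "C \<noteq> C'" for C C'
        using that components_nonoverlap P(2) by blast
      fix C1 C2 C3
      assume C: "C1 \<in> {C \<in> P. \<not> C \<subseteq> I}" "C2 \<in> {C \<in> P. \<not> C \<subseteq> I}" "C3 \<in> {C \<in> P. \<not> C \<subseteq> I}"
      then have "q C1 \<in> I" "q C3 \<in> I" using q by auto
      then have "{q C1..q C3} \<subseteq> I"
        using assms(2) unfolding is_interval_1 atLeastAtMost_def by blast
      then have "{q C1<..<q C3} \<subseteq> I"
        using greaterThanLessThan_subseteq_atLeastAtMost_iff by fastforce
      then show "\<not> C2 \<subseteq> {q C1<..<q C3}" using C by blast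
    qed
  qed
  have "P = {C \<in> P. C \<subseteq> I} \<union> {C \<in> P. \<not> C \<subseteq> I}" by blast
  then have "card P \<le> card {C \<in> P. C \<subseteq> I} + card {C \<in> P. \<not> C \<subseteq> I}"
    using card_Un_le by metis
  moreover have "card S \<le> 2 * card P"
    unfolding P_def using Suc.prems(2) siblings by (rule card_le_mult_image)
  ultimately have "card S + 4 \<le> 2 * (4 * 2 ^ n)" using inner outer by linarith
  then show ?case by simp
qed

text \<open>
  A live point is an obstacle for contiguity: it lies neither in the hole nor at an endpoint of a
  component.
\<close>

lemma contiguous_same_side:
  assumes "\<sigma> \<in> admissible" "Z \<in> components (live \<sigma> n)" "Z' \<in> components (live \<sigma> n)"
    and "f \<in> live \<sigma> n" "f \<notin> Z'" "contiguous \<sigma> n Z Z'" "\<forall>z\<in>Z. z < f"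
  shows "\<forall>z\<in>Z'. z < f"
proof (rule ccontr)
  assume *: "\<not> (\<forall>z\<in>Z'. z < f)"
  obtain a b where ab: "a < b" "Z = {a<..<b}" "a \<notin> live \<sigma> n" "b \<notin> live \<sigma> n"
    by (rule component_live_interval[OF assms(1,2)])
  obtain a' b' where ab': "a' < b'" "Z' = {a'<..<b'}" "a' \<notin> live \<sigma> n" "b' \<notin> live \<sigma> n"
    by (rule component_live_interval[OF assms(1,3)])
  have "b \<le> f" using assms(7) ab(1,2) by (metis dense_le_bounded greaterThanLessThan_iff less_imp_le)
  moreover have "b \<noteq> f" using ab(4) assms(4) by metis
  ultimately have "b < f" by simp
  have "f \<le> a'" using * assms(5) ab'(2) by (auto simp: not_less)
  moreover have "a' \<noteq> f" using ab'(3) assms(4) by metis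
  ultimately have "f < a'" by simp
  have ends: "Sup Z = b" "Inf Z = a" "Sup Z' = b'" "Inf Z' = a'" using ab(1,2) ab'(1,2) by simp_all
  have "f \<in> surviving_open \<sigma> n" using assms(4) live_eq_surviving_open[OF assms(1)] by blast
  then have not_hole: "f \<notin> hole \<sigma> n" using closure_subset by (auto simp: hole_def)
  have J: "J \<noteq> {}" "bdd_below J" "bdd_above J" "is_interval J" "J \<subseteq> hole \<sigma> n"
    if "J \<in> components (hole \<sigma> n)" for J
  proof -
    show sub: "J \<subseteq> hole \<sigma> n" using that by (rule in_components_subset)
    then have "J \<subseteq> {0..1}" by (auto simp: hole_def)
    then show "bdd_below J" "bdd_above J" by (meson bdd_below_Icc bdd_above_Icc bdd_below_mono bdd_above_mono)+
    show "J \<noteq> {}" "is_interval J" using that in_components_nonempty component_is_interval by blast+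
  qed
  from assms(6) consider "left_neighbour \<sigma> n Z Z'" | "left_neighbour \<sigma> n Z' Z"
    unfolding contiguous_def by blast
  then show False
  proof cases
    case 1
    then obtain J where J': "J \<in> components (hole \<sigma> n)" "b = Inf J" "Sup J = a'"
      unfolding left_neighbour_def ends using \<open>b < f\<close> \<open>f < a'\<close> by auto
    obtain x where "x \<in> J" "x < f"
      using cInf_lessD[OF J(1)[OF J'(1)], of f] J'(2) \<open>b < f\<close> by auto
    moreover obtain y where "y \<in> J" "f < y"
      using less_cSupD[OF J(1)[OF J'(1)], of f] J'(3) \<open>f < a'\<close> by auto
    ultimately have "f \<in> J" using J(4)[OF J'(1)] unfolding is_interval_1 by (meson less_imp_le)
    then show False using J(5)[OF J'(1)] not_hole by blast
  next
    case 2
    then obtain J where J': "J \<in> components (hole \<sigma> n)" "b' = Inf J" "Sup J = a"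
      unfolding left_neighbour_def ends using \<open>b < f\<close> \<open>f < a'\<close> ab(1) ab'(1) by auto
    obtain x where "x \<in> J" using J(1)[OF J'(1)] by blast
    then have "Inf J \<le> Sup J"
      using cInf_lower[OF _ J(2)[OF J'(1)], of x] cSup_upper[OF _ J(3)[OF J'(1)], of x] by simp
    then show False using J'(2,3) \<open>b < f\<close> \<open>f < a'\<close> ab(1) ab'(1) by linarith
  qed
qed

lemma contiguous_chain_same_side:
  assumes "\<sigma> \<in> admissible" "f \<in> live \<sigma> n"
    and "successively (contiguous \<sigma> n) Zs" "set Zs \<subseteq> components (live \<sigma> n)" "\<And>Z. Z \<in> set Zs \<Longrightarrow> f \<notin> Z"
    and "Z \<in> set Zs" "Z' \<in> set Zs" "\<forall>z\<in>Z. z < f"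
  shows "\<forall>z\<in>Z'. z < f"
proof -
  define left where "left Z \<longleftrightarrow> (\<forall>z\<in>Z. z < f)" for Z
  have step: "left X \<longleftrightarrow> left Y" if "contiguous \<sigma> n X Y" "X \<in> set Zs" "Y \<in> set Zs" for X Y
  proof -
    have "contiguous \<sigma> n Y X" using that(1) by (auto simp: contiguous_def)
    then show ?thesis
      unfolding left_def
      using contiguous_same_side[OF assms(1) _ _ assms(2)] that assms(4,5) by (meson subsetD)
  qed
  have "\<forall>X\<in>set Ws. left X \<longleftrightarrow> left (hd Ws)"
    if "successively (contiguous \<sigma> n) Ws" "set Ws \<subseteq> set Zs" for Ws
    using that
  proof (induction Ws)
    case (Cons X Ws)
    then show ?case
    proof (cases Ws)
      case (Cons Y Ws')
      then have "\<forall>X\<in>set Ws. left X \<longleftrightarrow> left Y" "left X \<longleftrightarrow> left Y"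
        using Cons.IH Cons.prems step[of X Y] by auto
      then show ?thesis using Cons by auto
    qed simp
  qed simp
  then have "left Z \<longleftrightarrow> left Z'" using assms(3,6,7) by blast
  then show ?thesis using assms(8) by (simp add: left_def)
qed

text \<open>
  A full set in the convex hull of a chain of bad elements would be disjoint from all of them, and the
  chain would have to jump across it.
\<close>

lemma contiguous_bad_length:
  assumes "\<sigma> \<in> admissible" "distinct Zs" "set Zs \<subseteq> Z_bad \<sigma> n" "successively (contiguous \<sigma> n) Zs"
  shows "length Zs \<le> 4 * 2 ^ n"
proof -
  have comp: "set Zs \<subseteq> components (live \<sigma> n)"
    using assms(3) Z_star_component[OF assms(1)] by (auto simp: Z_bad_def)
  define I where "I = {x. \<exists>y\<in>\<Union>(set Zs). \<exists>z\<in>\<Union>(set Zs). y \<le> x \<and> x \<le> z}"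
  have "is_interval I"
    unfolding is_interval_1 I_def by (blast intro: order_trans)
  moreover have "\<not> full \<sigma> n F" if sub: "F \<subseteq> I" for F
  proof
    assume F: "full \<sigma> n F"
    then obtain f where f: "f \<in> F" using full_nonempty by blast
    then have "f \<in> live \<sigma> n" using F by (auto simp: full_def)
    have not_mem: "f \<notin> Z" if "Z \<in> set Zs" for Z
    proof
      assume "f \<in> Z"
      have "Z \<in> components (live \<sigma> n)" using that comp by blast
      moreover have "connected F" "F \<subseteq> live \<sigma> n"
        using F is_interval_connected_1 by (auto simp: full_def)
      moreover have "Z \<inter> F \<noteq> {}" using f \<open>f \<in> Z\<close> by blast
      ultimately have "F \<subseteq> Z" by (rule components_maximal)
      then have "0 < Lambda \<sigma> (indicator Z)" by (rule full_good[OF assms(1) F])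
      then show False using assms(3) that by (auto simp: Z_bad_def)
    qed
    have "f \<in> I" using f sub by blast
    then obtain Y Z y z where yz: "Y \<in> set Zs" "Z \<in> set Zs" "y \<in> Y" "z \<in> Z" "y \<le> f" "f \<le> z"
      unfolding I_def by blast
    have "w < f" if "w \<in> Y" for w
    proof (rule ccontr)
      assume "\<not> w < f"
      moreover have "is_interval Y" using comp yz(1) component_is_interval by blast
      ultimately have "f \<in> Y" using that yz(3,5) unfolding is_interval_1 by (meson not_less)
      then show False using not_mem yz(1) by blast
    qed
    then have "\<forall>w\<in>Z. w < f"
      using contiguous_chain_same_side[OF assms(1) \<open>f \<in> live \<sigma> n\<close> assms(4) comp not_mem yz(1,2)] by blast
    then show False using yz(4,6) by auto
  qed
  moreover have "\<Union>(set Zs) \<subseteq> I" unfolding I_def by auto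
  ultimately have "card (set Zs) + 4 \<le> 4 * 2 ^ n"
    using card_components_without_full[OF assms(1), of I n "set Zs"] comp by blast
  then show ?thesis using distinct_card[OF assms(2)] by simp
qed

lemma C2_holds: "C2 maps half_intervals 4 2"
proof -
  have "2 / \<beta> < 1/4" using beta by (simp add: field_simps)
  then have "2 * Theta maps < min (rho maps half_intervals) 1"
    using rho_ge unfolding Theta_eq by linarith
  moreover have "real (length Zs) \<le> 4 * 2 ^ n"
    if "\<sigma> \<in> admissible" "distinct Zs \<and> set Zs \<subseteq> Z_bad \<sigma> n \<and> successively (contiguous \<sigma> n) Zs" for n \<sigma> Zs
    using contiguous_bad_length[OF that(1)] that(2)
    by (metis of_nat_le_iff of_nat_mult of_nat_numeral of_nat_power)
  ultimately show ?thesis unfolding C2_def by simp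
qed

section \<open>Separated critical orbits\<close>

text \<open>
  The condition is imposed before reduction modulo 1, so that being far from the multiples of 1/2 keeps
  the next orbit point away from 0, 1/2 and 1.
\<close>

definition separated :: "nat \<Rightarrow> bool" where
  "separated N \<longleftrightarrow> (\<forall>bs \<in> lists {\<beta>, \<omega> * \<beta>}. length bs < N \<longrightarrow>
     (\<forall>b\<in>{\<beta>, \<omega> * \<beta>}. \<forall>v\<in>{1/2, 1}. \<forall>h::int. 3 / \<beta> \<le> \<bar>b * foldr beta_map bs v - of_int h / 2\<bar>))"

definition orbit_values :: "nat \<Rightarrow> real set" where
  "orbit_values k = {foldr beta_map bs v | bs v.
     bs \<in> lists {\<beta>, \<omega> * \<beta>} \<and> 1 \<le> length bs \<and> length bs \<le> k \<and> v \<in> {1/2, 1}}"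

lemma orbit_values_step:
  assumes "b \<in> {\<beta>, \<omega> * \<beta>}" "w \<in> {1/2, 1} \<union> orbit_values k"
  shows "frac (b * w) \<in> orbit_values (Suc k)"
proof -
  have "\<exists>bs v. w = foldr beta_map bs v \<and> bs \<in> lists {\<beta>, \<omega> * \<beta>} \<and> length bs \<le> k \<and> v \<in> {1/2, 1}"
  proof (cases "w \<in> orbit_values k")
    case True
    then show ?thesis unfolding orbit_values_def by blast
  next
    case False
    then have "w = foldr beta_map [] w" "w \<in> {1/2, 1}" using assms(2) by auto
    then show ?thesis by (intro exI[of _ "[]"] exI[of _ w]) auto
  qed
  then obtain bs v where w: "w = foldr beta_map bs v" "bs \<in> lists {\<beta>, \<omega> * \<beta>}" "length bs \<le> k" "v \<in> {1/2, 1}"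
    by blast
  have "frac (b * w) = foldr beta_map (b # bs) v" using w(1) by (simp add: beta_map_def)
  moreover have "b # bs \<in> lists {\<beta>, \<omega> * \<beta>}" using assms(1) w(2) by simp
  moreover have "1 \<le> length (b # bs)" "length (b # bs) \<le> Suc k" using w(3) by simp_all
  ultimately show ?thesis unfolding orbit_values_def using w(4) by blast
qed

lemma orbit_values_separated:
  assumes "separated N" "k \<le> N" "w \<in> orbit_values k"
  shows "3 / \<beta> \<le> w" "w \<le> 1 - 3 / \<beta>" "3 / \<beta> \<le> \<bar>w - 1/2\<bar>"
proof -
  obtain bs v where bs: "w = foldr beta_map bs v" "bs \<in> lists {\<beta>, \<omega> * \<beta>}" "1 \<le> length bs" "length bs \<le> k" "v \<in> {1/2, 1}"
    using assms(3) unfolding orbit_values_def by blast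
  then obtain b cs where cs: "bs = b # cs" by (cases bs) auto
  define z where "z = b * foldr beta_map cs v"
  have far: "3 / \<beta> \<le> \<bar>z - of_int h / 2\<bar>" for h :: int
  proof -
    have "cs \<in> lists {\<beta>, \<omega> * \<beta>}" "length cs < N" "b \<in> {\<beta>, \<omega> * \<beta>}" using bs cs assms(2) by auto
    then show ?thesis using assms(1) bs(5) unfolding separated_def z_def by blast
  qed
  have w: "w = z - of_int \<lfloor>z\<rfloor>" using bs(1) cs by (simp add: beta_map_def frac_def z_def)
  have "0 \<le> w" "w < 1" unfolding w by linarith+
  moreover have "3 / \<beta> \<le> \<bar>w\<bar>" "3 / \<beta> \<le> \<bar>w - 1\<bar>" "3 / \<beta> \<le> \<bar>w - 1/2\<bar>"
    using far[of "2 * \<lfloor>z\<rfloor>"] far[of "2 * \<lfloor>z\<rfloor> + 2"] far[of "2 * \<lfloor>z\<rfloor> + 1"]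
    unfolding w by (simp_all add: add_divide_distrib diff_diff_eq)
  ultimately show "3 / \<beta> \<le> w" "w \<le> 1 - 3 / \<beta>" "3 / \<beta> \<le> \<bar>w - 1/2\<bar>" by linarith+
qed

text \<open>
  The possible images \<open>(p, q)\<close> of the components of level \<open>k\<close> when critical orbits are separated.
\<close>

definition shape :: "nat \<Rightarrow> real \<Rightarrow> real \<Rightarrow> bool" where
  "shape k p q \<longleftrightarrow> p \<in> {0} \<union> orbit_values k \<and> q \<in> {1} \<union> orbit_values k \<and> (p = 0 \<or> q = 1)"

text \<open>
  The free endpoint of the image is at distance \<open>3/\<beta>\<close> from 0, 1/2 and 1, so cutting at 1/2 cannot
  leave a short interval.
\<close>

lemma shape_cut:
  assumes "separated N" "k \<le> N" "shape k p q" "u = 0 \<or> u = 1/2"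
  defines "p' \<equiv> max p u" and "q' \<equiv> min q (u + 1/2)"
  assumes "p' < q'"
  shows "3 / \<beta> \<le> q' - p'" "p' = 0 \<or> p' \<in> {1/2, 1} \<union> orbit_values k" "q' \<in> {1/2, 1} \<union> orbit_values k"
proof -
  have small: "3 / \<beta> \<le> 1/4" using beta by (simp add: field_simps)
  have pos: "0 < 3 / \<beta>" using beta by simp
  note V = orbit_values_separated[OF assms(1,2)]
  have p: "p = 0 \<or> p \<in> orbit_values k \<and> 3 / \<beta> \<le> p \<and> p \<le> 1 - 3 / \<beta> \<and> 3 / \<beta> \<le> \<bar>p - 1/2\<bar>"
    using assms(3) V[of p] unfolding shape_def by auto
  have q: "q = 1 \<or> q \<in> orbit_values k \<and> 3 / \<beta> \<le> q \<and> q \<le> 1 - 3 / \<beta> \<and> 3 / \<beta> \<le> \<bar>q - 1/2\<bar>"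
    using assms(3) V[of q] unfolding shape_def by auto
  have pq: "p = 0 \<or> q = 1" using assms(3) unfolding shape_def by auto
  have "p' = p \<or> p' = u" "q' = q \<or> q' = u + 1/2" unfolding p'_def q'_def by linarith+
  then show "p' = 0 \<or> p' \<in> {1/2, 1} \<union> orbit_values k" "q' \<in> {1/2, 1} \<union> orbit_values k"
    using p q assms(4) by auto
  define d where "d = 3 / \<beta>"
  have "(p = 0 \<or> d \<le> p \<and> p \<le> 1 - d \<and> d \<le> \<bar>p - 1/2\<bar>)" "(q = 1 \<or> d \<le> q \<and> q \<le> 1 - d \<and> d \<le> \<bar>q - 1/2\<bar>)"
    "0 < d" "d \<le> 1/4" using p q pos small unfolding d_def by blast+
  then show "3 / \<beta> \<le> q' - p'"
    using pq assms(4,7) unfolding d_def[symmetric] p'_def q'_def by linarith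
qed

text \<open>
  A child is bounded on each side either by a discontinuity, which maps to an end of the unit
  interval, or by an end of the cut image of its parent, which maps to a critical orbit point.  The
  cut image contains a full branch, so both ends of a child cannot be of the second kind.
\<close>

lemma component_shape:
  assumes "\<sigma> \<in> admissible" "separated N" "k \<le> N" "Z \<in> components (live \<sigma> k)" "Z = {a<..<c}" "a < c"
  shows "\<exists>p q. shape k p q \<and> q = p + expansion \<sigma> k * (c - a)
    \<and> (\<forall>y\<in>Z. iter_map \<sigma> k y = p + expansion \<sigma> k * (y - a))"
  using assms(3-6)
proof (induction k arbitrary: Z a c)
  case 0
  have live_0: "live \<sigma> 0 = {0<..<1}" by (auto simp: live_def smooth_points_def)
  obtain a' b' where "a' < b'" "Z = {a'<..<b'}" "a' \<notin> live \<sigma> 0" "b' \<notin> live \<sigma> 0"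
    using component_live_interval[OF assms(1) "0.prems"(2)] .
  moreover have "Z \<subseteq> live \<sigma> 0" using "0.prems"(2) by (rule in_components_subset)
  ultimately have "Z = {0<..<1}"
    unfolding live_0 by (auto simp: greaterThanLessThan_subseteq_greaterThanLessThan)
  then have "a = 0" "c = 1" using "0.prems"(3,4) by (simp_all add: greaterThanLessThan_eq_iff)
  then show ?case by (intro exI[of _ 0] exI[of _ 1]) (simp add: shape_def expansion_def)
next
  case (Suc k)
  define b where "b = slope (\<sigma> k)"
  have b: "b \<in> {\<beta>, \<omega> * \<beta>}" "b > 0" "\<beta> \<le> b"
    using admissible_slope[OF assms(1), of k] slope_bounds(1)[of b] unfolding b_def by blast+
  define E where "E = expansion \<sigma> k"
  have E: "E > 0" unfolding E_def by (rule expansion_pos[OF assms(1)])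
  have Z_sub: "Z \<subseteq> live \<sigma> (Suc k)" using Suc.prems(2) by (rule in_components_subset)
  have ends: "a \<notin> live \<sigma> (Suc k)" "c \<notin> live \<sigma> (Suc k)"
  proof -
    obtain a' c' where "a' < c'" "Z = {a'<..<c'}" "a' \<notin> live \<sigma> (Suc k)" "c' \<notin> live \<sigma> (Suc k)"
      using component_live_interval[OF assms(1) Suc.prems(2)] .
    moreover have "a = a'" "c = c'"
      using calculation Suc.prems(3,4) by (auto simp: greaterThanLessThan_eq_iff)
    ultimately show "a \<notin> live \<sigma> (Suc k)" "c \<notin> live \<sigma> (Suc k)" by auto
  qed
  have "Z \<subseteq> live \<sigma> k" "connected Z" "Z \<noteq> {}"
    using Z_sub Suc.prems(3,4) by (auto simp: live_Suc)
  then obtain P where P: "P \<in> components (live \<sigma> k)" "Z \<subseteq> P"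
    using exists_component_superset[of Z "live \<sigma> k"] by blast
  obtain aP cP where P': "aP < cP" "P = {aP<..<cP}"
    using component_live_interval[OF assms(1) P(1)] by metis
  obtain p q where pq: "shape k p q" "q = p + E * (cP - aP)"
    "\<And>y. y \<in> P \<Longrightarrow> iter_map \<sigma> k y = p + E * (y - aP)"
    using Suc.IH[OF _ P(1) P'(2,1)] Suc.prems(1) unfolding E_def by auto
  define A where "A y = p + E * (y - aP)" for y
  have A_less: "A y < A z \<longleftrightarrow> y < z" for y z using E by (simp add: A_def)
  have A_diff: "A z = A y + E * (z - y)" for y z by (simp add: A_def algebra_simps)
  have A_ends: "A aP = p" "A cP = q" using pq(2) by (simp_all add: A_def)
  have sub: "aP \<le> a" "c \<le> cP"
    using P(2) P'(2) Suc.prems(3,4) by (auto simp: greaterThanLessThan_subseteq_greaterThanLessThan)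
  have "snd (\<sigma> k) \<in> half_intervals" using admissible_letter[OF assms(1), of k] by auto
  then obtain u where u: "u = 0 \<or> u = 1/2" "interior (snd (\<sigma> k)) = {u<..<u + 1/2}"
    using half_interval_interior by blast
  define p' where "p' = max p u"
  define q' where "q' = min q (u + 1/2)"
  have inside: "y \<in> P" "A y \<in> interior (snd (\<sigma> k))" "y \<in> live \<sigma> k" "iter_map \<sigma> k y = A y"
    if "p' < A y" "A y < q'" for y
  proof -
    have "A aP < A y" "A y < A cP" using that unfolding A_ends p'_def q'_def by auto
    then show "y \<in> P" unfolding A_less P'(2) by simp
    then show "y \<in> live \<sigma> k" "iter_map \<sigma> k y = A y"
      using in_components_subset[OF P(1)] pq(3) by (auto simp: A_def)
    show "A y \<in> interior (snd (\<sigma> k))" using that unfolding u(2) p'_def q'_def by auto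
  qed
  have Z_img: "p' < A y" "A y < q'" "iter_map \<sigma> k y = A y" "b * A y \<notin> \<int>" if "y \<in> Z" for y
  proof -
    have "y \<in> P" using that P(2) by blast
    then show eq: "iter_map \<sigma> k y = A y" using pq(3) by (simp add: A_def)
    have "A aP < A y" "A y < A cP" unfolding A_less using \<open>y \<in> P\<close> P'(2) by auto
    moreover have "A y \<in> {u<..<u + 1/2}" "b * A y \<notin> \<int>"
      using that Z_sub u(2) eq by (auto simp: live_Suc b_def)
    ultimately show "p' < A y" "A y < q'" "b * A y \<notin> \<int>" unfolding A_ends p'_def q'_def by auto
  qed
  define x where "x = A a"
  define z where "z = A c"
  have xz: "x < z" unfolding x_def z_def A_less by (rule Suc.prems(4))
  have "p' \<le> x"
  proof (rule ccontr)
    assume "\<not> p' \<le> x"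
    define e where "e = min ((p' - x) / E) ((c - a) / 2)"
    have "0 < e" using \<open>\<not> p' \<le> x\<close> E Suc.prems(4) by (simp add: e_def)
    moreover have "e < c - a" using Suc.prems(4) unfolding e_def by (intro min.strict_coboundedI2) simp
    ultimately have "a < a + e" "a + e < c" using Suc.prems(4) by linarith+
    then have "a + e \<in> Z" unfolding Suc.prems(3) by simp
    moreover have "E * e \<le> p' - x"
    proof -
      have "e \<le> (p' - x) / E" by (simp add: e_def)
      then show ?thesis using E by (simp add: field_simps)
    qed
    then have "A (a + e) \<le> p'" using A_diff[of "a + e" a] unfolding x_def by simp
    ultimately show False using Z_img(1) by fastforce
  qed
  have "z \<le> q'"
  proof (rule ccontr)
    assume "\<not> z \<le> q'"
    define e where "e = min ((z - q') / E) ((c - a) / 2)"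
    have "0 < e" using \<open>\<not> z \<le> q'\<close> E Suc.prems(4) by (simp add: e_def)
    moreover have "e < c - a" using Suc.prems(4) unfolding e_def by (intro min.strict_coboundedI2) simp
    ultimately have "a < c - e" "c - e < c" using Suc.prems(4) by linarith+
    then have "c - e \<in> Z" unfolding Suc.prems(3) by simp
    moreover have "E * e \<le> z - q'"
    proof -
      have "e \<le> (z - q') / E" by (simp add: e_def)
      then show ?thesis using E by (simp add: field_simps)
    qed
    then have "q' \<le> A (c - e)" using A_diff[of c "c - e"] unfolding z_def by simp
    ultimately show False using Z_img(2) by fastforce
  qed
  have x: "x = p' \<or> b * x \<in> \<int>"
  proof (rule disjCI, rule ccontr)
    assume "b * x \<notin> \<int>" "x \<noteq> p'"
    then have "p' < A a" "A a < q'" using \<open>p' \<le> x\<close> \<open>z \<le> q'\<close> xz unfolding x_def by auto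
    note inside[OF this]
    then have "a \<in> live \<sigma> (Suc k)" using \<open>b * x \<notin> \<int>\<close> by (simp add: live_Suc b_def x_def)
    then show False using ends(1) by simp
  qed
  have z: "z = q' \<or> b * z \<in> \<int>"
  proof (rule disjCI, rule ccontr)
    assume "b * z \<notin> \<int>" "z \<noteq> q'"
    then have "p' < A c" "A c < q'" using \<open>p' \<le> x\<close> \<open>z \<le> q'\<close> xz unfolding z_def by auto
    note inside[OF this]
    then have "c \<in> live \<sigma> (Suc k)" using \<open>b * z \<notin> \<int>\<close> by (simp add: live_Suc b_def z_def)
    then show False using ends(2) by simp
  qed
  define m where "m = \<lfloor>b * x\<rfloor>"
  have m: "of_int m \<le> b * x" "b * x < of_int m + 1" unfolding m_def by linarith+
  have bxz: "b * x < b * z" using xz b(2) by simp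
  \<comment> \<open>otherwise the discontinuity \<open>(m+1)/b\<close> would be the image of a point of \<open>Z\<close>\<close>
  have upper: "b * z \<le> of_int m + 1"
  proof (rule ccontr)
    assume "\<not> b * z \<le> of_int m + 1"
    define y where "y = a + ((of_int m + 1) / b - x) / E"
    have Ay: "A y = (of_int m + 1) / b" using A_diff[of y a] E unfolding x_def[symmetric] by (simp add: y_def)
    have "A a < A y" "A y < A c"
      using m(2) \<open>\<not> b * z \<le> of_int m + 1\<close> b(2) unfolding Ay x_def[symmetric] z_def[symmetric]
      by (simp_all add: field_simps)
    then have "y \<in> Z" unfolding A_less Suc.prems(3) by simp
    then have "b * A y \<notin> \<int>" by (rule Z_img(4))
    moreover have "b * A y = of_int (m + 1)" using Ay b(2) by simp
    ultimately show False using Ints_of_int by metis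
  qed
  define p1 where "p1 = b * x - of_int m"
  define q1 where "q1 = b * z - of_int m"
  have step: "iter_map \<sigma> (Suc k) y = p1 + expansion \<sigma> (Suc k) * (y - a)" if "y \<in> Z" for y
  proof -
    have "A a < A y" "A y < A c" using that Suc.prems(3) unfolding A_less by auto
    then have "b * x < b * A y" "b * A y < b * z" using b(2) by (simp_all add: x_def z_def)
    then have "frac (b * A y) = b * A y - of_int m"
      using m(1) upper by (simp add: frac_unique_iff)
    then have "iter_map \<sigma> (Suc k) y = b * A y - of_int m"
      unfolding iter_map_Suc_eq[OF assms(1)] Z_img(3)[OF that] b_def .
    also have "\<dots> = p1 + b * E * (y - a)"
      unfolding p1_def x_def by (subst A_diff[of y a]) (simp add: algebra_simps)
    finally show ?thesis by (simp add: expansion_Suc b_def E_def)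
  qed
  have q1_eq: "q1 = p1 + expansion \<sigma> (Suc k) * (c - a)"
    unfolding p1_def q1_def x_def z_def expansion_Suc b_def[symmetric] E_def[symmetric]
    by (subst A_diff[of c a]) (simp add: algebra_simps)
  have pq': "p' < q'" using \<open>p' \<le> x\<close> \<open>z \<le> q'\<close> xz by linarith
  note cut = shape_cut[OF assms(2) _ pq(1) u(1), folded p'_def q'_def, OF _ pq']
  have k: "k \<le> N" using Suc.prems(1) by simp
  have p1: "p1 \<in> {0} \<union> orbit_values (Suc k)"
  proof (cases "b * x \<in> \<int>")
    case True
    then have "p1 = 0" by (auto simp: p1_def m_def elim: Ints_cases)
    then show ?thesis by simp
  next
    case False
    then have "x = p'" "x \<noteq> 0" using x by auto
    then have "frac (b * x) \<in> orbit_values (Suc k)"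
      using cut(2)[OF k] by (intro orbit_values_step[OF b(1)]) auto
    then show ?thesis by (simp add: p1_def m_def frac_def)
  qed
  have q1: "q1 \<in> {1} \<union> orbit_values (Suc k)"
  proof (cases "b * z \<in> \<int>")
    case True
    then obtain l where l: "b * z = of_int l" by (auto elim: Ints_cases)
    then have "l = m + 1" using m(1) bxz upper by linarith
    then show ?thesis using l by (simp add: q1_def)
  next
    case False
    then have "b * z \<noteq> of_int m + 1" using Ints_of_int[of "m + 1"] by auto
    then have "frac (b * z) = q1" using m(1) bxz upper by (simp add: frac_unique_iff q1_def)
    moreover have "frac (b * z) \<in> orbit_values (Suc k)"
      using cut(3)[OF k] z False by (intro orbit_values_step[OF b(1)]) auto
    ultimately show ?thesis by simp
  qed
  have "p1 = 0 \<or> q1 = 1"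
  proof (rule ccontr)
    assume *: "\<not> (p1 = 0 \<or> q1 = 1)"
    have "b * x \<notin> \<int>" using * by (auto simp: p1_def m_def elim: Ints_cases)
    moreover have "b * z \<notin> \<int>"
    proof
      assume "b * z \<in> \<int>"
      then obtain l where l: "b * z = of_int l" by (auto elim: Ints_cases)
      then have "l = m + 1" using m(1) bxz upper by linarith
      then show False using * l by (simp add: q1_def)
    qed
    ultimately have "x = p'" "z = q'" using x z by auto
    then have "3 / \<beta> \<le> z - x" using cut(1)[OF k] by simp
    then have "b * (3 / \<beta>) \<le> b * (z - x)" using b(2) by (intro mult_left_mono) auto
    moreover have "3 \<le> b * (3 / \<beta>)" using b(3) beta by (simp add: field_simps)
    ultimately have "3 \<le> b * z - b * x" by (simp add: algebra_simps)
    then show False using upper m(1) by linarith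
  qed
  then have "shape (Suc k) p1 q1" using p1 q1 by (simp add: shape_def)
  then show ?case using q1_eq step by blast
qed

lemma dies_or_full:
  assumes "\<sigma> \<in> admissible" "separated N" "k \<le> N" "Z \<in> components (live \<sigma> k)"
  shows "iter_map \<sigma> k ` Z \<inter> interior (snd (\<sigma> k)) = {} \<or> (\<exists>F\<subseteq>Z. full \<sigma> (Suc k) F)"
proof -
  obtain a c where ac: "a < c" "Z = {a<..<c}" using component_live_interval[OF assms(1,4)] by metis
  define E where "E = expansion \<sigma> k"
  have E: "E > 0" unfolding E_def by (rule expansion_pos[OF assms(1)])
  obtain p q where pq: "shape k p q" "q = p + E * (c - a)"
    "\<And>y. y \<in> Z \<Longrightarrow> iter_map \<sigma> k y = p + E * (y - a)"
    using component_shape[OF assms ac(2,1)] unfolding E_def by blast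
  have image: "iter_map \<sigma> k ` Z = {p<..<q}"
  proof
    show "iter_map \<sigma> k ` Z \<subseteq> {p<..<q}" using pq(2,3) E ac by auto
    show "{p<..<q} \<subseteq> iter_map \<sigma> k ` Z"
    proof
      fix t assume t: "t \<in> {p<..<q}"
      define y where "y = a + (t - p) / E"
      have "(t - p) / E < c - a" using t pq(2) E by (simp add: field_simps)
      moreover have "0 < (t - p) / E" using t E by simp
      ultimately have "y \<in> Z" unfolding ac(2) y_def by simp
      moreover have "iter_map \<sigma> k y = t" using pq(3)[OF \<open>y \<in> Z\<close>] E by (simp add: y_def)
      ultimately show "t \<in> iter_map \<sigma> k ` Z" by blast
    qed
  qed
  have "snd (\<sigma> k) \<in> half_intervals" using admissible_letter[OF assms(1), of k] by auto
  then obtain u where u: "u = 0 \<or> u = 1/2" "interior (snd (\<sigma> k)) = {u<..<u + 1/2}"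
    using half_interval_interior by blast
  define p' where "p' = max p u"
  define q' where "q' = min q (u + 1/2)"
  have inter: "{p<..<q} \<inter> {u<..<u + 1/2} = {p'<..<q'}" by (auto simp: p'_def q'_def)
  show ?thesis
  proof (cases "p' < q'")
    case False
    then show ?thesis unfolding image u(2) inter by auto
  next
    case True
    have "3 / \<beta> \<le> q' - p'"
      using shape_cut(1)[OF assms(2,3) pq(1) u(1)] True unfolding p'_def q'_def by blast
    moreover have "\<beta> \<le> slope (\<sigma> k)" using admissible_slope(2)[OF assms(1)] slope_bounds(1) by blast
    ultimately have "\<beta> * (3 / \<beta>) \<le> slope (\<sigma> k) * (q' - p')" using beta by (intro mult_mono) auto
    then have len: "2 \<le> slope (\<sigma> k) * (q' - p')" using beta by simp
    have "{p'<..<q'} \<subseteq> iter_map \<sigma> k ` Z" "{p'<..<q'} \<subseteq> interior (snd (\<sigma> k))"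
      unfolding image u(2) inter[symmetric] by auto
    then obtain F where "F \<subseteq> Z" "full \<sigma> (Suc k) F"
      using full_child[OF assms(1) component_is_interval[OF assms(4)] in_components_subset[OF assms(4)] _ _ len]
      by blast
    then show ?thesis by blast
  qed
qed

text \<open>
  A nonzero value of the iterated transfer operator needs a nonzero summand.
\<close>

lemma iter_transfer_support:
  assumes "\<sigma> \<in> admissible" "x \<in> regular" "iter_transfer \<sigma> n f x \<noteq> 0"
  shows "\<exists>y\<in>live \<sigma> n. f y \<noteq> 0 \<and> iter_map \<sigma> n y = x"
  using assms(2,3)
proof (induction n arbitrary: x)
  case 0
  then show ?case using regularD[of x] by (auto simp: live_def smooth_points_def)
next
  case (Suc n)
  note s = admissible_letter[OF assms(1), of n]
  note b = admissible_slope[OF assms(1), of n]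
  have "(\<Sum>z\<in>fibre (slope (\<sigma> n)) x. iter_transfer \<sigma> n f z * indicator (snd (\<sigma> n)) z) \<noteq> 0"
    using Suc.prems(2) transfer_open_eq[OF s Suc.prems(1)] by auto
  then obtain z where z: "z \<in> fibre (slope (\<sigma> n)) x" "iter_transfer \<sigma> n f z * indicator (snd (\<sigma> n)) z \<noteq> 0"
    by (meson sum.neutral)
  then have z': "z \<in> regular" "beta_map (slope (\<sigma> n)) z = x" "iter_transfer \<sigma> n f z \<noteq> 0" "z \<in> snd (\<sigma> n)"
    using fibre_regular[OF b(2) Suc.prems(1)] by (auto simp: indicator_def split: if_splits)
  then obtain y where y: "y \<in> live \<sigma> n" "f y \<noteq> 0" "iter_map \<sigma> n y = z" using Suc.IH by blast
  have "z \<in> {0..1}" using regularD(1,2)[OF z'(1)] by simp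
  then have "slope (\<sigma> n) * z \<notin> \<int>" using regular_preimage(2)[OF b(2)] z'(2) Suc.prems(1) by blast
  moreover have "z \<in> interior (snd (\<sigma> n))" using regular_in_half_iff[OF z'(1)] z'(4) s by auto
  ultimately have "y \<in> live \<sigma> (Suc n)" using y by (simp add: live_Suc)
  moreover have "iter_map \<sigma> (Suc n) y = x" using y(3) z'(2) b(1) by simp
  ultimately show ?case using y(2) by blast
qed

text \<open>
  The least weight of a letter divided by the upper bound 2 for the image of the constant 1; its
  powers bound from below the ratios of full sets.
\<close>

definition min_weight :: real where "min_weight = 1 / (2 * (\<omega> * \<beta>))"

lemma min_weight_bounds: "0 < min_weight" "min_weight \<le> 1"
proof -
  have "1 \<le> 2 * (\<omega> * \<beta>)" using slope_bounds(3)[of "\<omega> * \<beta>"] by simp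
  then show "0 < min_weight" "min_weight \<le> 1" by (simp_all add: min_weight_def)
qed

lemma min_weight_power_le:
  assumes "\<sigma> \<in> admissible"
  shows "min_weight ^ k \<le> 1 / (expansion \<sigma> k * 2 ^ k)"
proof -
  have "expansion \<sigma> k \<le> (\<Prod>j<k. \<omega> * \<beta>)"
    unfolding expansion_def
    using admissible_slope[OF assms] slope_bounds(2) by (intro prod_mono) (auto intro: less_imp_le)
  then have "expansion \<sigma> k * 2 ^ k \<le> (\<omega> * \<beta>) ^ k * 2 ^ k" by simp
  also have "\<dots> = (2 * (\<omega> * \<beta>)) ^ k" by (simp add: power_mult_distrib)
  finally have "1 / (2 * (\<omega> * \<beta>)) ^ k \<le> 1 / (expansion \<sigma> k * 2 ^ k)"
    using expansion_pos[OF assms] by (intro frac_le) auto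
  then show ?thesis by (simp add: min_weight_def power_one_over)
qed

text \<open>
  A good element cannot miss the next half interval, as its ratios would vanish from then on; by
  \<open>dies_or_full\<close> it contains a full set one step later.
\<close>

lemma good_ratio:
  assumes "\<sigma> \<in> admissible" "separated N" "k \<le> N" "Z \<in> Z_good \<sigma> k" "Suc k \<le> n" "x \<in> regular"
  shows "min_weight ^ Suc k \<le> ratio \<sigma> n (indicator Z) x"
proof -
  have Z: "Z \<in> components (live \<sigma> k)" "0 < Lambda \<sigma> (indicator Z)"
    using assms(4) Z_star_component[OF assms(1)] by (auto simp: Z_good_def)
  have "\<not> iter_map \<sigma> k ` Z \<inter> interior (snd (\<sigma> k)) = {}"
  proof
    assume dead: "iter_map \<sigma> k ` Z \<inter> interior (snd (\<sigma> k)) = {}"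
    have "iter_transfer \<sigma> m (indicator Z) x = 0" if le: "Suc k \<le> m" and x: "x \<in> regular" for m x
    proof (rule ccontr)
      assume "iter_transfer \<sigma> m (indicator Z) x \<noteq> 0"
      then obtain y where "y \<in> live \<sigma> m" "indicator Z y \<noteq> (0::real)"
        using iter_transfer_support[OF assms(1) x] by blast
      then have "y \<in> Z" "iter_map \<sigma> k y \<in> interior (snd (\<sigma> k))"
        using le by (auto simp: live_def indicator_def split: if_splits)
      then show False using dead by blast
    qed
    then have "Lambda \<sigma> (indicator Z) = 0" by (rule Lambda_eq_0)
    then show False using Z(2) by simp
  qed
  then obtain F where F: "F \<subseteq> Z" "full \<sigma> (Suc k) F" using dies_or_full[OF assms(1-3) Z(1)] by blast
  have "min_weight ^ Suc k \<le> 1 / (expansion \<sigma> (Suc k) * 2 ^ Suc k)" by (rule min_weight_power_le[OF assms(1)])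
  also have "\<dots> \<le> ratio \<sigma> n (indicator Z) x" by (rule full_ratio[OF assms(1) F(2,1) assms(5,6)])
  finally show ?thesis .
qed

lemma ess_inf_indicator_ratio_ge:
  assumes "\<sigma> \<in> admissible" "AE x in lebesgue_on {0..1}. c \<le> ratio \<sigma> n (indicator Z) x"
  shows "c \<le> ess_inf (ratio \<sigma> n (indicator Z))"
proof (rule ess_inf_ge[OF _ assms(2)])
  show "AE x in lebesgue_on {0..1}. ratio \<sigma> n (indicator Z) x \<le> 1"
    by (rule AE_of_regular, rule ratio_bounds(2)[OF assms(1)]) (simp_all add: indicator_def)
qed

lemma eps_hat_ge:
  assumes "separated N" "k \<le> N" "Suc k \<le> n"
  shows "ereal (min_weight ^ Suc k) \<le> eps_hat maps half_intervals k n"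
  unfolding eps_hat_def
proof (intro INF_greatest)
  fix j \<sigma> Z assume *: "j \<in> {1..k}" "\<sigma> \<in> admissible" "Z \<in> Z_good \<sigma> j"
  have "min_weight ^ Suc k \<le> min_weight ^ Suc j" using min_weight_bounds * by (intro power_decreasing) auto
  also have "\<dots> \<le> ess_inf (ratio \<sigma> n (indicator Z))"
    using * assms by (intro ess_inf_indicator_ratio_ge AE_of_regular good_ratio[where N = N]) auto
  finally show "ereal (min_weight ^ Suc k) \<le> ereal (ess_inf (ratio \<sigma> n (indicator Z)))" by simp
qed

lemma C3_holds:
  assumes "separated N" "k \<le> N"
  shows "C3 maps half_intervals k (Suc N)"
proof -
  have "0 < ereal (min_weight ^ Suc k)" using min_weight_bounds(1) by simp
  also have "\<dots> \<le> eps_hat maps half_intervals k (Suc N)" using assms by (intro eps_hat_ge) auto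
  finally show ?thesis by (simp add: C3_def)
qed

text \<open>
  For \<open>m \<ge> 2\<close> the bound comes from \<open>good_ratio\<close>.  For \<open>m = 1\<close> the iterated operator applied to an
  indicator takes no values strictly between 0 and the weight of a letter, so a positive essential
  infimum of the ratio is automatically as large as that weight allows.
\<close>

lemma eps_star_1_ge:
  assumes "separated 1"
  shows "ereal (min_weight ^ 2) \<le> eps_star maps half_intervals 1"
proof -
  have two: "ereal (min_weight ^ 2) \<le> eps_hat maps half_intervals 1 m" if "2 \<le> m" for m
    using eps_hat_ge[OF assms, of 1 m] that by (simp add: power2_eq_square)
  have one: "ereal (min_weight ^ 2) \<le> eps_hat maps half_intervals 1 1" if pos: "0 < eps_hat maps half_intervals 1 1"
    unfolding eps_hat_def
  proof (intro INF_greatest)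
    fix k \<sigma> Z assume *: "k \<in> {1..1::nat}" "\<sigma> \<in> admissible" "Z \<in> Z_good \<sigma> k"
    have "eps_hat maps half_intervals 1 1 \<le> ereal (ess_inf (ratio \<sigma> 1 (indicator Z)))"
      unfolding eps_hat_def using * by (intro INF_lower2[OF *(1)] INF_lower2[OF *(2)] INF_lower2[OF *(3)]) simp
    then have "0 < ereal (ess_inf (ratio \<sigma> 1 (indicator Z)))" using pos by (rule less_le_trans[rotated])
    then have inf_pos: "0 < ess_inf (ratio \<sigma> 1 (indicator Z))" by simp
    have bounds: "0 \<le> (indicator Z y :: real) \<and> indicator Z y \<le> (1::real)" for y by (simp add: indicator_def)
    have "AE x in lebesgue_on {0..1}. ess_inf (ratio \<sigma> 1 (indicator Z)) \<le> ratio \<sigma> 1 (indicator Z) x"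
      by (rule AE_ess_inf_le; rule AE_of_regular; rule ratio_bounds[OF *(2) _ bounds])
    then have "AE x in lebesgue_on {0..1}. min_weight ^ 2 \<le> ratio \<sigma> 1 (indicator Z) x"
      using AE_regular
    proof eventually_elim
      case (elim x)
      have "ratio \<sigma> 1 (indicator Z) x \<noteq> 0" using elim(1) inf_pos by linarith
      then have "iter_transfer \<sigma> 1 (indicator Z) x \<noteq> 0" by (metis div_0)
      then obtain y where y: "y \<in> live \<sigma> 1" "indicator Z y \<noteq> (0::real)" "iter_map \<sigma> 1 y = x"
        using iter_transfer_support[OF *(2) elim(2)] by blast
      have "min_weight ^ 2 \<le> min_weight ^ 1" using min_weight_bounds by (intro power_decreasing) auto
      also have "\<dots> \<le> 1 / (expansion \<sigma> 1 * 2 ^ 1)" by (rule min_weight_power_le[OF *(2)])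
      finally have "min_weight ^ 2 * iter_transfer \<sigma> 1 (\<lambda>_. 1) x \<le> 1 / (expansion \<sigma> 1 * 2 ^ 1) * 2 ^ 1"
        using iter_transfer_one(1)[OF *(2) elim(2), of 1] iter_transfer_one_pos[OF *(2) elim(2), of 1]
          expansion_pos[OF *(2), of 1] by (intro mult_mono) auto
      also have "\<dots> = indicator Z y / expansion \<sigma> 1" using y(2) by (simp add: indicator_def split: if_splits)
      also have "\<dots> \<le> iter_transfer \<sigma> 1 (indicator Z) x"
        using iter_transfer_orbit[OF *(2) y(1), of "indicator Z"] y(3) elim(2) by simp
      finally show ?case by (rule ratio_ge_iff[OF *(2) elim(2), THEN iffD2])
    qed
    then have "min_weight ^ 2 \<le> ess_inf (ratio \<sigma> 1 (indicator Z))"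
      by (rule ess_inf_indicator_ratio_ge[OF *(2)])
    then show "ereal (min_weight ^ 2) \<le> ereal (ess_inf (ratio \<sigma> 1 (indicator Z)))"
      by (simp only: ereal_less_eq)
  qed
  have "0 < ereal (min_weight ^ 2)" using min_weight_bounds(1) by simp
  then have "0 < eps_hat maps half_intervals 1 2" using two[of 2] by (rule less_le_trans) simp
  then have "\<exists>m\<ge>1. 0 < eps_hat maps half_intervals 1 m" by (intro exI[of _ 2]) simp
  then have "eps_star maps half_intervals 1 =
      (INF m\<in>{m. m \<ge> 1 \<and> eps_hat maps half_intervals 1 m > 0}. eps_hat maps half_intervals 1 m)"
    by (simp add: eps_star_def)
  moreover have "ereal (min_weight ^ 2) \<le> \<dots>"
  proof (rule INF_greatest)
    fix m assume "m \<in> {m. m \<ge> 1 \<and> eps_hat maps half_intervals 1 m > 0}"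
    then show "ereal (min_weight ^ 2) \<le> eps_hat maps half_intervals 1 m"
      using one two[of m] by (cases "m = 1") auto
  qed
  ultimately show ?thesis by simp
qed

section \<open>The size of \<open>n\<^sub>2\<close>\<close>

lemma C_star_0_4: "C_star 0 4 = 19"
  by (simp add: C_star_def)

lemma beta_large:
  assumes "2 * 10 ^ 12 * \<omega> ^ 6 \<le> \<beta>"
  shows "11552 \<le> \<beta>"
proof -
  have "2 * 10 ^ 12 * 1 \<le> 2 * 10 ^ 12 * \<omega> ^ 6" using omega by (intro mult_left_mono) (auto simp: one_le_power)
  then have "2 * 10 ^ 12 * 1 \<le> \<beta>" using assms by (rule order_trans)
  then show ?thesis by simp
qed

text \<open>
  With \<open>C\<^sub>\<star> = 19\<close> the quotient in the definition of \<open>n\<^sub>0\<close> is at most 1 as soon as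
  \<open>4 \<cdot> 19\<^sup>2 = 1444 \<le> \<beta>/8\<close>.
\<close>

lemma n0_eq_1:
  assumes "2 * 10 ^ 12 * \<omega> ^ 6 \<le> \<beta>"
  shows "n0 maps half_intervals 0 4 2 = 1"
proof -
  define R where "R = rho maps half_intervals / (2 * Theta maps)"
  have "\<beta> / 8 \<le> R"
    using rho_ge beta unfolding R_def Theta_eq by (simp add: field_simps)
  then have R: "1444 \<le> R" using beta_large[OF assms] by linarith
  have pos: "0 < ln (1444::real)" by simp
  have le: "ln 1444 \<le> ln R" using R by simp
  then have "0 < ln R" using pos by linarith
  then have "0 < ln 1444 / ln R" "ln 1444 / ln R \<le> 1"
    using divide_pos_pos[OF pos] le by (auto simp: divide_le_eq_1)
  then have "\<lceil>ln 1444 / ln R\<rceil> = 1" by linarith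
  then show ?thesis unfolding n0_def C_star_0_4 R_def by simp
qed

lemma C_n_1_bounds:
  assumes "separated 1"
  shows "0 \<le> real_of_ereal (C_n maps half_intervals 0 4 2 1)"
    "real_of_ereal (C_n maps half_intervals 0 4 2 1) \<le> 136 * (\<omega>\<^sup>2 * \<beta>)"
proof -
  have num: "(3 * 0 + 2) * (2 * 4 * 2 + 1) * Theta maps = 34 / \<beta>" by (simp add: Theta_eq)
  have "0 \<le> real_of_ereal (ereal (34 / \<beta>) / eps_star maps half_intervals 1)
    \<and> real_of_ereal (ereal (34 / \<beta>) / eps_star maps half_intervals 1) \<le> 136 * (\<omega>\<^sup>2 * \<beta>)"
  proof (cases "eps_star maps half_intervals 1")
    case (real r)
    have r: "min_weight ^ 2 \<le> r" using eps_star_1_ge[OF assms] real by simp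
    have "0 < min_weight ^ 2" using min_weight_bounds by simp
    then have "0 < r" using r by linarith
    have "34 / \<beta> / r \<le> 34 / \<beta> / min_weight ^ 2" 
      using r beta \<open>0 < min_weight ^ 2\<close> \<open>0 < r\<close> by (intro divide_left_mono mult_pos_pos) auto
    also have "\<dots> = 136 * (\<omega>\<^sup>2 * \<beta>)"
      using beta omega by (simp add: min_weight_def field_simps power2_eq_square)
    finally show ?thesis using real \<open>0 < r\<close> beta by simp
  next
    case PInf
    then show ?thesis using beta by simp
  next
    case MInf
    then show ?thesis using eps_star_1_ge[OF assms] by simp
  qed
  then show "0 \<le> real_of_ereal (C_n maps half_intervals 0 4 2 1)"
    "real_of_ereal (C_n maps half_intervals 0 4 2 1) \<le> 136 * (\<omega>\<^sup>2 * \<beta>)"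
    unfolding C_n_def num by blast+
qed

text \<open>
  Up to constants, \<open>a\<close> and \<open>B\<close> are at most \<open>X = \<omega>\<^sup>2\<beta>\<^sup>2\<close> and the last factor is at most \<open>Y = \<omega>\<^sup>2\<beta>\<close>,
  so the argument of the logarithm is of order \<open>\<omega>\<^sup>6\<beta>\<^sup>5\<close>, to be compared with \<open>(\<rho>/\<theta>)\<^sup>6 \<ge> (\<beta>/8)\<^sup>6\<close>.
\<close>

lemma n2_le_6:
  assumes "separated 1" "2 * 10 ^ 12 * \<omega> ^ 6 \<le> \<beta>"
  shows "n2 maps half_intervals 0 4 2 \<le> 6"
proof -
  define \<rho> where "\<rho> = rho maps half_intervals"
  define C where "C = real_of_ereal (C_n maps half_intervals 0 4 2 1)"
  define a where "a = max 1 (15 / 11 * (C / (19 * (2 * Theta maps))))"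
  define R where "R = \<rho> / (2 * Theta maps)"
  define A where "A = 4 * a * (1 + 2 * a * 19) * (1 + 2 * C / \<rho>)"
  have n2: "n2 maps half_intervals 0 4 2 =
      (if eps_star maps half_intervals 1 = 0 then 1 else nat \<lceil>ln A / ln R\<rceil>)"
    unfolding n2_def Let_def n0_eq_1[OF assms(2)] C_star_0_4
    by (simp add: A_def R_def a_def C_def \<rho>_def)
  define X where "X = \<omega>\<^sup>2 * \<beta>\<^sup>2"
  define Y where "Y = \<omega>\<^sup>2 * \<beta>"
  have "1 \<le> \<omega>\<^sup>2" "1 \<le> \<beta>\<^sup>2" using omega beta by (simp_all add: one_le_power)
  then have XY: "1 \<le> X" "1 \<le> Y" "X = Y * \<beta>"
    using beta mult_mono[of 1 "\<omega>\<^sup>2" 1 "\<beta>\<^sup>2"] mult_mono[of 1 "\<omega>\<^sup>2" 1 \<beta>]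
    by (simp_all add: X_def Y_def power2_eq_square)
  have \<rho>: "1/4 \<le> \<rho>" unfolding \<rho>_def by (rule rho_ge)
  have C: "0 \<le> C" "C \<le> 136 * Y" unfolding C_def Y_def by (rule C_n_1_bounds[OF assms(1)])+
  have "C * \<beta> \<le> 136 * X" using C(2) beta unfolding XY(3) by (simp add: mult_right_mono)
  then have a: "1 \<le> a" "a \<le> 5 * X"
    using XY(1) unfolding a_def Theta_eq by auto
  have B: "0 \<le> 1 + 2 * a * 19" "1 + 2 * a * 19 \<le> 191 * X" using a XY(1) by linarith+
  have "2 * C / \<rho> \<le> 2 * C / (1/4)" using \<rho> C(1) by (intro divide_left_mono) auto
  then have D: "1 \<le> 1 + 2 * C / \<rho>" "1 + 2 * C / \<rho> \<le> 1089 * Y" using C XY(2) \<rho> by simp_all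
  have "1 \<le> A"
  proof -
    have "1 * 1 * 1 \<le> (4 * a) * (1 + 2 * a * 19) * (1 + 2 * C / \<rho>)"
      using a(1) D(1) by (intro mult_mono) auto
    then show ?thesis by (simp add: A_def)
  qed
  have "A \<le> (4 * (5 * X)) * (191 * X) * (1089 * Y)"
    unfolding A_def using a B D XY by (intro mult_mono) auto
  also have "\<dots> = 4159980 * \<omega> ^ 6 * \<beta> ^ 5"
    by (simp add: X_def Y_def power2_eq_square power_numeral_reduce)
  also have "\<dots> \<le> (\<beta> / 8) ^ 6"
  proof -
    have "4159980 * 8 ^ 6 * \<omega> ^ 6 \<le> 2 * 10 ^ 12 * \<omega> ^ 6" using omega by (intro mult_right_mono) auto
    then have "4159980 * 8 ^ 6 * \<omega> ^ 6 * \<beta> ^ 5 \<le> \<beta> * \<beta> ^ 5"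
      using assms(2) beta by (intro mult_right_mono) auto
    then show ?thesis by (simp add: power_divide field_simps power_numeral_reduce)
  qed
  also have "\<dots> \<le> R ^ 6"
  proof (rule power_mono)
    show "\<beta> / 8 \<le> R" using \<rho> beta unfolding R_def Theta_eq by (simp add: field_simps)
  qed (use beta in simp)
  finally have "A \<le> R ^ 6" .
  have "1 < R"
  proof -
    have "\<beta> / 8 \<le> R" using \<rho> beta unfolding R_def Theta_eq by (simp add: field_simps)
    then show ?thesis using beta_large[OF assms(2)] by linarith
  qed
  have "ln A \<le> ln (R ^ 6)" using \<open>1 \<le> A\<close> \<open>A \<le> R ^ 6\<close> by (subst ln_le_cancel_iff) linarith+
  also have "\<dots> = 6 * ln R" using \<open>1 < R\<close> by (simp add: ln_realpow)
  finally have "ln A / ln R \<le> 6" using \<open>1 < R\<close> by (simp add: divide_le_eq)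
  then have "\<lceil>ln A / ln R\<rceil> \<le> 6" by linarith
  then show ?thesis unfolding n2 by simp
qed

end

section \<open>The exceptional set of parameters\<close>

definition crit_orbit :: "real list \<Rightarrow> real \<Rightarrow> real \<Rightarrow> real" where
  "crit_orbit cs v \<beta> = foldr beta_map (map (\<lambda>c. c * \<beta>) cs) v"

lemma crit_orbit_Nil: "crit_orbit [] v \<beta> = v"
  by (simp add: crit_orbit_def)

lemma crit_orbit_Cons: "crit_orbit (c # cs) v \<beta> = frac (c * \<beta> * crit_orbit cs v \<beta>)"
  by (simp add: crit_orbit_def beta_map_def)

lemma crit_orbit_unit: "v \<in> {0..1} \<Longrightarrow> crit_orbit cs v \<beta> \<in> {0..1}"
  by (cases cs) (auto simp: crit_orbit_Nil crit_orbit_Cons intro: less_imp_le frac_lt_1)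

text \<open>
  The integer parts discarded along the critical orbit.  Fixing them turns the orbit point into a
  polynomial in the parameter.
\<close>

fun itinerary :: "real list \<Rightarrow> real \<Rightarrow> real \<Rightarrow> int list" where
  "itinerary [] v \<beta> = []"
| "itinerary (c # cs) v \<beta> = \<lfloor>c * \<beta> * crit_orbit cs v \<beta>\<rfloor> # itinerary cs v \<beta>"

text \<open>
  Among parameters with the same itinerary every step multiplies differences by at least \<open>m\<close>, since
  the orbit points are nonnegative; the initial rate is \<open>c v \<ge> 1/2\<close>.
\<close>

lemma crit_orbit_expands:
  assumes "1 \<le> m" "m \<le> x" "x \<le> y" "v \<in> {1/2..1}"
  shows "set cs \<subseteq> {1..} \<Longrightarrow> 1 \<le> c \<Longrightarrow> itinerary cs v x = itinerary cs v y \<Longrightarrow>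
    m ^ length cs / 2 * (y - x) \<le> c * y * crit_orbit cs v y - c * x * crit_orbit cs v x"
proof (induction cs arbitrary: c)
  case Nil
  have "1/2 * (y - x) \<le> (c * v) * (y - x)"
    using assms(3,4) Nil.prems(2) mult_mono[of 1 c "1/2" v] by (intro mult_right_mono) auto
  then show ?case by (simp add: crit_orbit_Nil algebra_simps)
next
  case (Cons d cs)
  define P where "P = crit_orbit (d # cs) v"
  have P: "0 \<le> P y" unfolding P_def crit_orbit_Cons by simp
  have "m ^ length cs / 2 * (y - x) \<le> d * y * crit_orbit cs v y - d * x * crit_orbit cs v x"
    using Cons.prems by (intro Cons.IH) auto
  also have "\<dots> = P y - P x"
    using Cons.prems(3) unfolding P_def crit_orbit_Cons frac_def by simp
  finally have step: "m ^ length cs / 2 * (y - x) \<le> P y - P x" .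
  have "0 \<le> m ^ length cs / 2 * (y - x)" using assms(1,3) by simp
  then have nonneg: "0 \<le> P y - P x" using step by linarith
  have "m ^ length (d # cs) / 2 * (y - x) = m * (m ^ length cs / 2 * (y - x))" by simp
  also have "\<dots> \<le> m * (P y - P x)" using step assms(1) by (intro mult_left_mono) auto
  also have "\<dots> \<le> (c * x) * (P y - P x)"
    using assms(1,2) Cons.prems(2) nonneg mult_mono[of 1 c m x] by (intro mult_right_mono) auto
  also have "\<dots> \<le> (c * x) * (P y - P x) + c * (y - x) * P y"
    using assms(3) Cons.prems(2) P by simp
  also have "\<dots> = c * y * P y - c * x * P x" by (simp add: algebra_simps)
  finally show ?case unfolding P_def .
qed

lemma card_floor_image_le:
  fixes f :: "'a \<Rightarrow> real"
  assumes "\<And>x. x \<in> S \<Longrightarrow> p \<le> f x \<and> f x \<le> p + l" "0 \<le> l"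
  shows "finite ((\<lambda>x. \<lfloor>f x\<rfloor>) ` S)" "real (card ((\<lambda>x. \<lfloor>f x\<rfloor>) ` S)) \<le> l + 2"
proof -
  have sub: "(\<lambda>x. \<lfloor>f x\<rfloor>) ` S \<subseteq> {\<lfloor>p\<rfloor>..\<lfloor>p + l\<rfloor>}"
  proof
    fix i assume "i \<in> (\<lambda>x. \<lfloor>f x\<rfloor>) ` S"
    then obtain x where "x \<in> S" "i = \<lfloor>f x\<rfloor>" by blast
    then show "i \<in> {\<lfloor>p\<rfloor>..\<lfloor>p + l\<rfloor>}"
      using floor_mono[of p "f x"] floor_mono[of "f x" "p + l"] assms(1)[of x] by simp
  qed
  then show "finite ((\<lambda>x. \<lfloor>f x\<rfloor>) ` S)" by (rule finite_subset) simp
  have "card ((\<lambda>x. \<lfloor>f x\<rfloor>) ` S) \<le> card {\<lfloor>p\<rfloor>..\<lfloor>p + l\<rfloor>}" using sub by (intro card_mono) auto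
  also have "\<dots> = nat (\<lfloor>p + l\<rfloor> - \<lfloor>p\<rfloor> + 1)" by simp
  finally have "real (card ((\<lambda>x. \<lfloor>f x\<rfloor>) ` S)) \<le> real_of_int (\<lfloor>p + l\<rfloor> - \<lfloor>p\<rfloor> + 1)"
    using assms(2) floor_mono[of p "p + l"] by linarith
  also have "\<dots> \<le> l + 2" by linarith
  finally show "real (card ((\<lambda>x. \<lfloor>f x\<rfloor>) ` S)) \<le> l + 2" .
qed

text \<open>
  The first integer part takes boundedly many values, because its argument moves by at most
  \<open>2 \<omega>\<close> over a parameter interval of length 1.  Every further one takes \<open>O(m)\<close> values, so
  there is one factor \<open>m\<close> fewer than there are integer parts.  The parameters \<open>\<kappa>\<close> and \<open>\<epsilon>\<close> cover both
  integer parts and rounding to multiples of 1/2.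
\<close>

lemma card_itineraries:
  assumes "1 < \<omega>" "1 \<le> m" "v \<in> {1/2..1}"
  shows "set cs \<subseteq> {1..\<omega>} \<Longrightarrow> c \<in> {1..\<omega>} \<Longrightarrow> \<kappa> \<in> {1..2} \<Longrightarrow>
    finite ((\<lambda>\<beta>. (\<lfloor>\<kappa> * (c * \<beta> * crit_orbit cs v \<beta>) + \<epsilon>\<rfloor>, itinerary cs v \<beta>)) ` {m..m + 1}) \<and>
    m * real (card ((\<lambda>\<beta>. (\<lfloor>\<kappa> * (c * \<beta> * crit_orbit cs v \<beta>) + \<epsilon>\<rfloor>, itinerary cs v \<beta>)) ` {m..m + 1}))
      \<le> (6 * \<omega> * m) ^ Suc (length cs)"
proof (induction cs arbitrary: c \<kappa> \<epsilon>)
  case Nil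
  define f where "f \<beta> = \<kappa> * (c * \<beta> * v) + \<epsilon>" for \<beta>
  have range: "\<kappa> * (c * m * v) + \<epsilon> \<le> f \<beta> \<and> f \<beta> \<le> \<kappa> * (c * m * v) + \<epsilon> + 2 * \<omega>" if "\<beta> \<in> {m..m + 1}" for \<beta>
  proof -
    have "f \<beta> = \<kappa> * (c * m * v) + \<epsilon> + (\<kappa> * c * v) * (\<beta> - m)" by (simp add: f_def algebra_simps)
    moreover have "0 \<le> (\<kappa> * c * v) * (\<beta> - m)" using Nil.prems assms(3) that by auto
    moreover have "(\<kappa> * c * v) * (\<beta> - m) \<le> (2 * \<omega> * 1) * 1"
      using Nil.prems assms that by (intro mult_mono) auto
    ultimately show ?thesis by linarith
  qed
  note count = card_floor_image_le[of "{m..m + 1}" _ f, OF range]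
  define F where "F = (\<lambda>\<beta>. \<lfloor>f \<beta>\<rfloor>) ` {m..m + 1}"
  have F: "finite F" "real (card F) \<le> 2 * \<omega> + 2"
    unfolding F_def using count assms(1) by auto
  have image: "(\<lambda>\<beta>. (\<lfloor>\<kappa> * (c * \<beta> * crit_orbit [] v \<beta>) + \<epsilon>\<rfloor>, itinerary [] v \<beta>)) ` {m..m + 1} = (\<lambda>i. (i, [])) ` F"
    unfolding F_def f_def by (auto simp: crit_orbit_Nil)
  have "card ((\<lambda>i. (i, [] :: int list)) ` F) = card F" by (rule card_image) (auto intro: inj_onI)
  moreover have "m * real (card F) \<le> m * (6 * \<omega>)" using F(2) assms by (intro mult_left_mono) auto
  ultimately show ?case unfolding image using F(1) by (simp add: mult.commute mult.left_commute)
next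
  case (Cons d cs)
  define f where "f \<beta> = \<kappa> * (c * \<beta> * crit_orbit (d # cs) v \<beta>) + \<epsilon>" for \<beta>
  have range: "\<epsilon> \<le> f \<beta> \<and> f \<beta> \<le> \<epsilon> + 2 * (\<omega> * (m + 1))" if "\<beta> \<in> {m..m + 1}" for \<beta>
  proof -
    have P: "0 \<le> crit_orbit (d # cs) v \<beta>" "crit_orbit (d # cs) v \<beta> \<le> 1"
      using crit_orbit_unit[of v "d # cs" \<beta>] assms(3) by auto
    have "0 \<le> \<kappa> * (c * \<beta> * crit_orbit (d # cs) v \<beta>)"
      using P Cons.prems that assms(2) by (intro mult_nonneg_nonneg) auto
    moreover have "\<kappa> * (c * \<beta> * crit_orbit (d # cs) v \<beta>) \<le> 2 * (\<omega> * (m + 1) * 1)"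
      using P Cons.prems that assms(1,2) by (intro mult_mono mult_nonneg_nonneg) auto
    ultimately show ?thesis by (simp add: f_def)
  qed
  note count = card_floor_image_le[of "{m..m + 1}" _ f, OF range]
  define F where "F = (\<lambda>\<beta>. \<lfloor>f \<beta>\<rfloor>) ` {m..m + 1}"
  have "2 * (\<omega> * (m + 1)) + 2 \<le> 6 * \<omega> * m"
  proof -
    have "1 * 1 \<le> \<omega> * m" "\<omega> * 1 \<le> \<omega> * m" using assms(1,2) by (intro mult_mono; simp)+
    then show ?thesis by (simp add: algebra_simps)
  qed
  then have F: "finite F" "real (card F) \<le> 6 * \<omega> * m"
    unfolding F_def using count assms(1,2) by auto
  define G where "G = (\<lambda>\<beta>. (\<lfloor>1 * (d * \<beta> * crit_orbit cs v \<beta>) + 0\<rfloor>, itinerary cs v \<beta>)) ` {m..m + 1}"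
  have G: "finite G" "m * real (card G) \<le> (6 * \<omega> * m) ^ Suc (length cs)"
    unfolding G_def using Cons.prems Cons.IH[of d 1 0] by auto
  define L where "L = (\<lambda>\<beta>. (\<lfloor>f \<beta>\<rfloor>, itinerary (d # cs) v \<beta>)) ` {m..m + 1}"
  have sub: "L \<subseteq> F \<times> (\<lambda>(i, is). i # is) ` G"
    unfolding L_def F_def G_def by force
  have "card L \<le> card (F \<times> (\<lambda>(i, is). i # is) ` G)" using F(1) G(1) sub by (intro card_mono) auto
  also have "\<dots> \<le> card F * card G"
    unfolding card_cartesian_product using card_image_le[OF G(1)] by (intro mult_le_mono2)
  finally have "real (card L) \<le> real (card F) * real (card G)" by (metis of_nat_le_iff of_nat_mult)
  then have "m * real (card L) \<le> m * (real (card F) * real (card G))" using assms(2) by (intro mult_left_mono) auto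
  also have "\<dots> = real (card F) * (m * real (card G))" by simp
  also have "\<dots> \<le> (6 * \<omega> * m) * (6 * \<omega> * m) ^ Suc (length cs)"
    using F(2) G(2) assms(1,2) by (intro mult_mono) auto
  finally have "m * real (card L) \<le> (6 * \<omega> * m) ^ Suc (length (d # cs))" by simp
  moreover have "finite L" using F(1) G(1) sub finite_subset by blast
  ultimately show ?case unfolding L_def f_def by blast
qed

lemma cover_of_small_fibres:
  fixes S :: "real set" and L :: "real \<Rightarrow> 'b"
  assumes "finite (L ` S)" "0 \<le> d"
    and "\<And>x y. x \<in> S \<Longrightarrow> y \<in> S \<Longrightarrow> L x = L y \<Longrightarrow> x \<le> y \<Longrightarrow> y - x \<le> d"
  obtains B where "B \<in> sets lebesgue" "S \<subseteq> B" "emeasure lebesgue B \<le> ennreal (real (card (L ` S)) * (2 * d))"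
proof -
  define r where "r l = (SOME x. x \<in> S \<and> L x = l)" for l
  have r: "r l \<in> S \<and> L (r l) = l" if "l \<in> L ` S" for l
    unfolding r_def by (rule someI_ex) (use that in blast)
  define B where "B = (\<Union>l\<in>L ` S. {r l - d..r l + d})"
  have "S \<subseteq> B"
  proof
    fix x assume x: "x \<in> S"
    then have "r (L x) \<in> S" "L (r (L x)) = L x" using r[of "L x"] by auto
    then have "x - r (L x) \<le> d \<or> x < r (L x)" "r (L x) - x \<le> d \<or> r (L x) < x"
      using assms(3)[of x "r (L x)"] assms(3)[of "r (L x)" x] x by force+
    then have "x \<in> {r (L x) - d..r (L x) + d}" using assms(2) by auto
    then show "x \<in> B" unfolding B_def using x by blast
  qed
  moreover have "emeasure lebesgue B \<le> ennreal (real (card (L ` S)) * (2 * d))"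
  proof -
    have "emeasure lebesgue B \<le> (\<Sum>l\<in>L ` S. emeasure lebesgue {r l - d..r l + d})"
      unfolding B_def using assms(1) by (intro emeasure_subadditive_finite) auto
    also have "\<dots> = (\<Sum>l\<in>L ` S. ennreal (2 * d))"
      using assms(2) by (intro sum.cong) (auto simp: emeasure_lborel_Icc)
    also have "\<dots> = ennreal (real (card (L ` S)) * (2 * d))"
      using assms(2) by (simp add: ennreal_mult ennreal_of_nat_eq_real_of_nat)
    finally show ?thesis .
  qed
  moreover have "B \<in> sets lebesgue" unfolding B_def using assms(1) by (intro sets.finite_UN) auto
  ultimately show thesis using that by blast
qed

text \<open>
  The exceptional parameters with a given itinerary and a given nearest multiple of 1/2 have
  diameter at most \<open>12/m\<^sup>j\<^sup>+\<^sup>1\<close>, where \<open>j\<close> is the length of the itinerary, by expansion.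
\<close>

lemma exceptional_single:
  assumes "1 < \<omega>" "12 \<le> m" "v \<in> {1/2..1}" "set cs \<subseteq> {1..\<omega>}" "c \<in> {1..\<omega>}"
  obtains B where "B \<in> sets lebesgue" "emeasure lebesgue B \<le> ennreal (24 * (6 * \<omega>) ^ Suc (length cs) / m)"
    "\<And>\<beta> h. \<beta> \<in> {m..m + 1} \<Longrightarrow> \<beta> \<notin> B \<Longrightarrow> 3 / \<beta> \<le> \<bar>c * \<beta> * crit_orbit cs v \<beta> - of_int h / 2\<bar>"
proof -
  define Q where "Q \<beta> = c * \<beta> * crit_orbit cs v \<beta>" for \<beta>
  define S where "S = {\<beta> \<in> {m..m + 1}. \<exists>h::int. \<bar>Q \<beta> - of_int h / 2\<bar> < 3 / \<beta>}"
  define L where "L \<beta> = (\<lfloor>2 * Q \<beta> + 1/2\<rfloor>, itinerary cs v \<beta>)" for \<beta>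
  define d where "d = 12 / m ^ Suc (length cs)"
  have labels: "finite (L ` {m..m + 1})" "m * real (card (L ` {m..m + 1})) \<le> (6 * \<omega> * m) ^ Suc (length cs)"
    using card_itineraries[OF assms(1) _ assms(3,4,5), of m 2 "1/2"] assms(2) unfolding L_def Q_def by auto
  have S_sub: "L ` S \<subseteq> L ` {m..m + 1}" unfolding S_def by blast
  then have "finite (L ` S)" using labels(1) finite_subset by blast
  moreover have "0 \<le> d" using assms(2) by (simp add: d_def)
  moreover have "y - x \<le> d" if xy: "x \<in> S" "y \<in> S" "L x = L y" "x \<le> y" for x y
  proof -
    have nearest: "\<bar>2 * Q \<beta> - of_int \<lfloor>2 * Q \<beta> + 1/2\<rfloor>\<bar> < 6 / m" if "\<beta> \<in> S" for \<beta>
    proof -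
      obtain h :: int where h: "\<bar>Q \<beta> - of_int h / 2\<bar> < 3 / \<beta>" "m \<le> \<beta>" using \<open>\<beta> \<in> S\<close> unfolding S_def by auto
      have "3 / \<beta> \<le> 3 / m" using h(2) assms(2) by (intro divide_left_mono) auto
      then have "\<bar>Q \<beta> - of_int h / 2\<bar> < 3 / m" using h(1) by linarith
      then have close: "\<bar>2 * Q \<beta> - of_int h\<bar> < 6 / m" by (simp add: abs_if field_simps split: if_splits)
      moreover have "6 / m \<le> 1/2" using assms(2) by (simp add: field_simps)
      ultimately have "\<bar>2 * Q \<beta> - of_int h\<bar> < 1/2" by linarith
      \<comment> \<open>the multiple of 1/2 close to \<open>Q \<beta>\<close> is unique, hence determined by the label\<close>
      then have "\<lfloor>2 * Q \<beta> + 1/2\<rfloor> = h" by linarith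
      then show ?thesis using close by simp
    qed
    have "\<lfloor>2 * Q x + 1/2\<rfloor> = \<lfloor>2 * Q y + 1/2\<rfloor>" "itinerary cs v x = itinerary cs v y"
      using xy(3) unfolding L_def by auto
    then have "Q y - Q x < 6 / m" using nearest[OF xy(1)] nearest[OF xy(2)] by linarith
    moreover have "m ^ length cs / 2 * (y - x) \<le> Q y - Q x"
      unfolding Q_def using xy(1,4) assms(2-5) \<open>itinerary cs v x = itinerary cs v y\<close>
      by (intro crit_orbit_expands) (auto simp: S_def)
    ultimately have "m ^ length cs / 2 * (y - x) < 6 / m" by linarith
    then show ?thesis using assms(2) by (simp add: d_def field_simps)
  qed
  ultimately obtain B where B: "B \<in> sets lebesgue" "S \<subseteq> B"
    "emeasure lebesgue B \<le> ennreal (real (card (L ` S)) * (2 * d))"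
    by (rule cover_of_small_fibres)
  have "real (card (L ` S)) * (2 * d) \<le> 24 * (6 * \<omega>) ^ Suc (length cs) / m"
  proof -
    have "m * real (card (L ` S)) \<le> (6 * \<omega> * m) ^ Suc (length cs)"
    proof -
      have "card (L ` S) \<le> card (L ` {m..m + 1})" using labels(1) S_sub by (rule card_mono)
      then have "m * real (card (L ` S)) \<le> m * real (card (L ` {m..m + 1}))"
        using assms(2) by (intro mult_left_mono) auto
      then show ?thesis using labels(2) by linarith
    qed
    then have "m * real (card (L ` S)) * (24 / m ^ Suc (length cs)) / m
        \<le> (6 * \<omega> * m) ^ Suc (length cs) * (24 / m ^ Suc (length cs)) / m"
      using assms(2) by (intro divide_right_mono mult_right_mono) auto
    also have "(6 * \<omega> * m) ^ Suc (length cs) * (24 / m ^ Suc (length cs)) / m = 24 * (6 * \<omega>) ^ Suc (length cs) / m"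
      using assms(2) unfolding power_mult_distrib[of "6 * \<omega>" m] by simp
    finally have "m * real (card (L ` S)) * (24 / m ^ Suc (length cs)) / m \<le> 24 * (6 * \<omega>) ^ Suc (length cs) / m" .
    moreover have "real (card (L ` S)) * (2 * d) = m * real (card (L ` S)) * (24 / m ^ Suc (length cs)) / m"
      using assms(2) by (simp add: d_def)
    ultimately show ?thesis by linarith
  qed
  then have "emeasure lebesgue B \<le> ennreal (24 * (6 * \<omega>) ^ Suc (length cs) / m)"
    using B(3) ennreal_leI order_trans by blast
  moreover have "3 / \<beta> \<le> \<bar>c * \<beta> * crit_orbit cs v \<beta> - of_int h / 2\<bar>" if "\<beta> \<in> {m..m + 1}" "\<beta> \<notin> B" for \<beta> h
  proof -
    have "\<beta> \<notin> S" using B(2) that(2) by blast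
    then show ?thesis using that(1) unfolding S_def Q_def by (auto simp: not_less)
  qed
  ultimately show thesis using B(1) that by blast
qed

lemma exceptional_unit_interval:
  assumes "1 < \<omega>"
  obtains K where "0 \<le> K" "\<And>m::nat. 12 \<le> m \<Longrightarrow> \<exists>B \<in> sets lebesgue. emeasure lebesgue B \<le> ennreal (K / real m) \<and>
    (\<forall>\<beta>\<in>{real m..real m + 1} - B. \<forall>cs\<in>lists {1, \<omega>}. length cs < N \<longrightarrow>
      (\<forall>c\<in>{1, \<omega>}. \<forall>v\<in>{1/2, 1}. \<forall>h::int. 3 / \<beta> \<le> \<bar>c * \<beta> * crit_orbit cs v \<beta> - of_int h / 2\<bar>))"
proof -
  define I where "I = {cs. set cs \<subseteq> {1, \<omega>} \<and> length cs \<le> N} \<times> {1, \<omega>} \<times> {1/2, 1::real}"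
  have "finite I" unfolding I_def by (intro finite_cartesian_product finite_lists_length_le) auto
  define w where "w = (\<lambda>(cs :: real list, c :: real, v :: real). 24 * (6 * \<omega>) ^ Suc (length cs))"
  define K where "K = (\<Sum>i\<in>I. w i)"
  have w: "0 \<le> w i" for i using assms by (auto simp: w_def split: prod.splits)
  then have "0 \<le> K" unfolding K_def by (rule sum_nonneg)
  moreover have "\<exists>B \<in> sets lebesgue. emeasure lebesgue B \<le> ennreal (K / real m) \<and>
    (\<forall>\<beta>\<in>{real m..real m + 1} - B. \<forall>cs\<in>lists {1, \<omega>}. length cs < N \<longrightarrow>
      (\<forall>c\<in>{1, \<omega>}. \<forall>v\<in>{1/2, 1}. \<forall>h::int. 3 / \<beta> \<le> \<bar>c * \<beta> * crit_orbit cs v \<beta> - of_int h / 2\<bar>))"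
    if m: "12 \<le> m" for m :: nat
  proof -
    define good where "good = (\<lambda>(cs, c, v) B. \<forall>\<beta>\<in>{real m..real m + 1} - B. \<forall>h::int.
      3 / \<beta> \<le> \<bar>c * \<beta> * crit_orbit cs v \<beta> - of_int h / 2\<bar>)"
    have "\<forall>i\<in>I. \<exists>B. B \<in> sets lebesgue \<and> emeasure lebesgue B \<le> ennreal (w i / real m) \<and> good i B"
    proof
      fix i assume "i \<in> I"
      then obtain cs c v where i: "i = (cs, c, v)" "set cs \<subseteq> {1, \<omega>}" "c \<in> {1, \<omega>}" "v \<in> {1/2, 1}"
        unfolding I_def by blast
      have sub: "{1, \<omega>} \<subseteq> {1..\<omega>}" using assms by auto
      then have pre: "set cs \<subseteq> {1..\<omega>}" "c \<in> {1..\<omega>}" using i(2,3) by blast+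
      have v: "v \<in> {1/2..1}" using i(4) by auto
      have "12 \<le> real m" using m by simp
      obtain B where B: "B \<in> sets lebesgue" "emeasure lebesgue B \<le> ennreal (24 * (6 * \<omega>) ^ Suc (length cs) / real m)"
        "\<And>\<beta> h. \<beta> \<in> {real m..real m + 1} \<Longrightarrow> \<beta> \<notin> B \<Longrightarrow> 3 / \<beta> \<le> \<bar>c * \<beta> * crit_orbit cs v \<beta> - of_int h / 2\<bar>"
        by (rule exceptional_single[OF assms \<open>12 \<le> real m\<close> v pre]) blast
      then show "\<exists>B. B \<in> sets lebesgue \<and> emeasure lebesgue B \<le> ennreal (w i / real m) \<and> good i B"
        unfolding i(1) w_def good_def by auto
    qed
    then obtain B where B: "\<And>i. i \<in> I \<Longrightarrow> B i \<in> sets lebesgue"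
      "\<And>i. i \<in> I \<Longrightarrow> emeasure lebesgue (B i) \<le> ennreal (w i / real m)" "\<And>i. i \<in> I \<Longrightarrow> good i (B i)"
      by metis
    have "emeasure lebesgue (\<Union>i\<in>I. B i) \<le> (\<Sum>i\<in>I. emeasure lebesgue (B i))"
      using \<open>finite I\<close> B(1) by (intro emeasure_subadditive_finite) auto
    also have "\<dots> \<le> (\<Sum>i\<in>I. ennreal (w i / real m))" using B(2) by (rule sum_mono)
    also have "\<dots> = ennreal (K / real m)"
      using w by (simp add: K_def sum_ennreal sum_divide_distrib)
    finally have "emeasure lebesgue (\<Union>i\<in>I. B i) \<le> ennreal (K / real m)" .
    moreover have "(\<Union>i\<in>I. B i) \<in> sets lebesgue" using \<open>finite I\<close> B(1) by (intro sets.finite_UN) auto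
    moreover have "3 / \<beta> \<le> \<bar>c * \<beta> * crit_orbit cs v \<beta> - of_int h / 2\<bar>"
      if "\<beta> \<in> {real m..real m + 1} - (\<Union>i\<in>I. B i)" "cs \<in> lists {1, \<omega>}" "length cs < N" "c \<in> {1, \<omega>}" "v \<in> {1/2, 1}"
      for \<beta> cs c v and h :: int
    proof -
      have "(cs, c, v) \<in> I" using that unfolding I_def by (auto simp: lists_eq_set)
      then show ?thesis using B(3)[of "(cs, c, v)"] that(1) unfolding good_def by auto
    qed
    ultimately show ?thesis by blast
  qed
  ultimately show thesis using that by blast
qed

lemma sum_inverse_le_ln:
  assumes "1 \<le> n"
  shows "(\<Sum>m=1..n. 1 / real m) \<le> 1 + ln (real n)"
proof -
  have "harm n - ln (real n) \<le> harm 1 - ln (real 1)"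
    using euler_mascheroni_sequence_decreasing[of 1 n] assms by simp
  then show ?thesis by (simp add: harm_def divide_inverse)
qed

section \<open>Parameters outside the exceptional set\<close>

lemma (in beta_system) separated_iff:
  "separated N \<longleftrightarrow> (\<forall>cs\<in>lists {1, \<omega>}. length cs < N \<longrightarrow>
     (\<forall>c\<in>{1, \<omega>}. \<forall>v\<in>{1/2, 1}. \<forall>h::int. 3 / \<beta> \<le> \<bar>c * \<beta> * crit_orbit cs v \<beta> - of_int h / 2\<bar>))"
proof -
  have slopes: "{\<beta>, \<omega> * \<beta>} = (\<lambda>c. c * \<beta>) ` {1, \<omega>}" by simp
  show ?thesis unfolding separated_def slopes lists_image crit_orbit_def by simp
qed

lemma (in beta_system) separated_antimono:
  assumes "separated M" "N \<le> M"
  shows "separated N"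
  unfolding separated_def
proof (intro ballI impI)
  fix bs and b v :: real
  assume bs: "bs \<in> lists {\<beta>, \<omega> * \<beta>}" "length bs < N" and bv: "b \<in> {\<beta>, \<omega> * \<beta>}" "v \<in> {1/2, 1}"
  then have "length bs < M" using assms(2) by simp
  then show "\<forall>h::int. 3 / \<beta> \<le> \<bar>b * foldr beta_map bs v - of_int h / 2\<bar>"
    using assms(1) bs(1) bv unfolding separated_def by blast
qed

lemma beta_system_conditions:
  assumes "1 < \<omega>" "2 * 10 ^ 12 * \<omega> ^ 6 \<le> \<beta>"
    and "\<forall>cs\<in>lists {1, \<omega>}. length cs < 6 \<longrightarrow>
     (\<forall>c\<in>{1, \<omega>}. \<forall>v\<in>{1/2, 1}. \<forall>h::int. 3 / \<beta> \<le> \<bar>c * \<beta> * crit_orbit cs v \<beta> - of_int h / 2\<bar>)"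
  shows "C1 (beta_maps \<omega> \<beta>) half_intervals \<and>
         distortion_const (beta_maps \<omega> \<beta>) half_intervals 0 \<and>
         (\<exists>K \<xi>. C2 (beta_maps \<omega> \<beta>) half_intervals K \<xi> \<and>
            (\<exists>n3 \<ge> n2 (beta_maps \<omega> \<beta>) half_intervals 0 K \<xi>.
               C3 (beta_maps \<omega> \<beta>) half_intervals
                 (n2 (beta_maps \<omega> \<beta>) half_intervals 0 K \<xi>) n3))"
proof -
  have "2 * 10 ^ 12 * 1 \<le> 2 * 10 ^ 12 * \<omega> ^ 6"
    using assms(1) by (intro mult_left_mono) (auto simp: one_le_power)
  then have "2 * 10 ^ 12 * 1 \<le> \<beta>" using assms(2) by (rule order_trans)
  then interpret beta_system \<omega> \<beta> by unfold_locales (use assms(1) in auto)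
  have sep: "separated 6" using assms(3) unfolding separated_iff .
  then have "separated 1" by (rule separated_antimono) simp
  then have n2: "n2 maps half_intervals 0 4 2 \<le> 6" using assms(2) by (rule n2_le_6)
  then have "C3 maps half_intervals (n2 maps half_intervals 0 4 2) (Suc 6)" by (rule C3_holds[OF sep])
  moreover have "n2 maps half_intervals 0 4 2 \<le> Suc 6" using n2 by simp
  ultimately show ?thesis using C1_holds distortion_const_0 C2_holds by blast
qed

text \<open>
  Parameters up to \<open>b0\<close> are discarded altogether; this is harmless since \<open>t - 1 \<le> b0 ln t\<close> for
  \<open>1 < t \<le> b0\<close>.  Beyond \<open>b0\<close> the harmonic sum is at most \<open>1 + ln t \<le> 2 ln t\<close>.
\<close>

lemma logarithmic_exceptional_set:
  assumes "12 \<le> b0" "0 \<le> K"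
    and "\<And>m::nat. 12 \<le> m \<Longrightarrow> \<exists>B \<in> sets lebesgue. emeasure lebesgue B \<le> ennreal (K / real m) \<and>
      (\<forall>\<beta>\<in>{real m..real m + 1} - B. P \<beta>)"
  obtains B C where "B \<subseteq> {1<..}" "B \<in> sets lebesgue" "0 < C"
    "\<And>t. 1 < t \<Longrightarrow> emeasure lebesgue (B \<inter> {1<..<t}) \<le> ennreal (C * ln t)"
    "\<And>\<beta>. 1 < \<beta> \<Longrightarrow> \<beta> \<notin> B \<Longrightarrow> b0 \<le> \<beta> \<and> P \<beta>"
proof -
  have "\<forall>m\<in>{12..}. \<exists>B. B \<in> sets lebesgue \<and> emeasure lebesgue B \<le> ennreal (K / real m) \<and>
      (\<forall>\<beta>\<in>{real m..real m + 1} - B. P \<beta>)"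
    using assms(3) by force
  then obtain D where D: "\<And>m. 12 \<le> m \<Longrightarrow> D m \<in> sets lebesgue"
    "\<And>m. 12 \<le> m \<Longrightarrow> emeasure lebesgue (D m) \<le> ennreal (K / real m)"
    "\<And>m \<beta>. 12 \<le> m \<Longrightarrow> \<beta> \<in> {real m..real m + 1} \<Longrightarrow> \<beta> \<notin> D m \<Longrightarrow> P \<beta>"
    unfolding bchoice_iff by (metis DiffI atLeast_iff)
  define D' where "D' m = D m \<inter> {real m..real m + 1}" for m
  have D': "D' m \<in> sets lebesgue" "emeasure lebesgue (D' m) \<le> ennreal (K / real m)" if "12 \<le> m" for m
  proof -
    show "D' m \<in> sets lebesgue" unfolding D'_def using D(1)[OF that] by (intro sets.Int) auto
    have "emeasure lebesgue (D' m) \<le> emeasure lebesgue (D m)"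
      unfolding D'_def using D(1)[OF that] by (intro emeasure_mono) auto
    then show "emeasure lebesgue (D' m) \<le> ennreal (K / real m)" using D(2)[OF that] by (rule order_trans)
  qed
  define B where "B = {1<..b0} \<union> (\<Union>m\<in>{12..}. D' m)"
  define C where "C = b0 + 2 * K"
  show thesis
  proof (rule that[of B C])
    show "B \<subseteq> {1<..}" unfolding B_def D'_def by force
    show "B \<in> sets lebesgue" unfolding B_def using D'(1) by (intro sets.Un sets.countable_UN') auto
    show "0 < C" using assms(1,2) by (simp add: C_def)
    show "b0 \<le> \<beta> \<and> P \<beta>" if \<beta>: "1 < \<beta>" "\<beta> \<notin> B" for \<beta>
    proof -
      have "b0 < \<beta>" using \<beta> unfolding B_def by auto
      define m where "m = nat \<lfloor>\<beta>\<rfloor>"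
      have "12 \<le> \<lfloor>\<beta>\<rfloor>" using \<open>b0 < \<beta>\<close> assms(1) by linarith
      then have "real m = of_int \<lfloor>\<beta>\<rfloor>" "12 \<le> m" unfolding m_def using nat_mono[of 12 "\<lfloor>\<beta>\<rfloor>"] by simp_all
      then have m: "12 \<le> m" "\<beta> \<in> {real m..real m + 1}" by auto
      moreover have "\<beta> \<notin> D m" using \<beta>(2) m unfolding B_def D'_def by auto
      ultimately show ?thesis using D(3) \<open>b0 < \<beta>\<close> by auto
    qed
    fix t :: real assume t: "1 < t"
    show "emeasure lebesgue (B \<inter> {1<..<t}) \<le> ennreal (C * ln t)"
    proof (cases "t \<le> b0")
      case True
      have "emeasure lebesgue (B \<inter> {1<..<t}) \<le> emeasure lebesgue {1..t}"
        by (rule emeasure_mono) auto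
      also have "\<dots> = ennreal (t - 1)" using t by simp
      also have "\<dots> \<le> ennreal (C * ln t)"
      proof (rule ennreal_leI)
        have "ln (1 / t) \<le> 1 / t - 1" using t by (intro ln_le_minus_one) auto
        then have "1 - 1 / t \<le> ln t" using t by (simp add: ln_div)
        then have "t * (1 - 1 / t) \<le> t * ln t" using t by (intro mult_left_mono) auto
        moreover have "t * (1 - 1 / t) = t - 1" using t by (simp add: field_simps)
        moreover have "t * ln t \<le> C * ln t"
          using True t assms(2) by (intro mult_right_mono) (auto simp: C_def)
        ultimately show "t - 1 \<le> C * ln t" by linarith
      qed
      finally show ?thesis .
    next
      case False
      define n where "n = nat \<lfloor>t\<rfloor>"
      have "12 \<le> t" using False assms(1) by linarith
      then have n: "1 \<le> n" "real n \<le> t" unfolding n_def by linarith+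
      have ln_t: "1 \<le> ln t"
      proof -
        have "exp 1 \<le> (3::real)" by (rule exp_le)
        then show ?thesis using \<open>12 \<le> t\<close> by (subst ln_ge_iff) auto
      qed
      have "B \<inter> {1<..<t} \<subseteq> {1..b0} \<union> (\<Union>m\<in>{12..n}. D' m)"
      proof
        fix x assume x: "x \<in> B \<inter> {1<..<t}"
        show "x \<in> {1..b0} \<union> (\<Union>m\<in>{12..n}. D' m)"
        proof (cases "x \<le> b0")
          case False
          then obtain m where m: "12 \<le> m" "x \<in> D' m" using x unfolding B_def by auto
          then have "real m \<le> t" using x unfolding D'_def by auto
          then have "m \<le> n" unfolding n_def by linarith
          then show ?thesis using m by auto
        qed (use x in auto)
      qed
      then have "emeasure lebesgue (B \<inter> {1<..<t}) \<le> emeasure lebesgue ({1..b0} \<union> (\<Union>m\<in>{12..n}. D' m))"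
        using D'(1) by (intro emeasure_mono sets.Un sets.finite_UN) auto
      also have "\<dots> \<le> emeasure lebesgue {1..b0} + emeasure lebesgue (\<Union>m\<in>{12..n}. D' m)"
        using D'(1) by (intro emeasure_subadditive sets.finite_UN) auto
      also have "\<dots> \<le> ennreal b0 + (\<Sum>m\<in>{12..n}. ennreal (K / real m))"
      proof (rule add_mono)
        show "emeasure lebesgue {1..b0} \<le> ennreal b0" using assms(1) by (simp add: ennreal_leI)
        have "emeasure lebesgue (\<Union>m\<in>{12..n}. D' m) \<le> (\<Sum>m\<in>{12..n}. emeasure lebesgue (D' m))"
          using D'(1) by (intro emeasure_subadditive_finite) auto
        also have "\<dots> \<le> (\<Sum>m\<in>{12..n}. ennreal (K / real m))" using D'(2) by (intro sum_mono) auto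
        finally show "emeasure lebesgue (\<Union>m\<in>{12..n}. D' m) \<le> (\<Sum>m\<in>{12..n}. ennreal (K / real m))" .
      qed
      also have "\<dots> = ennreal (b0 + (\<Sum>m\<in>{12..n}. K / real m))"
        using assms(1,2) by (simp add: sum_ennreal ennreal_plus sum_nonneg)
      also have "\<dots> \<le> ennreal (C * ln t)"
      proof (rule ennreal_leI)
        have "(\<Sum>m\<in>{12..n}. K / real m) \<le> (\<Sum>m=1..n. K / real m)"
          using assms(2) by (intro sum_mono2) auto
        also have "\<dots> = K * (\<Sum>m=1..n. 1 / real m)" by (simp add: sum_distrib_left)
        also have "\<dots> \<le> K * (1 + ln (real n))"
          using assms(2) sum_inverse_le_ln[OF n(1)] by (intro mult_left_mono)
        also have "\<dots> \<le> K * (2 * ln t)"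
        proof (rule mult_left_mono[OF _ assms(2)])
          have "ln (real n) \<le> ln t" using n by simp
          then show "1 + ln (real n) \<le> 2 * ln t" using ln_t by linarith
        qed
        finally have "(\<Sum>m\<in>{12..n}. K / real m) \<le> 2 * K * ln t" by simp
        moreover have "b0 * 1 \<le> b0 * ln t" using ln_t assms(1) by (intro mult_left_mono) auto
        ultimately show "b0 + (\<Sum>m\<in>{12..n}. K / real m) \<le> C * ln t" by (simp add: C_def distrib_right)
      qed
      finally show ?thesis .
    qed
  qed
qed

theorem proposition7p1:
  fixes \<omega> :: real
  assumes "\<omega> > 1"
  shows "\<exists>(B :: real set) (C :: real).
      B \<subseteq> {1<..} \<and> B \<in> sets lebesgue \<and> C > 0 \<and>
      (\<forall>t>1. emeasure lebesgue (B \<inter> {1<..<t}) \<le> ennreal (C * ln t)) \<and>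
      (\<forall>\<beta> \<in> {1<..} - B.
         C1 (beta_maps \<omega> \<beta>) half_intervals \<and>
         distortion_const (beta_maps \<omega> \<beta>) half_intervals 0 \<and>
         (\<exists>K \<xi>. C2 (beta_maps \<omega> \<beta>) half_intervals K \<xi> \<and>
            (\<exists>n3 \<ge> n2 (beta_maps \<omega> \<beta>) half_intervals 0 K \<xi>.
               C3 (beta_maps \<omega> \<beta>) half_intervals
                 (n2 (beta_maps \<omega> \<beta>) half_intervals 0 K \<xi>) n3)))"
proof -
  have "2 * 10 ^ 12 * 1 \<le> 2 * 10 ^ 12 * \<omega> ^ 6"
    using assms by (intro mult_left_mono) (auto simp: one_le_power)
  then have "12 \<le> 2 * 10 ^ 12 * \<omega> ^ 6" by (rule order_trans[rotated]) simp
  obtain K where K: "0 \<le> K" "\<And>m::nat. 12 \<le> m \<Longrightarrow> \<exists>B \<in> sets lebesgue. emeasure lebesgue B \<le> ennreal (K / real m) \<and>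
    (\<forall>\<beta>\<in>{real m..real m + 1} - B. \<forall>cs\<in>lists {1, \<omega>}. length cs < 6 \<longrightarrow>
      (\<forall>c\<in>{1, \<omega>}. \<forall>v\<in>{1/2, 1}. \<forall>h::int. 3 / \<beta> \<le> \<bar>c * \<beta> * crit_orbit cs v \<beta> - of_int h / 2\<bar>))"
    by (rule exceptional_unit_interval[OF assms, of 6]) blast
  show ?thesis
  proof (rule logarithmic_exceptional_set[OF \<open>12 \<le> 2 * 10 ^ 12 * \<omega> ^ 6\<close> K])
    fix B C
    assume B: "B \<subseteq> {1<..}" "B \<in> sets lebesgue" "0 < C"
      "\<And>t. 1 < t \<Longrightarrow> emeasure lebesgue (B \<inter> {1<..<t}) \<le> ennreal (C * ln t)"
      and good: "\<And>\<beta>. 1 < \<beta> \<Longrightarrow> \<beta> \<notin> B \<Longrightarrow> 2 * 10 ^ 12 * \<omega> ^ 6 \<le> \<beta> \<and>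
        (\<forall>cs\<in>lists {1, \<omega>}. length cs < 6 \<longrightarrow> (\<forall>c\<in>{1, \<omega>}. \<forall>v\<in>{1/2, 1}. \<forall>h::int.
          3 / \<beta> \<le> \<bar>c * \<beta> * crit_orbit cs v \<beta> - of_int h / 2\<bar>))"
    have "\<forall>\<beta> \<in> {1<..} - B.
         C1 (beta_maps \<omega> \<beta>) half_intervals \<and>
         distortion_const (beta_maps \<omega> \<beta>) half_intervals 0 \<and>
         (\<exists>K \<xi>. C2 (beta_maps \<omega> \<beta>) half_intervals K \<xi> \<and>
            (\<exists>n3 \<ge> n2 (beta_maps \<omega> \<beta>) half_intervals 0 K \<xi>.
               C3 (beta_maps \<omega> \<beta>) half_intervals
                 (n2 (beta_maps \<omega> \<beta>) half_intervals 0 K \<xi>) n3))"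
    proof
      fix \<beta> assume "\<beta> \<in> {1<..} - B"
      then have "1 < \<beta>" "\<beta> \<notin> B" by auto
      note g = good[OF this]
      show "C1 (beta_maps \<omega> \<beta>) half_intervals \<and>
         distortion_const (beta_maps \<omega> \<beta>) half_intervals 0 \<and>
         (\<exists>K \<xi>. C2 (beta_maps \<omega> \<beta>) half_intervals K \<xi> \<and>
            (\<exists>n3 \<ge> n2 (beta_maps \<omega> \<beta>) half_intervals 0 K \<xi>.
               C3 (beta_maps \<omega> \<beta>) half_intervals
                 (n2 (beta_maps \<omega> \<beta>) half_intervals 0 K \<xi>) n3))"
        by (rule beta_system_conditions[OF assms conjunct1[OF g] conjunct2[OF g]])
    qed
    then show ?thesis using B by blast
  qed
qed

end
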